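(* Let $V$ be a closed isometric operator in a Hilbert space $H$, and let $\Delta$ be an open arc of $\mathbb{T}$ such that $\zeta^{-1}$ is a point of the regular type of $V$ for all $\zeta\in\Delta$. Let $z_0\in\mathbb{D}$ be an arbitrary fixed point, put $$\Delta_1=\left\{\widetilde t:\ \widetilde t=\frac{\lambda-z_0}{1-\overline{z_0}\lambda},\ \lambda\in\Delta\right\},$$ and let the following condition be satisfied: $$P^H_{M_{1/\overline{z_0}}}M_{\frac{z_0+\zeta}{1+\zeta\overline{z_0}}}=M_{1/\overline{z_0}},\qquad\forall\zeta\in\Delta_1.$$ Let $\mathbf{R}_z=\mathbf{R}_z(V)$ be an arbitrary generalized resolvent of $V$, and let $C(\lambda;z_0)\in\mathcal{S}(N_{z_0};N_{1/\overline{z_0}})$ correspond to $\mathbf{R}_z(V)$ by Inin's formula. Then $\mathbf{R}_z(V)$ has an analytic continuation to the set $\mathbb{D}\cup\mathbb{D}_e\cup\Delta$ if and only if the following conditions are satisfied: 1) $C(\lambda;z_0)$ has an extension to the set $\mathbb{D}\cup\Delta$ which is continuous in the uniform operator (norm) topology; 2) the extended $C(\lambda;z_0)$ maps $N_{z_0}$ isometrically onto the whole of $N_{1/\overline{z_0}}$, for all $\lambda\in\Delta$; 3) the operator $C(\lambda;z_0)-W_{\lambda;z_0}$ is invertible for all $\lambda\in\Delta$, and $$(C(\lambda;z_0)-W_{\lambda;z_0})N_{z_0}=N_{1/\overline{z_0}},\qquad\forall\lambda\in\Delta.$$ Here $W_{\lambda;z_0}$ is defined by the equality $$W_{\lambda;z_0}P^H_{N_{z_0}}f=\frac{1-\overline{z_0}\lambda}{\lambda-z_0}P^H_{N_{1/\overline{z_0}}}f,\qquad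 f\in N_\lambda,\ \lambda\in\mathbb{T}.$$
   Context: All Hilbert spaces are complex and separable. $\mathbb{D}=\{|z|<1\}$, $\mathbb{D}_e=\{|z|>1\}$, $\mathbb{T}=\{|z|=1\}$, $\mathbb{T}_e=\mathbb{D}\cup\mathbb{D}_e$. A closed isometric operator $V$ in $H$ is a linear isometry defined on a closed subspace $D(V)\subseteq H$ with range $R(V)\subseteq H$. $E_H$ is the identity on $H$, and $P^H_L$ is the orthogonal projection of $H$ onto a closed subspace $L$. "Invertible" means injective, so that the inverse exists on the range. Generalized resolvent: if $U\supseteq V$ is a unitary operator in a Hilbert space $\widetilde H\supseteq H$, the function $\mathbf{R}_\zeta h=P^{\widetilde H}_H(E_{\widetilde H}-\zeta U)^{-1}h$, $h\in H$, $\zeta\in\mathbb{T}_e$, is a generalized resolvent of $V$. An analytic continuation to $\mathbb{D}\cup\mathbb{D}_e\cup\Delta$ means an analytic operator-valued function on this set that coincides with $\mathbf{R}_z$ on $\mathbb{D}\cup\mathbb{D}_e$. Set $M_\zeta=(E_H-\zeta V)D(V)$, $N_\zeta=H\ominus M_\zeta$ for $\zeta\in\mathbb{C}$ (orthogonal complement), and $M_\infty=R(V)$, $N_\infty=H\ominus R(V)$; for $z_0=0$ the symbol $1/\overline{z_0}$ means $\infty$. For $z\in\mathbb{D}$ put $V_z=(V-\overline zE_H)(E_H-zV)^{-1}$, an isometric operator with domain $M_z$ and range $M_{1/\overline z}$. A point $\lambda\in\mathbb{C}$ is a point of the regular type of $V$ if $V-\lambda E_H$ has a bounded inverse defined on its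 range. For a linear contraction $C$ with $D(C)=N_{z_0}$, $R(C)\subseteq N_{1/\overline{z_0}}$, set $V^+_{z_0;C}=V_{z_0}\oplus C$ (a bounded operator on $H=M_{z_0}\oplus N_{z_0}$) and $$V_{C;z_0}=(V^+_{z_0;C}+\overline{z_0}E_H)(E_H+z_0V^+_{z_0;C})^{-1}.$$ $\mathcal{S}(H_1;H_2)$ is the set of all analytic operator-valued functions $F$ on $\mathbb{D}$ whose values $F(\zeta)$ are linear contractions with domain $H_1$ and range contained in $H_2$. Inin's formula (known): for fixed $z_0\in\mathbb{D}$, $$\mathbf{R}_\zeta=\left[E_H-\zeta V_{C(\zeta;z_0);z_0}\right]^{-1},\quad\zeta\in\mathbb{D},$$ establishes a one-to-one correspondence between all generalized resolvents of $V$ and all functions $C(\zeta)=C(\zeta;z_0)\in\mathcal{S}(N_{z_0};N_{1/\overline{z_0}})$. The operator $W_{\lambda;z_0}$ has domain $P^H_{N_{z_0}}N_\lambda$; it is well defined, and for $\lambda\in\mathbb{T}$ such that $\lambda^{-1}$ is a point of the regular type of $V$ its domain is $N_{z_0}$ and its range is $N_{1/\overline{z_0}}$. *)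

theory Defs
  imports "HOL-Analysis.Analysis"
begin

section \<open>Complex separable Hilbert spaces\<close>

class scaleC =
  fixes scaleC :: "complex \<Rightarrow> 'a \<Rightarrow> 'a" (infixr "*\<^sub>C" 75)

text \<open>The real inner product and the norm of \<open>real_inner\<close> are those induced by the complex inner
  product, which is linear in its first argument.\<close>

class complex_inner = real_inner + scaleC +
  fixes cinner :: "'a \<Rightarrow> 'a \<Rightarrow> complex"
  assumes scaleC_add_right: "c *\<^sub>C (x + y) = c *\<^sub>C x + c *\<^sub>C y"
    and scaleC_add_left: "(c + d) *\<^sub>C x = c *\<^sub>C x + d *\<^sub>C x"
    and scaleC_scaleC: "c *\<^sub>C d *\<^sub>C x = (c * d) *\<^sub>C x"
    and scaleR_scaleC: "r *\<^sub>R x = complex_of_real r *\<^sub>C x"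
    and cinner_commute: "cinner x y = cnj (cinner y x)"
    and cinner_add_left: "cinner (x + y) z = cinner x z + cinner y z"
    and cinner_scaleC_left: "cinner (c *\<^sub>C x) y = c * cinner x y"
    and inner_eq_Re_cinner: "inner x y = Re (cinner x y)"

text \<open>\<open>polish_space\<close> adds completeness and separability.\<close>

class complex_hilbert = complex_inner + polish_space

instantiation complex :: complex_hilbert
begin

definition scaleC_complex :: "complex \<Rightarrow> complex \<Rightarrow> complex"
  where "scaleC_complex c x = c * x"

definition cinner_complex :: "complex \<Rightarrow> complex \<Rightarrow> complex"
  where "cinner_complex x y = x * cnj y"

instance
  by standard
    (simp_all add: scaleC_complex_def cinner_complex_def inner_complex_def scaleR_conv_of_real
      algebra_simps)

end

global_interpretation complex_vector: vector_space "scaleC :: complex \<Rightarrow> 'a \<Rightarrow> 'a::complex_inner"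
  defines csubspace = complex_vector.subspace
proof
  show "c *\<^sub>C (x + y) = c *\<^sub>C x + c *\<^sub>C y" for c :: complex and x y :: 'a
    by (rule scaleC_add_right)
  show "(c + d) *\<^sub>C x = c *\<^sub>C x + d *\<^sub>C x" for c d :: complex and x :: 'a
    by (rule scaleC_add_left)
  show "c *\<^sub>C d *\<^sub>C x = (c * d) *\<^sub>C x" for c d :: complex and x :: 'a
    by (rule scaleC_scaleC)
  show "1 *\<^sub>C x = x" for x :: 'a
    using scaleR_scaleC[of 1 x] by simp
qed

definition orth_compl :: "'a::complex_inner set \<Rightarrow> 'a set"
  where "orth_compl L = {x. \<forall>y\<in>L. cinner x y = 0}"

definition orth_proj :: "'a::complex_inner set \<Rightarrow> 'a \<Rightarrow> 'a"
  where "orth_proj L x = (THE y. y \<in> L \<and> x - y \<in> orth_compl L)"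

section \<open>Operators defined on subspaces\<close>

text \<open>An operator with domain \<open>L\<close> is a total function of which only the values on \<open>L\<close> matter.\<close>

definition clinear_on :: "'a::complex_inner set \<Rightarrow> ('a \<Rightarrow> 'b::complex_inner) \<Rightarrow> bool"
  where "clinear_on L T \<longleftrightarrow>
    (\<forall>x\<in>L. \<forall>y\<in>L. T (x + y) = T x + T y) \<and> (\<forall>c. \<forall>x\<in>L. T (c *\<^sub>C x) = c *\<^sub>C T x)"

definition bounded_clinear_on :: "'a::complex_inner set \<Rightarrow> ('a \<Rightarrow> 'b::complex_inner) \<Rightarrow> bool"
  where "bounded_clinear_on L T \<longleftrightarrow> clinear_on L T \<and> (\<exists>K. \<forall>x\<in>L. norm (T x) \<le> K * norm x)"

definition contraction_on :: "'a::complex_inner set \<Rightarrow> ('a \<Rightarrow> 'b::complex_inner) \<Rightarrow> bool"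
  where "contraction_on L T \<longleftrightarrow> clinear_on L T \<and> (\<forall>x\<in>L. norm (T x) \<le> norm x)"

definition isometry_on :: "'a::complex_inner set \<Rightarrow> ('a \<Rightarrow> 'b::complex_inner) \<Rightarrow> bool"
  where "isometry_on L T \<longleftrightarrow> clinear_on L T \<and> (\<forall>x\<in>L. norm (T x) = norm x)"

definition unitary_op :: "('a::complex_inner \<Rightarrow> 'a) \<Rightarrow> bool"
  where "unitary_op U \<longleftrightarrow> isometry_on UNIV U \<and> surj U"

text \<open>Convergence in the uniform operator topology of operators with domain \<open>L\<close> is uniform
  convergence on the closed unit ball of \<open>L\<close>.\<close>

definition op_continuous_on ::
    "'a::complex_inner set \<Rightarrow> complex set \<Rightarrow> (complex \<Rightarrow> 'a \<Rightarrow> 'b::complex_inner) \<Rightarrow> bool"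
  where "op_continuous_on L S F \<longleftrightarrow>
    (\<forall>z\<in>S. bounded_clinear_on L (F z) \<and>
      uniform_limit (L \<inter> cball 0 1) F (F z) (at z within S))"

text \<open>Complex differentiability in the uniform operator topology; intended for open \<open>S\<close>.\<close>

definition op_analytic_on ::
    "'a::complex_inner set \<Rightarrow> complex set \<Rightarrow> (complex \<Rightarrow> 'a \<Rightarrow> 'b::complex_inner) \<Rightarrow> bool"
  where "op_analytic_on L S F \<longleftrightarrow>
    (\<forall>z\<in>S. bounded_clinear_on L (F z) \<and>
      (\<exists>F'. bounded_clinear_on L F' \<and>
        uniform_limit (L \<inter> cball 0 1) (\<lambda>w x. inverse (w - z) *\<^sub>C (F w x - F z x)) F' (at z)))"

definition schur_class ::
    "'a::complex_inner set \<Rightarrow> 'b::complex_inner set \<Rightarrow> (complex \<Rightarrow> 'a \<Rightarrow> 'b) set"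
  where "schur_class L1 L2 =
    {F. op_analytic_on L1 (ball 0 1) F \<and>
      (\<forall>\<zeta>\<in>ball 0 1. contraction_on L1 (F \<zeta>) \<and> F \<zeta> ` L1 \<subseteq> L2)}"

section \<open>Isometric operators and their generalized resolvents\<close>

definition closed_isometric_op :: "'a::complex_hilbert set \<Rightarrow> ('a \<Rightarrow> 'a) \<Rightarrow> bool"
  where "closed_isometric_op D V \<longleftrightarrow> csubspace D \<and> closed D \<and> isometry_on D V"

definition regular_type_point :: "'a::complex_hilbert set \<Rightarrow> ('a \<Rightarrow> 'a) \<Rightarrow> complex \<Rightarrow> bool"
  where "regular_type_point D V \<mu> \<longleftrightarrow>
    (let T = (\<lambda>f. V f - \<mu> *\<^sub>C f) in
      inj_on T D \<and> (\<exists>K. \<forall>g \<in> T ` D. norm (inv_into D T g) \<le> K * norm g))"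

text \<open>The unitary operator \<open>U\<close> acts in a Hilbert space \<open>'k\<close> into which \<open>'a\<close> is embedded by \<open>J\<close>;
  the value of the generalized resolvent is transported back along \<open>J\<close>.\<close>

definition generalized_resolvent ::
    "'k::complex_hilbert itself \<Rightarrow> 'a::complex_hilbert set \<Rightarrow> ('a \<Rightarrow> 'a)
      \<Rightarrow> (complex \<Rightarrow> 'a \<Rightarrow> 'a) \<Rightarrow> bool"
  where "generalized_resolvent _ D V R \<longleftrightarrow>
    (\<exists>(J :: 'a \<Rightarrow> 'k) U. isometry_on UNIV J \<and> unitary_op U \<and> (\<forall>f\<in>D. U (J f) = J (V f)) \<and>
      (\<forall>\<zeta>. norm \<zeta> \<noteq> 1 \<longrightarrow>
        (\<forall>h. J (R \<zeta> h) = orth_proj (range J) (inv (\<lambda>x. x - \<zeta> *\<^sub>C U x) (J h)))))"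

definition M_space :: "'a::complex_hilbert set \<Rightarrow> ('a \<Rightarrow> 'a) \<Rightarrow> complex \<Rightarrow> 'a set"
  where "M_space D V \<zeta> = (\<lambda>f. f - \<zeta> *\<^sub>C V f) ` D"

definition N_space :: "'a::complex_hilbert set \<Rightarrow> ('a \<Rightarrow> 'a) \<Rightarrow> complex \<Rightarrow> 'a set"
  where "N_space D V \<zeta> = orth_compl (M_space D V \<zeta>)"

text \<open>\<open>M_refl D V z\<close> and \<open>N_refl D V z\<close> are the spaces $M_{1/\bar z}$ and $N_{1/\bar z}$,
  where $1/\bar 0 = \infty$ and $M_\infty = R(V)$.\<close>

definition M_refl :: "'a::complex_hilbert set \<Rightarrow> ('a \<Rightarrow> 'a) \<Rightarrow> complex \<Rightarrow> 'a set"
  where "M_refl D V z = (if z = 0 then V ` D else M_space D V (1 / cnj z))"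

definition N_refl :: "'a::complex_hilbert set \<Rightarrow> ('a \<Rightarrow> 'a) \<Rightarrow> complex \<Rightarrow> 'a set"
  where "N_refl D V z = orth_compl (M_refl D V z)"

text \<open>The operator $V_z$ with domain $M_z$, the operator $V^+_{z;C}$ on the whole space, and the
  operator $V_{C;z}$.\<close>

definition V_shift :: "'a::complex_hilbert set \<Rightarrow> ('a \<Rightarrow> 'a) \<Rightarrow> complex \<Rightarrow> 'a \<Rightarrow> 'a"
  where "V_shift D V z g =
    (let f = inv_into D (\<lambda>f. f - z *\<^sub>C V f) g in V f - cnj z *\<^sub>C f)"

definition V_plus ::
    "'a::complex_hilbert set \<Rightarrow> ('a \<Rightarrow> 'a) \<Rightarrow> complex \<Rightarrow> ('a \<Rightarrow> 'a) \<Rightarrow> 'a \<Rightarrow> 'a"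
  where "V_plus D V z C h =
    V_shift D V z (orth_proj (M_space D V z) h) + C (orth_proj (N_space D V z) h)"

definition V_ext ::
    "'a::complex_hilbert set \<Rightarrow> ('a \<Rightarrow> 'a) \<Rightarrow> complex \<Rightarrow> ('a \<Rightarrow> 'a) \<Rightarrow> 'a \<Rightarrow> 'a"
  where "V_ext D V z C g =
    (let f = inv (\<lambda>f. f + z *\<^sub>C V_plus D V z C f) g in V_plus D V z C f + cnj z *\<^sub>C f)"

text \<open>Inin's formula.\<close>

definition corresponds_Inin ::
    "'a::complex_hilbert set \<Rightarrow> ('a \<Rightarrow> 'a) \<Rightarrow> complex \<Rightarrow> (complex \<Rightarrow> 'a \<Rightarrow> 'a)
      \<Rightarrow> (complex \<Rightarrow> 'a \<Rightarrow> 'a) \<Rightarrow> bool"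
  where "corresponds_Inin D V z0 C R \<longleftrightarrow>
    (\<forall>\<zeta>\<in>ball 0 1. \<forall>h. R \<zeta> h = inv (\<lambda>x. x - \<zeta> *\<^sub>C V_ext D V z0 (C \<zeta>) x) h)"

text \<open>The operator $W_{\mu;z_0}$ with domain $P^H_{N_{z_0}} N_\mu$.\<close>

definition W_op ::
    "'a::complex_hilbert set \<Rightarrow> ('a \<Rightarrow> 'a) \<Rightarrow> complex \<Rightarrow> complex \<Rightarrow> 'a \<Rightarrow> 'a"
  where "W_op D V \<mu> z0 g =
    (THE k. \<exists>f \<in> N_space D V \<mu>. g = orth_proj (N_space D V z0) f \<and>
      k = ((1 - cnj z0 * \<mu>) / (\<mu> - z0)) *\<^sub>C orth_proj (N_refl D V z0) f)"

definition open_arc :: "complex set \<Rightarrow> bool"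
  where "open_arc \<Delta> \<longleftrightarrow> (\<exists>a b. a < b \<and> b \<le> a + 2 * pi \<and> \<Delta> = cis ` {a<..<b})"

end

theory Submission
  imports Defs "HOL-Complex_Analysis.Complex_Analysis"
begin

text \<open>
  Write \<open>E\<close> for the identity, $M = M_{z_0}$, $A = V_{z_0}$, $M' = AM = M_{1/\bar z_0}$, and let $N$, $N'$ be
  the orthogonal complements of $M$, $M'$. Put $T(\zeta) = A \oplus C(\zeta)$ and
  $w = (\zeta - z_0)/(1 - \bar z_0\zeta)$. A change of variable in Inin's formula gives
  $(E - wT(\zeta))^{-1} = \alpha(\zeta) R_\zeta + \beta(\zeta) E$ with scalar functions that are analytic
  near the arc (\<open>shifted_resolvent_left\<close>, \<open>shifted_resolvent_right\<close>). Continuing the resolvent thus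
  amounts to continuing the inverse of $E - wT$.

  The link between the two sides of the circle is the symmetry $R_{1/\bar\zeta} = E - R_\zeta^*$. If $R$
  continues to $F$, then $F + F^* = E$ on the arc, and the same relation holds for
  $G = \alpha F + \beta E$. An operator with $G + G^* = E$ has real part $1/2$, so it is invertible with
  $\|G^{-1}\| \le 2$, and $E - G^{-1}$ is unitary (locale \<open>half_real_part\<close>). Since
  $wT = E - G^{-1}$ inside the disc and inversion is norm continuous under a common bound of the inverses
  (\<open>op_tendsto_inverse\<close>), $T$ extends continuously to the arc with unitary values that agree with $A$ on
  $M$. Restriction to $N$ gives the extension of $C$ and its unitarity from $N$ to $N'$.

  The condition on $C - W$ is the bijectivity of $E - wT$ at a boundary point
  (\<open>bij_one_minus_ext_iff\<close>). For $f \in N_\lambda$ the components of $f - wTf$ in $M'$ cancel and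
  $(E - wT)f = -w(C - W)P_N f \in N'$, while $(E - wT)g = (E - wA)g$ for $g \in M$. The projection
  hypothesis gives $P_N N_\lambda = N$, so $H = N_\lambda + M$, and $N' + (E - wA)M = H$; regularity makes
  the latter sum direct. Hence $E - wT$ is a bijection exactly when $C - W$ is one from $N$ onto $N'$.

  Conversely, let $C$ have boundary values with the stated properties. Then $E - wT$ is bijective on the
  arc with $T$ unitary, its inverse $G$ satisfies $G + G^* = E$ and is therefore bounded by the
  Hellinger--Toeplitz theorem. Being bounded below is stable under small perturbations, so the
  resolvents converge in norm from inside the disc, and by symmetry also from outside, weakly and to the
  same limit, as $F + F^* = E$. The matrix coefficients of the resulting $F$ are continuous across the
  arc and holomorphic off it, hence holomorphic (\<open>holomorphic_on_paste_across_circle\<close>). A weakly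
  holomorphic, locally bounded operator function is analytic in norm
  (\<open>op_analytic_on_of_weakly_holomorphic\<close>).
\<close>

section \<open>Complex inner products\<close>

lemma cinner_add_right: "cinner x (y + z) = cinner x y + cinner x z"
  by (metis cinner_add_left cinner_commute complex_cnj_add)

lemma cinner_scaleC_right: "cinner x (c *\<^sub>C y) = cnj c * cinner x y"
  by (metis cinner_commute cinner_scaleC_left complex_cnj_mult)

text \<open>As a rewrite rule this equation does not terminate on \<open>complex\<close>, where the factor \<open>-1\<close> is
  itself a vector; it is applied to explicit instances only.\<close>

lemma uminus_eq_scaleC: "- x = (-1::complex) *\<^sub>C (x::'a::complex_inner)"
  using scaleR_scaleC[of "-1" x] by simp

lemma cinner_minus_left: "cinner (- x) y = - cinner x y"
  using cinner_scaleC_left[of "-1" x y] by (simp flip: uminus_eq_scaleC[of x])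

lemma cinner_minus_right: "cinner x (- y) = - cinner x y"
  using cinner_scaleC_right[of x "-1" y] by (simp flip: uminus_eq_scaleC[of y])

lemma cinner_diff_left: "cinner (x - y) z = cinner x z - cinner y z"
  by (simp only: diff_conv_add_uminus cinner_add_left cinner_minus_left)

lemma cinner_diff_right: "cinner x (y - z) = cinner x y - cinner x z"
  by (simp only: diff_conv_add_uminus cinner_add_right cinner_minus_right)

lemma cinner_zero_left [simp]: "cinner 0 x = 0"
  using cinner_diff_left[of x x x] by simp

lemma cinner_zero_right [simp]: "cinner x 0 = 0"
  using cinner_diff_right[of x x x] by simp

lemmas cinner_linear = cinner_add_left cinner_add_right cinner_diff_left cinner_diff_right
  cinner_scaleC_left cinner_scaleC_right

lemma cinner_self: "cinner x x = complex_of_real ((norm x)\<^sup>2)"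
proof -
  have "Im (cinner x x) = 0"
    using cinner_commute[of x x] by (metis complex_cnj_cancel_iff Reals_cnj_iff complex_is_Real_iff)
  then show ?thesis
    by (simp add: complex_eq_iff inner_eq_Re_cinner[symmetric] power2_norm_eq_inner)
qed

lemma cinner_self_eq_zero: "cinner x x = 0 \<longleftrightarrow> x = 0"
  by (simp add: cinner_self)

lemma cinner_eq_zero_sym: "cinner x y = 0 \<longleftrightarrow> cinner y x = 0"
  by (metis cinner_commute complex_cnj_zero)

lemma cinner_left_cancel:
  assumes "\<And>y. cinner x y = cinner x' y"
  shows "x = x'"
  using assms[of "x - x'"] cinner_self_eq_zero[of "x - x'"] by (simp add: cinner_diff_left)

lemma norm_scaleC: "norm (c *\<^sub>C (x::'a::complex_inner)) = norm c * norm x"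
proof -
  have "complex_of_real ((norm (c *\<^sub>C x))\<^sup>2) = complex_of_real ((norm c * norm x)\<^sup>2)"
    using cinner_self[of "c *\<^sub>C x"] cinner_self[of x] complex_norm_square[of c]
    by (simp add: cinner_scaleC_left cinner_scaleC_right power_mult_distrib ac_simps)
  then have "(norm (c *\<^sub>C x))\<^sup>2 = (norm c * norm x)\<^sup>2"
    using of_real_eq_iff by blast
  then show ?thesis
    by (simp add: power2_eq_iff_nonneg)
qed

text \<open>Rotating \<open>x\<close> by a unimodular factor makes the inner product real, which reduces the complex
  Cauchy--Schwarz inequality to the real one.\<close>

lemma norm_cinner_le: "norm (cinner x y) \<le> norm x * norm y"
proof -
  define c where "c = (if cinner x y = 0 then 1 else cnj (sgn (cinner x y)))"
  have nc: "norm c = 1"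
    by (simp add: c_def norm_sgn)
  have "cinner (c *\<^sub>C x) y = complex_of_real (norm (cinner x y))"
    using complex_norm_square[of "cinner x y"]
    by (auto simp: c_def cinner_scaleC_left sgn_div_norm scaleR_conv_of_real divide_simps
        power2_eq_square mult.commute)
  then have "norm (cinner x y) = inner (c *\<^sub>C x) y"
    by (simp add: inner_eq_Re_cinner)
  also have "\<dots> \<le> norm (c *\<^sub>C x) * norm y"
    by (rule norm_cauchy_schwarz)
  finally show ?thesis
    by (simp add: norm_scaleC nc)
qed

text \<open>Norm bounds will be read off from matrix coefficients.\<close>

lemma norm_le_cinner:
  fixes x :: "'a::complex_inner"
  assumes "0 \<le> K" and "\<And>y. norm (cinner x y) \<le> K * norm y"
  shows "norm x \<le> K"
proof (cases "x = 0")
  case False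
  have "norm x * norm x \<le> K * norm x"
    using assms(2)[of x] by (simp add: cinner_self power2_eq_square norm_mult)
  then show ?thesis
    using False by simp
qed (use assms(1) in simp)

lemma tendsto_cinner_left:
  assumes "(f \<longlongrightarrow> l) F"
  shows "((\<lambda>t. cinner (f t) y) \<longlongrightarrow> cinner l y) F"
proof -
  have "((\<lambda>t. norm (f t - l) * norm y) \<longlongrightarrow> 0) F"
    using tendsto_norm_zero[OF LIM_zero[OF assms]] tendsto_mult_left_zero by blast
  moreover have "\<forall>\<^sub>F t in F. norm (cinner (f t) y - cinner l y) \<le> norm (f t - l) * norm y"
    by (rule always_eventually) (metis cinner_diff_left norm_cinner_le)
  ultimately have "((\<lambda>t. cinner (f t) y - cinner l y) \<longlongrightarrow> 0) F"
    by (rule Lim_null_comparison[rotated])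
  then show ?thesis
    by (simp add: LIM_zero_iff)
qed

lemma tendsto_cinner_right:
  assumes "(f \<longlongrightarrow> l) F"
  shows "((\<lambda>t. cinner y (f t)) \<longlongrightarrow> cinner y l) F"
proof -
  have "((\<lambda>t. cnj (cinner (f t) y)) \<longlongrightarrow> cnj (cinner l y)) F"
    by (rule tendsto_cnj[OF tendsto_cinner_left[OF assms]])
  then show ?thesis
    by (simp only: cinner_commute[symmetric])
qed

lemma tendsto_scaleC:
  assumes "(c \<longlongrightarrow> c0) F" and "(f \<longlongrightarrow> l) F"
  shows "((\<lambda>t. c t *\<^sub>C (f t :: 'a::complex_inner)) \<longlongrightarrow> c0 *\<^sub>C l) F"
proof -
  have eq: "c t *\<^sub>C f t - c0 *\<^sub>C l = c t *\<^sub>C (f t - l) + (c t - c0) *\<^sub>C l" for t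
    by (simp add: complex_vector.scale_right_diff_distrib complex_vector.scale_left_diff_distrib)
  have "((\<lambda>t. norm (c t) * norm (f t - l) + norm (c t - c0) * norm l) \<longlongrightarrow> norm c0 * 0 + 0 * norm l) F"
    by (intro tendsto_intros assms tendsto_norm_zero LIM_zero)
  then have "((\<lambda>t. norm (c t) * norm (f t - l) + norm (c t - c0) * norm l) \<longlongrightarrow> 0) F"
    by simp
  moreover have "\<forall>\<^sub>F t in F. norm (c t *\<^sub>C f t - c0 *\<^sub>C l)
      \<le> norm (c t) * norm (f t - l) + norm (c t - c0) * norm l"
    by (rule always_eventually) (metis eq norm_scaleC norm_triangle_ineq)
  ultimately have "((\<lambda>t. c t *\<^sub>C f t - c0 *\<^sub>C l) \<longlongrightarrow> 0) F"
    by (rule Lim_null_comparison[rotated])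
  then show ?thesis
    by (simp add: LIM_zero_iff)
qed

lemma clinear_onI:
  assumes "\<And>x y. x \<in> L \<Longrightarrow> y \<in> L \<Longrightarrow> T (x + y) = T x + T y"
    and "\<And>c x. x \<in> L \<Longrightarrow> T (c *\<^sub>C x) = c *\<^sub>C T x"
  shows "clinear_on L T"
  using assms by (auto simp: clinear_on_def)

lemma clinear_on_add: "clinear_on L T \<Longrightarrow> x \<in> L \<Longrightarrow> y \<in> L \<Longrightarrow> T (x + y) = T x + T y"
  by (simp add: clinear_on_def)

lemma clinear_on_scale: "clinear_on L T \<Longrightarrow> x \<in> L \<Longrightarrow> T (c *\<^sub>C x) = c *\<^sub>C T x"
  by (simp add: clinear_on_def)

lemma clinear_on_zero: "clinear_on L T \<Longrightarrow> csubspace L \<Longrightarrow> T 0 = 0"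
  using clinear_on_scale[of L T 0 0] complex_vector.subspace_0 by (metis complex_vector.scale_zero_left)

lemma clinear_on_minus: "clinear_on L T \<Longrightarrow> x \<in> L \<Longrightarrow> T (- x) = - T x"
  using clinear_on_scale[of L T x "-1"] by (simp flip: uminus_eq_scaleC[of x] uminus_eq_scaleC[of "T x"])

lemma clinear_on_diff:
  "clinear_on L T \<Longrightarrow> csubspace L \<Longrightarrow> x \<in> L \<Longrightarrow> y \<in> L \<Longrightarrow> T (x - y) = T x - T y"
  using clinear_on_add[of L T x "- y"] clinear_on_minus[of L T y] complex_vector.subspace_neg[of L y]
  by simp

lemma csubspace_image: 
  assumes "clinear_on L T" and L: "csubspace L"
  shows "csubspace (T ` L)"
proof (rule complex_vector.subspaceI)
  show "0 \<in> T ` L"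
    using clinear_on_zero[OF assms] complex_vector.subspace_0[OF L] by (metis image_eqI)
  show "x + y \<in> T ` L" if "x \<in> T ` L" "y \<in> T ` L" for x y
    using that clinear_on_add[OF assms(1)] complex_vector.subspace_add[OF L]
    by (metis (no_types, lifting) imageE image_eqI)
  show "c *\<^sub>C x \<in> T ` L" if "x \<in> T ` L" for c x
    using that clinear_on_scale[OF assms(1)] complex_vector.subspace_scale[OF L]
    by (metis (no_types, lifting) imageE image_eqI)
qed

lemma bounded_clinear_on_le:
  assumes "bounded_clinear_on L T"
  obtains K where "0 \<le> K" and "\<And>x. x \<in> L \<Longrightarrow> norm (T x) \<le> K * norm x"
proof -
  obtain K where K: "\<forall>x\<in>L. norm (T x) \<le> K * norm x"
    using assms by (auto simp: bounded_clinear_on_def)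
  have "norm (T x) \<le> max K 0 * norm x" if "x \<in> L" for x
    using K that by (smt (verit) mult_right_mono norm_ge_zero)
  then show ?thesis
    using that[of "max K 0"] by simp
qed

lemma isometry_on_clinear: "isometry_on L T \<Longrightarrow> clinear_on L T"
  and isometry_on_norm: "isometry_on L T \<Longrightarrow> x \<in> L \<Longrightarrow> norm (T x) = norm x"
  by (auto simp: isometry_on_def)

lemma cinner_eq_inner: "cinner x y = Complex (inner x y) (inner x (\<i> *\<^sub>C y))"
  by (simp add: complex_eq_iff inner_eq_Re_cinner cinner_scaleC_right)

text \<open>The real part comes from polarization, the imaginary part from applying this to \<open>\<i> y\<close>.\<close>

lemma isometry_on_cinner:
  assumes T: "isometry_on L T" and L: "csubspace L" and x: "x \<in> L" and y: "y \<in> L"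
  shows "cinner (T x) (T y) = cinner x y"
proof -
  have pol: "inner (T u) (T v) = inner u v" if "u \<in> L" "v \<in> L" for u v
  proof -
    have "norm (T u + T v) = norm (u + v)"
      using T that L by (metis clinear_on_add complex_vector.subspace_add isometry_on_clinear
          isometry_on_norm)
    then show ?thesis
      using isometry_on_norm[OF T] that by (simp add: dot_norm)
  qed
  have "\<i> *\<^sub>C T y = T (\<i> *\<^sub>C y)"
    using T y by (metis clinear_on_scale isometry_on_clinear)
  then show ?thesis
    using x y L by (simp add: cinner_eq_inner pol complex_vector.subspace_scale)
qed

lemma isometry_on_of_cinner:
  assumes "clinear_on L T" and "\<And>x. x \<in> L \<Longrightarrow> cinner (T x) (T x) = cinner x x"
  shows "isometry_on L T"
  unfolding isometry_on_def
proof (intro conjI ballI assms)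
  fix x assume "x \<in> L"
  then have "(norm (T x))\<^sup>2 = (norm x)\<^sup>2"
    using assms(2)[of x] by (simp only: cinner_self of_real_eq_iff)
  then show "norm (T x) = norm x"
    by (simp add: power2_eq_iff_nonneg)
qed

text \<open>If the images \<open>T (u n)\<close> converge, then \<open>u\<close> is Cauchy by the lower bound, and its limit is in
  the closed set \<open>L\<close>.\<close>

lemma closed_image_bounded_below:
  fixes T :: "'a::complex_hilbert \<Rightarrow> 'b::complex_hilbert"
  assumes lin: "clinear_on L T" and L: "csubspace L" "closed L"
    and bd: "\<And>x. x \<in> L \<Longrightarrow> norm (T x) \<le> K * norm x"
    and c: "0 < c" "\<And>x. x \<in> L \<Longrightarrow> c * norm x \<le> norm (T x)"
  shows "closed (T ` L)"
proof -
  have cont: "(\<lambda>n. T (u n)) \<longlonglongrightarrow> T x" if "\<And>n. u n \<in> L" "x \<in> L" "u \<longlonglongrightarrow> x" for u x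
  proof -
    have "norm (T (u n) - T x) \<le> K * norm (u n - x)" for n
      using bd[of "u n - x"] clinear_on_diff[OF lin L(1) that(1) that(2)]
        complex_vector.subspace_diff[OF L(1) that(1) that(2)] by simp
    moreover have "(\<lambda>n. K * norm (u n - x)) \<longlonglongrightarrow> 0"
      using that(3) by (intro tendsto_mult_right_zero tendsto_norm_zero) (simp add: LIM_zero)
    ultimately have "(\<lambda>n. T (u n) - T x) \<longlonglongrightarrow> 0"
      by (rule Lim_null_comparison[OF always_eventually, OF allI])
    then show ?thesis
      by (simp add: LIM_zero_iff)
  qed
  show ?thesis
  proof (rule closed_sequential_limits[THEN iffD2], intro allI impI)
    fix v l assume v: "(\<forall>n. v n \<in> T ` L) \<and> v \<longlonglongrightarrow> l"
    then have "\<forall>n. \<exists>y. y \<in> L \<and> v n = T y"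
      by blast
    then obtain u where "\<forall>n. u n \<in> L \<and> v n = T (u n)"
      by (rule choice[THEN exE])
    then have u: "\<And>n. u n \<in> L" "\<And>n. v n = T (u n)"
      by auto
    have "Cauchy u"
      unfolding Cauchy_def
    proof (intro allI impI)
      fix e :: real assume "0 < e"
      then have "0 < c * e"
        using c by simp
      moreover have "Cauchy v"
        using v LIMSEQ_imp_Cauchy by blast
      ultimately obtain n0 where n0: "\<And>m n. m \<ge> n0 \<Longrightarrow> n \<ge> n0 \<Longrightarrow> dist (v m) (v n) < c * e"
        unfolding Cauchy_def by meson
      have "c * dist (u m) (u n) \<le> dist (v m) (v n)" for m n
        using c(2)[OF complex_vector.subspace_diff[OF L(1) u(1)[of m] u(1)[of n]]]
        unfolding u(2) dist_norm clinear_on_diff[OF lin L(1) u(1) u(1)] .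
      then have "c * dist (u m) (u n) < c * e" if "m \<ge> n0" "n \<ge> n0" for m n
        using n0[OF that] by (meson order_le_less_trans)
      then show "\<exists>M. \<forall>m\<ge>M. \<forall>n\<ge>M. dist (u m) (u n) < e"
        using c(1) by auto
    qed
    then obtain x where x: "u \<longlonglongrightarrow> x"
      using Cauchy_convergent convergent_def by blast
    then have "x \<in> L"
      using L(2) u(1) closed_sequentially by blast
    then have "v \<longlonglongrightarrow> T x"
      using cont[OF u(1) _ x] u(2)[abs_def] by simp
    then show "l \<in> T ` L"
      using v \<open>x \<in> L\<close> LIMSEQ_unique by blast
  qed
qed

section \<open>Orthogonal projections\<close>

lemma csubspace_orth_compl: "csubspace (orth_compl L)"
  by (rule complex_vector.subspaceI) (auto simp: orth_compl_def cinner_linear)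

lemma orth_compl_Int: "x \<in> L \<Longrightarrow> x \<in> orth_compl L \<Longrightarrow> x = 0"
  using cinner_self_eq_zero by (auto simp: orth_compl_def)

lemma closed_orth_compl: "closed (orth_compl L)"
  unfolding closed_sequential_limits orth_compl_def
proof clarify
  fix u x y assume u: "\<forall>n. u n \<in> {x. \<forall>y\<in>L. cinner x y = 0}" "u \<longlonglongrightarrow> x" and y: "y \<in> L"
  have "(\<lambda>n. cinner (u n) y) \<longlonglongrightarrow> cinner x y"
    by (rule tendsto_cinner_left[OF u(2)])
  moreover have "(\<lambda>n. cinner (u n) y) = (\<lambda>n. 0)"
    using u(1) y by auto
  ultimately show "cinner x y = 0"
    using LIMSEQ_unique[OF _ tendsto_const] by metis
qed

text \<open>The projection theorem. A sequence in \<open>L\<close> whose distances to \<open>x\<close> approach the infimum is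
  Cauchy by the parallelogram law, and minimality of the distance of its limit \<open>y\<close> along every
  complex line \<open>y + c z\<close> in \<open>L\<close> forces \<open>x - y\<close> to be orthogonal to \<open>z\<close>.\<close>

lemma projection_exists:
  fixes L :: "'a::complex_hilbert set"
  assumes L: "csubspace L" "closed L"
  shows "\<exists>y\<in>L. x - y \<in> orth_compl L"
proof -
  define d where "d = Inf ((\<lambda>y. (norm (x - y))\<^sup>2) ` L)"
  have bdd: "bdd_below ((\<lambda>y. (norm (x - y))\<^sup>2) ` L)"
    by (rule bdd_belowI[of _ 0]) auto
  have ne: "(\<lambda>y. (norm (x - y))\<^sup>2) ` L \<noteq> {}"
    using complex_vector.subspace_0[OF L(1)] by blast
  have d_le: "d \<le> (norm (x - y))\<^sup>2" if "y \<in> L" for y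
    unfolding d_def by (rule cInf_lower[OF _ bdd]) (use that in auto)
  have "\<exists>y\<in>L. (norm (x - y))\<^sup>2 < d + 1 / real (Suc n)" for n
  proof -
    have "\<exists>t\<in>(\<lambda>y. (norm (x - y))\<^sup>2) ` L. t < d + 1 / real (Suc n)"
      unfolding d_def by (subst cInf_less_iff[OF ne bdd, symmetric]) simp
    then show ?thesis
      by blast
  qed
  then obtain u where u: "\<And>n. u n \<in> L" "\<And>n. (norm (x - u n))\<^sup>2 < d + 1 / real (Suc n)"
    by metis
  have par: "(norm (y - z))\<^sup>2 \<le> 2 * ((norm (x - y))\<^sup>2 - d) + 2 * ((norm (x - z))\<^sup>2 - d)"
    if "y \<in> L" "z \<in> L" for y z
  proof -
    have m: "(1/2) *\<^sub>R (y + z) \<in> L"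
      using that L(1) by (simp add: scaleR_scaleC complex_vector.subspace_add complex_vector.subspace_scale)
    have "(norm (y - z))\<^sup>2 + 4 * (norm (x - (1/2) *\<^sub>R (y + z)))\<^sup>2
        = 2 * (norm (x - y))\<^sup>2 + 2 * (norm (x - z))\<^sup>2"
      unfolding power2_norm_eq_inner
      by (simp add: inner_diff_left inner_diff_right inner_add_left inner_add_right inner_commute
          algebra_simps)
    then show ?thesis
      using d_le[OF m] by simp
  qed
  have "Cauchy u"
    unfolding Cauchy_def
  proof (intro allI impI)
    fix e :: real assume e: "0 < e"
    then obtain n0 :: nat where n0: "4 / e\<^sup>2 < real n0"
      using reals_Archimedean2 by blast
    have "dist (u m) (u n) < e" if "m \<ge> n0" "n \<ge> n0" for m n
    proof -
      have small: "1 / real (Suc k) < e\<^sup>2 / 4" if "k \<ge> n0" for k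
      proof -
        have "4 / e\<^sup>2 < real (Suc k)"
          using n0 that by linarith
        then show ?thesis
          using e by (simp add: field_simps)
      qed
      have "(norm (u m - u n))\<^sup>2 < 2 * (1 / real (Suc m)) + 2 * (1 / real (Suc n))"
        using par[OF u(1)[of m] u(1)[of n]] u(2)[of m] u(2)[of n] by argo
      also have "\<dots> < e\<^sup>2"
        using small[OF that(1)] small[OF that(2)] by linarith
      finally show ?thesis
        using e by (simp add: dist_norm power_less_imp_less_base)
    qed
    then show "\<exists>M. \<forall>m\<ge>M. \<forall>n\<ge>M. dist (u m) (u n) < e"
      by blast
  qed
  then obtain y where y: "u \<longlonglongrightarrow> y"
    using Cauchy_convergent convergent_def by blast
  then have yL: "y \<in> L"
    using L(2) u(1) closed_sequentially by blast
  have "(\<lambda>n. (norm (x - u n))\<^sup>2) \<longlonglongrightarrow> (norm (x - y))\<^sup>2"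
    by (intro tendsto_intros y)
  moreover have "(\<lambda>n. d + 1 / real (Suc n)) \<longlonglongrightarrow> d + 0"
    by (intro tendsto_intros LIMSEQ_inverse_real_of_nat[unfolded inverse_eq_divide])
  ultimately have dy: "(norm (x - y))\<^sup>2 \<le> d"
    using u(2) by (metis (no_types, lifting) LIMSEQ_le add_0_right less_imp_le)
  have "cinner (x - y) z = 0" if z: "z \<in> L" for z
  proof (rule ccontr)
    assume nz: "cinner (x - y) z \<noteq> 0"
    then have zn: "norm z > 0"
      by auto
    define c where "c = cinner (x - y) z / of_real ((norm z)\<^sup>2)"
    have "y + c *\<^sub>C z \<in> L"
      using yL z L(1) by (simp add: complex_vector.subspace_add complex_vector.subspace_scale)
    then have min: "(norm (x - y))\<^sup>2 \<le> (norm (x - y - c *\<^sub>C z))\<^sup>2"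
      using d_le dy by (metis diff_diff_eq order_trans)
    have "complex_of_real ((norm (x - y - c *\<^sub>C z))\<^sup>2) = cinner (x - y) (x - y) - cnj c * cinner (x - y) z
        - c * cnj (cinner (x - y) z) + c * cnj c * cinner z z"
    proof -
      have "cinner (v - c *\<^sub>C z) (v - c *\<^sub>C z) = cinner v v - cnj c * cinner v z
          - c * cnj (cinner v z) + c * cnj c * cinner z z" for v
        using cinner_commute[of z v] by (simp add: cinner_linear algebra_simps)
      then show ?thesis
        unfolding cinner_self[symmetric] .
    qed
    also have "\<dots> = of_real ((norm (x - y))\<^sup>2 - (norm (cinner (x - y) z))\<^sup>2 / (norm z)\<^sup>2)"
      using zn complex_norm_square[of "cinner (x - y) z"]
      by (simp add: c_def cinner_self field_simps power2_eq_square)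
    finally have "(norm (x - y - c *\<^sub>C z))\<^sup>2
        = (norm (x - y))\<^sup>2 - (norm (cinner (x - y) z))\<^sup>2 / (norm z)\<^sup>2"
      by (simp only: of_real_eq_iff)
    then have "(norm (cinner (x - y) z))\<^sup>2 / (norm z)\<^sup>2 \<le> 0"
      using min by linarith
    then show False
      using nz zn by (simp add: divide_le_0_iff)
  qed
  then show ?thesis
    using yL by (auto simp: orth_compl_def)
qed

lemma orth_proj_unique:
  assumes "csubspace L" "y \<in> L" "x - y \<in> orth_compl L"
  shows "orth_proj L x = y"
  unfolding orth_proj_def
proof (rule the_equality)
  show "y \<in> L \<and> x - y \<in> orth_compl L"
    using assms by simp
next
  fix z assume z: "z \<in> L \<and> x - z \<in> orth_compl L"
  have "(x - y) - (x - z) \<in> orth_compl L"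
    using z assms csubspace_orth_compl complex_vector.subspace_diff by blast
  moreover have "z - y \<in> L"
    using z assms complex_vector.subspace_diff by blast
  ultimately show "z = y"
    using orth_compl_Int[of "z - y" L] by simp
qed

lemma orth_proj_mem:
  fixes L :: "'a::complex_hilbert set"
  assumes "csubspace L" "closed L"
  shows "orth_proj L x \<in> L" and "x - orth_proj L x \<in> orth_compl L"
proof -
  obtain y where "y \<in> L" "x - y \<in> orth_compl L"
    using projection_exists[OF assms] by blast
  then show "orth_proj L x \<in> L" "x - orth_proj L x \<in> orth_compl L"
    using orth_proj_unique[OF assms(1)] by auto
qed

lemma orth_proj_compl:
  fixes L :: "'a::complex_hilbert set"
  assumes "csubspace L" "closed L"
  shows "orth_proj (orth_compl L) x = x - orth_proj L x"
proof (rule orth_proj_unique[OF csubspace_orth_compl])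
  show "x - orth_proj L x \<in> orth_compl L"
    by (rule orth_proj_mem[OF assms])
  show "x - (x - orth_proj L x) \<in> orth_compl (orth_compl L)"
    using orth_proj_mem(1)[OF assms, of x]
    by (auto simp: orth_compl_def cinner_eq_zero_sym)
qed

lemma orth_proj_cinner:
  fixes L :: "'a::complex_hilbert set"
  assumes "csubspace L" "closed L" "y \<in> L"
  shows "cinner (orth_proj L x) y = cinner x y"
  using orth_proj_mem(2)[OF assms(1,2), of x] assms(3)
  by (auto simp: orth_compl_def cinner_diff_left)

lemma orth_proj_ident:
  assumes "csubspace L" "x \<in> L"
  shows "orth_proj L x = x"
  by (rule orth_proj_unique) (use assms in \<open>auto simp: complex_vector.subspace_0 csubspace_orth_compl\<close>)

lemma orth_proj_zero:
  assumes "csubspace L" "x \<in> orth_compl L"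
  shows "orth_proj L x = 0"
  by (rule orth_proj_unique) (use assms in \<open>auto simp: complex_vector.subspace_0\<close>)

lemma clinear_orth_proj:
  fixes L :: "'a::complex_hilbert set"
  assumes "csubspace L" "closed L"
  shows "clinear_on UNIV (orth_proj L)"
proof (rule clinear_onI)
  note P = orth_proj_mem[OF assms] and O = csubspace_orth_compl[of L]
  fix x y :: 'a and c :: complex
  have "x + y - (orth_proj L x + orth_proj L y) \<in> orth_compl L"
    using complex_vector.subspace_add[OF O P(2)[of x] P(2)[of y]] by (simp add: algebra_simps)
  then show "orth_proj L (x + y) = orth_proj L x + orth_proj L y"
    by (intro orth_proj_unique assms complex_vector.subspace_add P) auto
  have "c *\<^sub>C x - c *\<^sub>C orth_proj L x \<in> orth_compl L"
    using complex_vector.subspace_scale[OF O P(2)[of x], of c]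
    by (simp add: complex_vector.scale_right_diff_distrib)
  then show "orth_proj L (c *\<^sub>C x) = c *\<^sub>C orth_proj L x"
    by (intro orth_proj_unique assms complex_vector.subspace_scale P) auto
qed

lemma pythagoras:
  assumes "cinner x y = 0"
  shows "(norm (x + y))\<^sup>2 = (norm x)\<^sup>2 + (norm y)\<^sup>2"
proof -
  have "inner x y = 0"
    using assms by (simp add: inner_eq_Re_cinner)
  then show ?thesis
    by (simp add: power2_norm_eq_inner inner_add_left inner_add_right inner_commute)
qed

lemma norm_orth_proj_split:
  fixes L :: "'a::complex_hilbert set"
  assumes "csubspace L" "closed L"
  shows "(norm x)\<^sup>2 = (norm (orth_proj L x))\<^sup>2 + (norm (orth_proj (orth_compl L) x))\<^sup>2"
proof -
  have "cinner (orth_proj L x) (x - orth_proj L x) = 0"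
    using orth_proj_mem[OF assms, of x] by (auto simp: orth_compl_def cinner_eq_zero_sym)
  then show ?thesis
    using pythagoras[of "orth_proj L x" "x - orth_proj L x"] by (simp add: orth_proj_compl[OF assms])
qed

lemma norm_orth_proj_le:
  fixes L :: "'a::complex_hilbert set"
  assumes "csubspace L" "closed L"
  shows "norm (orth_proj L x) \<le> norm x" "norm (orth_proj (orth_compl L) x) \<le> norm x"
  using norm_orth_proj_split[OF assms, of x]
  by (simp_all add: power2_le_imp_le)

text \<open>The range is closed, and a vector orthogonal to it vanishes, so the range is everything. The
  condition on the range is stated through inner products, so that no adjoint has to be formed.\<close>

lemma bij_bounded_below:
  fixes T :: "'a::complex_hilbert \<Rightarrow> 'a"
  assumes lin: "clinear_on UNIV T"
    and bd: "\<And>x. norm (T x) \<le> K * norm x"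
    and c: "0 < c" "\<And>x. c * norm x \<le> norm (T x)"
    and orth: "\<And>y. (\<And>x. cinner (T x) y = 0) \<Longrightarrow> y = 0"
  shows "bij T"
proof (rule bijI)
  show "inj T"
  proof (rule injI)
    fix x y assume "T x = T y"
    then have "c * norm (x - y) \<le> 0"
      using c(2)[of "x - y"] clinear_on_diff[OF lin] by simp
    then show "x = y"
      using c(1) by (simp add: mult_le_0_iff)
  qed
  have cl: "closed (range T)"
    by (rule closed_image_bounded_below[OF lin _ _ bd c]) auto
  have sub: "csubspace (range T)"
    by (rule csubspace_image[OF lin]) simp
  have "x \<in> range T" for x
  proof -
    have "x - orth_proj (range T) x = 0"
      using orth_proj_mem(2)[OF sub cl, of x]
      by (intro orth) (auto simp: orth_compl_def cinner_eq_zero_sym)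
    then show ?thesis
      using orth_proj_mem(1)[OF sub cl, of x] by simp
  qed
  then show "surj T"
    by blast
qed

section \<open>Analytic operator functions\<close>

text \<open>A Taylor estimate with a constant depending only on the bound of \<open>f\<close>. The uniformity is what
  turns weak differentiability of an operator function into differentiability in norm.\<close>

lemma difference_quotient_bound:
  fixes f :: "complex \<Rightarrow> complex"
  assumes hol: "f holomorphic_on ball z r" and r: "0 < r"
    and bd: "\<And>w. w \<in> ball z r \<Longrightarrow> norm (f w) \<le> B"
    and w: "w \<in> ball z (r/3)" "w \<noteq> z"
  shows "norm ((f w - f z) / (w - z) - deriv f z) \<le> 18 * B / r\<^sup>2 * norm (w - z)"
proof -
  have d2: "norm (deriv (deriv f) u) \<le> 18 * B / r\<^sup>2" if u: "u \<in> ball z (r/3)" for u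
  proof -
    have sub: "cball u (r/3) \<subseteq> ball z r"
    proof
      fix v assume "v \<in> cball u (r/3)"
      then show "v \<in> ball z r"
        using u dist_triangle[of z v u] r by (simp add: dist_commute)
    qed
    have "norm ((deriv ^^ 2) f u) \<le> fact 2 * B / (r/3)^2"
    proof (rule Cauchy_inequality)
      show "f holomorphic_on ball u (r/3)"
        using hol sub by (meson ball_subset_cball holomorphic_on_subset order_trans)
      show "continuous_on (cball u (r/3)) f"
        using hol sub by (meson holomorphic_on_imp_continuous_on holomorphic_on_subset)
      show "norm (f v) \<le> B" if "norm (u - v) = r/3" for v
        using bd sub that by (metis dist_norm mem_cball order_refl subsetD)
    qed (use r in simp)
    then show ?thesis
      by (simp add: numeral_2_eq_2 power_divide)
  qed
  have dd: "((deriv ^^ i) f has_field_derivative (deriv ^^ Suc i) f u) (at u within ball z (r/3))"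
    if "u \<in> ball z (r/3)" for u i
  proof -
    have "u \<in> ball z r"
      using that r by auto
    then have "((deriv ^^ i) f has_field_derivative deriv ((deriv ^^ i) f) u) (at u)"
      using holomorphic_higher_deriv[OF hol open_ball] holomorphic_derivI open_ball by blast
    then show ?thesis
      by (simp add: has_field_derivative_at_within)
  qed
  have "norm ((deriv ^^ 0) f w - (\<Sum>i\<le>1. (deriv ^^ i) f z * (w - z) ^ i / fact i))
      \<le> 18 * B / r\<^sup>2 * norm (w - z) ^ Suc 1 / fact 1"
    by (rule complex_Taylor[of "ball z (r/3)"]) (use dd d2 w r in auto)
  then have *: "norm (f w - f z - deriv f z * (w - z)) \<le> 18 * B / r\<^sup>2 * (norm (w - z) * norm (w - z))"
    by (simp add: power2_eq_square diff_diff_eq)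
  have "(f w - f z) / (w - z) - deriv f z = (f w - f z - deriv f z * (w - z)) / (w - z)"
    using w(2) by (simp add: divide_simps)
  then have "norm ((f w - f z) / (w - z) - deriv f z)
      = norm (f w - f z - deriv f z * (w - z)) / norm (w - z)"
    by (simp add: norm_divide)
  also have "\<dots> \<le> 18 * B / r\<^sup>2 * norm (w - z)"
    using * w(2) by (simp add: pos_divide_le_eq mult.assoc)
  finally show ?thesis .
qed

text \<open>By the preceding estimate for the matrix coefficients the difference quotients satisfy a
  Cauchy condition uniformly on the unit ball; their limit is the derivative.\<close>

lemma op_analytic_on_of_weakly_holomorphic:
  fixes F :: "complex \<Rightarrow> 'a::complex_inner \<Rightarrow> 'b::complex_hilbert"
  assumes S: "open S"
    and lin: "\<And>z. z \<in> S \<Longrightarrow> clinear_on UNIV (F z)"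
    and bd: "\<And>z. z \<in> S \<Longrightarrow> \<exists>r>0. \<exists>K. \<forall>w\<in>ball z r \<inter> S. \<forall>x. norm (F w x) \<le> K * norm x"
    and hol: "\<And>x y. (\<lambda>z. cinner (F z x) y) holomorphic_on S"
  shows "op_analytic_on UNIV S F"
  unfolding op_analytic_on_def
proof (intro ballI conjI)
  fix z assume z: "z \<in> S"
  show "bounded_clinear_on UNIV (F z)"
    using lin[OF z] bd[OF z] z unfolding bounded_clinear_on_def by fastforce
  obtain r0 K0 where r0: "r0 > 0" "\<And>w x. w \<in> ball z r0 \<inter> S \<Longrightarrow> norm (F w x) \<le> K0 * norm x"
    using bd[OF z] by blast
  obtain r1 where r1: "r1 > 0" "ball z r1 \<subseteq> S"
    using S z open_contains_ball by blast
  define r where "r = min r0 r1"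
  define K where "K = max K0 0"
  have r: "r > 0" "ball z r \<subseteq> S" and K: "K \<ge> 0"
    using r0 r1 by (auto simp: r_def K_def)
  have bdK: "norm (F w x) \<le> K * norm x" if "w \<in> ball z r" for w x
  proof -
    have "w \<in> ball z r0 \<inter> S"
      using that r(2) by (auto simp: r_def)
    then have "norm (F w x) \<le> K0 * norm x"
      by (rule r0(2))
    also have "\<dots> \<le> K * norm x"
      by (intro mult_right_mono) (auto simp: K_def)
    finally show ?thesis .
  qed
  define Q where "Q w x = inverse (w - z) *\<^sub>C (F w x - F z x)" for w x
  define c where "c = 18 * K / r\<^sup>2"
  have c: "c \<ge> 0"
    using K by (simp add: c_def)
  define U where "U = ball z (r/3) - {z}"
  have Qdiff: "norm (Q w x - Q v x) \<le> c * (norm (w - z) + norm (v - z)) * norm x"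
    if w: "w \<in> U" and v: "v \<in> U" for w v x
  proof (rule norm_le_cinner)
    show "0 \<le> c * (norm (w - z) + norm (v - z)) * norm x"
      using c by simp
    fix y
    define f where "f u = cinner (F u x) y" for u
    have hf: "f holomorphic_on ball z r"
      unfolding f_def using hol r(2) holomorphic_on_subset by blast
    have bf: "norm (f u) \<le> K * norm x * norm y" if "u \<in> ball z r" for u
      unfolding f_def
      by (rule order_trans[OF norm_cinner_le]) (intro mult_right_mono bdK that norm_ge_zero)
    have dq: "norm (cinner (Q u x) y - deriv f z) \<le> c * norm (u - z) * (norm x * norm y)"
      if "u \<in> U" for u
    proof -
      have "norm ((f u - f z) / (u - z) - deriv f z)
          \<le> 18 * (K * norm x * norm y) / r\<^sup>2 * norm (u - z)"
        by (rule difference_quotient_bound[OF hf r(1) bf]) (use that in \<open>auto simp: U_def\<close>)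
      then show ?thesis
        by (simp add: Q_def f_def c_def cinner_scaleC_left cinner_diff_left divide_simps mult_ac)
    qed
    have "cinner (Q w x - Q v x) y = (cinner (Q w x) y - deriv f z) - (cinner (Q v x) y - deriv f z)"
      by (simp add: cinner_diff_left)
    also have "norm \<dots> \<le> c * norm (w - z) * (norm x * norm y) + c * norm (v - z) * (norm x * norm y)"
      by (intro order_trans[OF norm_triangle_ineq4] add_mono dq w v)
    finally show "norm (cinner (Q w x - Q v x) y) \<le> c * (norm (w - z) + norm (v - z)) * norm x * norm y"
      by (simp add: algebra_simps)
  qed
  \<comment> \<open>the derivative is the limit of the difference quotients along one sequence tending to \<open>z\<close>\<close>
  define s where "s n = z + of_real (r / 3 / real (n + 2))" for n
  have s_dist: "norm (s n - z) = r / 3 / real (n + 2)" for n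
    unfolding s_def add_diff_cancel_left' norm_of_real using r by simp
  have sU: "s n \<in> U" for n
  proof -
    have "norm (s n - z) < r / 3" "norm (s n - z) > 0"
      unfolding s_dist using r by (auto simp: field_simps intro!: add_pos_nonneg)
    then show ?thesis
      by (auto simp: U_def dist_norm norm_minus_commute)
  qed
  have s_lim: "(\<lambda>n. norm (s n - z)) \<longlonglongrightarrow> 0"
  proof -
    have "(\<lambda>n. inverse (real (n + 2))) \<longlonglongrightarrow> 0"
      by (rule LIMSEQ_ignore_initial_segment[OF lim_inverse_n])
    then show ?thesis
      unfolding s_dist divide_inverse[of "r / 3"] by (rule tendsto_mult_right_zero)
  qed
  have "\<exists>l. (\<lambda>n. Q (s n) x) \<longlonglongrightarrow> l" for x
  proof -
    have "Cauchy (\<lambda>n. Q (s n) x)"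
      unfolding Cauchy_def
    proof (intro allI impI)
      fix e :: real assume e: "0 < e"
      have "(\<lambda>n. c * norm (s n - z) * norm x) \<longlonglongrightarrow> c * 0 * norm x"
        by (intro tendsto_mult tendsto_const s_lim)
      then have "\<forall>\<^sub>F n in sequentially. c * norm (s n - z) * norm x < e / 2"
        by (rule order_tendstoD) (use e in simp)
      then obtain n0 where n0: "\<And>n. n \<ge> n0 \<Longrightarrow> c * norm (s n - z) * norm x < e / 2"
        by (auto simp: eventually_sequentially)
      have "dist (Q (s m) x) (Q (s n) x) < e" if "m \<ge> n0" "n \<ge> n0" for m n
      proof -
        have "dist (Q (s m) x) (Q (s n) x) \<le> c * norm (s m - z) * norm x + c * norm (s n - z) * norm x"
          using Qdiff[OF sU sU, of m x n] by (simp add: dist_norm algebra_simps)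
        also have "\<dots> < e"
          using n0[OF that(1)] n0[OF that(2)] by linarith
        finally show ?thesis .
      qed
      then show "\<exists>M. \<forall>m\<ge>M. \<forall>n\<ge>M. dist (Q (s m) x) (Q (s n) x) < e"
        by blast
    qed
    then show ?thesis
      using Cauchy_convergent convergent_def by blast
  qed
  then obtain F' where F': "\<And>x. (\<lambda>n. Q (s n) x) \<longlonglongrightarrow> F' x"
    by metis
  have near: "norm (Q w x - F' x) \<le> c * norm (w - z) * norm x" if w: "w \<in> U" for w x
  proof (rule tendsto_le[OF sequentially_bot])
    show "(\<lambda>n. norm (Q w x - Q (s n) x)) \<longlonglongrightarrow> norm (Q w x - F' x)"
      by (intro tendsto_intros F')
    have "(\<lambda>n. c * (norm (w - z) + norm (s n - z)) * norm x) \<longlonglongrightarrow> c * (norm (w - z) + 0) * norm x"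
      by (intro tendsto_intros s_lim)
    then show "(\<lambda>n. c * (norm (w - z) + norm (s n - z)) * norm x) \<longlonglongrightarrow> c * norm (w - z) * norm x"
      by simp
    show "\<forall>\<^sub>F n in sequentially. norm (Q w x - Q (s n) x) \<le> c * (norm (w - z) + norm (s n - z)) * norm x"
      by (intro always_eventually allI Qdiff w sU)
  qed
  have linQ: "clinear_on UNIV (Q w)" if "w \<in> U" for w
  proof -
    have "w \<in> S"
      using that r by (auto simp: U_def)
    then have Fw: "clinear_on UNIV (F w)" and Fz: "clinear_on UNIV (F z)"
      using lin z by auto
    show ?thesis
    proof (rule clinear_onI)
      fix x y :: 'a and k :: complex
      have "F w (x + y) - F z (x + y) = (F w x - F z x) + (F w y - F z y)"
        by (simp add: clinear_on_add[OF Fw] clinear_on_add[OF Fz])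
      then show "Q w (x + y) = Q w x + Q w y"
        by (simp only: Q_def scaleC_add_right)
      have "F w (k *\<^sub>C x) - F z (k *\<^sub>C x) = k *\<^sub>C (F w x - F z x)"
        by (simp add: clinear_on_scale[OF Fw] clinear_on_scale[OF Fz]
            complex_vector.scale_right_diff_distrib)
      then show "Q w (k *\<^sub>C x) = k *\<^sub>C Q w x"
        by (simp only: Q_def scaleC_scaleC mult.commute)
    qed
  qed
  have "clinear_on UNIV F'"
  proof (rule clinear_onI)
    fix x y :: 'a and k :: complex
    have "(\<lambda>n. Q (s n) x + Q (s n) y) \<longlonglongrightarrow> F' x + F' y"
      by (intro tendsto_add F')
    then show "F' (x + y) = F' x + F' y"
      using F'[of "x + y"] clinear_on_add[OF linQ[OF sU]] LIMSEQ_unique by auto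
    have "(\<lambda>n. k *\<^sub>C Q (s n) x) \<longlonglongrightarrow> k *\<^sub>C F' x"
      by (intro tendsto_scaleC tendsto_const F')
    then show "F' (k *\<^sub>C x) = k *\<^sub>C F' x"
      using F'[of "k *\<^sub>C x"] clinear_on_scale[OF linQ[OF sU]] LIMSEQ_unique by auto
  qed
  moreover have "\<exists>K'. \<forall>x\<in>UNIV. norm (F' x) \<le> K' * norm x"
  proof (intro exI ballI)
    fix x
    have s0: "s 0 \<in> ball z r" "z \<in> ball z r"
      using sU[of 0] r by (auto simp: U_def)
    have "norm (Q (s 0) x) \<le> norm (inverse (s 0 - z)) * (K * norm x + K * norm x)"
      unfolding Q_def norm_scaleC
      by (intro mult_left_mono order_trans[OF norm_triangle_ineq4] add_mono bdK s0) auto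
    moreover have "norm (F' x) \<le> norm (Q (s 0) x) + norm (Q (s 0) x - F' x)"
      using norm_triangle_ineq4[of "Q (s 0) x" "Q (s 0) x - F' x"] by simp
    ultimately show "norm (F' x) \<le> (norm (inverse (s 0 - z)) * (2 * K) + c * norm (s 0 - z)) * norm x"
      using near[OF sU, of 0 x] by (simp add: algebra_simps)
  qed
  ultimately have "bounded_clinear_on UNIV F'"
    by (simp add: bounded_clinear_on_def)
  moreover have "uniform_limit (UNIV \<inter> cball 0 1) Q F' (at z)"
  proof (rule uniform_limitI)
    fix e :: real assume e: "0 < e"
    have "((\<lambda>w. c * norm (w - z)) \<longlongrightarrow> c * norm (z - z)) (at z)"
      by (intro tendsto_intros)
    then have "\<forall>\<^sub>F w in at z. c * norm (w - z) < e"
      by (rule order_tendstoD) (use e in simp)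
    moreover have "\<forall>\<^sub>F w in at z. w \<in> U"
      unfolding U_def using r by (auto simp: eventually_at_topological intro!: exI[of _ "ball z (r/3)"])
    ultimately show "\<forall>\<^sub>F w in at z. \<forall>x\<in>UNIV \<inter> cball 0 1. dist (Q w x) (F' x) < e"
    proof eventually_elim
      case (elim w)
      show ?case
      proof
        fix x :: 'a assume "x \<in> UNIV \<inter> cball 0 1"
        then have "norm x \<le> 1"
          by simp
        then have "c * norm (w - z) * norm x \<le> c * norm (w - z) * 1"
          using c by (intro mult_left_mono) auto
        then show "dist (Q w x) (F' x) < e"
          using near[OF elim(2), of x] elim(1) by (simp add: dist_norm)
      qed
    qed
  qed
  ultimately show "\<exists>F'. bounded_clinear_on UNIV F' \<and>
      uniform_limit (UNIV \<inter> cball 0 1) (\<lambda>w x. inverse (w - z) *\<^sub>C (F w x - F z x)) F' (at z)"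
    unfolding Q_def[abs_def] by blast
qed

text \<open>By homogeneity uniform convergence of linear operators on the unit ball is convergence relative
  to \<open>norm x\<close>.\<close>

lemma uniform_limit_opI:
  assumes "\<And>e. 0 < e \<Longrightarrow> \<forall>\<^sub>F w in A. \<forall>x\<in>L. norm (F w x - F0 x) \<le> e * norm x"
  shows "uniform_limit (L \<inter> cball 0 1) F F0 A"
proof (rule uniform_limitI)
  fix e :: real assume e: "0 < e"
  then have "\<forall>\<^sub>F w in A. \<forall>x\<in>L. norm (F w x - F0 x) \<le> e/2 * norm x"
    using assms[of "e/2"] by simp
  then show "\<forall>\<^sub>F w in A. \<forall>x\<in>L \<inter> cball 0 1. dist (F w x) (F0 x) < e"
  proof eventually_elim
    case (elim w)
    show ?case
    proof
      fix x assume x: "x \<in> L \<inter> cball 0 1"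
      then have "norm (F w x - F0 x) \<le> e/2 * norm x" "norm x \<le> 1"
        using elim by auto
      moreover have "e/2 * norm x \<le> e/2 * 1"
        using \<open>norm x \<le> 1\<close> e by (intro mult_left_mono) auto
      ultimately show "dist (F w x) (F0 x) < e"
        using e unfolding dist_norm by linarith
    qed
  qed
qed

lemma uniform_limit_opD:
  assumes lim: "uniform_limit (L \<inter> cball 0 1) F F0 A" and L: "csubspace L"
    and lin: "\<forall>\<^sub>F w in A. clinear_on L (F w)" "clinear_on L F0" and e: "0 < e"
  shows "\<forall>\<^sub>F w in A. \<forall>x\<in>L. norm (F w x - F0 x) \<le> e * norm x"
  using uniform_limitD[OF lim e] lin(1)
proof eventually_elim
  case (elim w)
  show ?case
  proof
    fix x assume x: "x \<in> L"
    show "norm (F w x - F0 x) \<le> e * norm x"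
    proof (cases "x = 0")
      case True
      then show ?thesis
        using clinear_on_zero[OF elim(2) L] clinear_on_zero[OF lin(2) L] by simp
    next
      case False
      define k where "k = complex_of_real (inverse (norm x))"
      have k: "norm k = inverse (norm x)"
        unfolding k_def norm_of_real by simp
      have "k *\<^sub>C x \<in> L"
        using x L complex_vector.subspace_scale by blast
      moreover have "norm (k *\<^sub>C x) \<le> 1"
        using False by (simp add: norm_scaleC k)
      ultimately have "norm (F w (k *\<^sub>C x) - F0 (k *\<^sub>C x)) < e"
        using elim(1) by (auto simp: dist_norm)
      then have "norm k * norm (F w x - F0 x) < e"
        unfolding clinear_on_scale[OF elim(2) x] clinear_on_scale[OF lin(2) x]
        by (simp add: norm_scaleC flip: complex_vector.scale_right_diff_distrib)
      then show ?thesis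
        using False by (simp add: k field_simps)
    qed
  qed
qed

text \<open>Differentiability implies continuity, from \<open>F w - F z = (w - z) q\<close> with difference quotients
  \<open>q\<close> that are bounded by \<open>K + 1\<close> near \<open>z\<close>.\<close>

lemma op_analytic_on_imp_uniform_limit:
  assumes an: "op_analytic_on L S F" and z: "z \<in> S"
  shows "uniform_limit (L \<inter> cball 0 1) F (F z) (at z)"
proof -
  obtain F' where F': "bounded_clinear_on L F'"
    and lim: "uniform_limit (L \<inter> cball 0 1) (\<lambda>w x. inverse (w - z) *\<^sub>C (F w x - F z x)) F' (at z)"
    using an z by (auto simp: op_analytic_on_def)
  obtain K where K: "0 \<le> K" "\<And>x. x \<in> L \<Longrightarrow> norm (F' x) \<le> K * norm x"
    using bounded_clinear_on_le[OF F'] by blast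
  show ?thesis
  proof (rule uniform_limitI)
    fix e :: real assume e: "0 < e"
    have "((\<lambda>w. norm (w - z) * (K + 1)) \<longlongrightarrow> norm (z - z) * (K + 1)) (at z)"
      by (intro tendsto_intros)
    then have "\<forall>\<^sub>F w in at z. norm (w - z) * (K + 1) < e"
      by (rule order_tendstoD) (use e in simp)
    moreover have "\<forall>\<^sub>F w in at z. w \<noteq> z"
      by (simp add: eventually_at_filter)
    moreover have "\<forall>\<^sub>F w in at z. \<forall>x\<in>L \<inter> cball 0 1.
        dist (inverse (w - z) *\<^sub>C (F w x - F z x)) (F' x) < 1"
      using uniform_limitD[OF lim] by simp
    ultimately show "\<forall>\<^sub>F w in at z. \<forall>x\<in>L \<inter> cball 0 1. dist (F w x) (F z x) < e"
    proof eventually_elim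
      case (elim w)
      show ?case
      proof
        fix x assume x: "x \<in> L \<inter> cball 0 1"
        let ?q = "inverse (w - z) *\<^sub>C (F w x - F z x)"
        have "F w x - F z x = (w - z) *\<^sub>C ?q"
          using elim(2) by (simp add: scaleC_scaleC)
        then have "norm (F w x - F z x) = norm (w - z) * norm ?q"
          by (metis norm_scaleC)
        also have "norm ?q \<le> norm (F' x) + norm (?q - F' x)"
          by (metis norm_triangle_sub)
        also have "\<dots> \<le> K + 1"
        proof -
          have "norm (F' x) \<le> K * norm x"
            using K x by auto
          also have "\<dots> \<le> K * 1"
            using K x by (intro mult_left_mono) auto
          finally have "norm (F' x) \<le> K"
            by simp
          moreover have "norm (?q - F' x) < 1"
            using elim(3) x by (auto simp: dist_norm)
          ultimately show ?thesis
            by linarith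
        qed
        finally show "dist (F w x) (F z x) < e"
          using elim(1) by (simp add: dist_norm mult_left_mono)
      qed
    qed
  qed
qed

text \<open>Locally \<open>u \<mapsto> p exp (\<i> u)\<close> straightens the circle to the real line, across which
  continuous functions that are holomorphic on both sides can be pasted.\<close>

lemma holomorphic_on_paste_across_circle:
  fixes f :: "complex \<Rightarrow> complex"
  assumes S: "open S" and cont: "continuous_on S f"
    and inn: "f holomorphic_on S \<inter> ball 0 1"
    and out: "f holomorphic_on S \<inter> {z. 1 < norm z}"
  shows "f holomorphic_on S"
proof -
  have "\<exists>f'. (f has_field_derivative f') (at p)" if p: "p \<in> S" for p
  proof (cases "norm p = 1")
    case False
    have "open (S \<inter> {z. 1 < norm z})"
      by (intro open_Int S open_Collect_less continuous_intros)
    moreover have "p \<in> S \<inter> ball 0 1 \<or> p \<in> S \<inter> {z. 1 < norm z}"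
      using False p by auto
    ultimately show ?thesis
      using inn out holomorphic_on_open open_Int[OF S open_ball] by metis
  next
    case True
    define g where "g u = p * exp (\<i> * u)" for u
    define U where "U = g -` S"
    have norm_g: "norm (g u) = exp (- Im u)" for u
      using True by (simp add: g_def norm_mult norm_exp_eq_Re)
    have g_hol: "g holomorphic_on A" for A
      unfolding g_def by (intro holomorphic_intros)
    have "continuous_on UNIV g"
      by (intro holomorphic_on_imp_continuous_on g_hol)
    then have U: "open U"
      unfolding U_def by (rule open_vimage[OF S])
    have inner_i: "\<i> \<bullet> u = Im u" for u
      by (simp add: inner_complex_def)
    have "(f \<circ> g) holomorphic_on U"
    proof (rule holomorphic_on_paste_across_line[OF U, of "\<i>" _ 0])
      show "(f \<circ> g) holomorphic_on U \<inter> {z. \<i> \<bullet> z < 0}"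
        by (rule holomorphic_on_compose_gen[OF g_hol out]) (auto simp: U_def norm_g inner_i)
      show "(f \<circ> g) holomorphic_on U \<inter> {z. 0 < \<i> \<bullet> z}"
        by (rule holomorphic_on_compose_gen[OF g_hol inn]) (auto simp: U_def norm_g inner_i)
      show "continuous_on U (f \<circ> g)"
        by (intro continuous_on_compose holomorphic_on_imp_continuous_on g_hol
            continuous_on_subset[OF cont]) (auto simp: U_def)
    qed simp
    define T where "T = S \<inter> {z. 0 < Re (z / p)}"
    have p0: "p \<noteq> 0"
      using True by auto
    have T: "open T"
      unfolding T_def using p0 by (intro open_Int S open_Collect_less continuous_intros) auto
    define h where "h z = - \<i> * Ln (z / p)" for z
    have gh: "g (h z) = z" if "z \<in> T" for z
    proof -
      have "z / p \<noteq> 0"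
        using that p0 by (auto simp: T_def)
      then show ?thesis
        using p0 by (simp add: g_def h_def flip: mult.assoc)
    qed
    have "h holomorphic_on T"
      unfolding h_def using p0 by (intro holomorphic_intros) (auto simp: T_def complex_nonpos_Reals_iff)
    then have "((f \<circ> g) \<circ> h) holomorphic_on T"
      by (rule holomorphic_on_compose_gen[OF _ \<open>(f \<circ> g) holomorphic_on U\<close>])
         (use gh in \<open>auto simp: U_def T_def\<close>)
    then have "f holomorphic_on T"
      by (rule holomorphic_transform) (simp add: gh)
    moreover have "p \<in> T"
      using p p0 by (simp add: T_def)
    ultimately show ?thesis
      using T holomorphic_on_open by blast
  qed
  then show ?thesis
    using S holomorphic_on_open by blast
qed

section \<open>The Hellinger--Toeplitz theorem\<close>

text \<open>The sets \<open>{x. norm (S x) \<le> n}\<close> are closed since, through the formal adjoint, they are cut out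
  by continuous functionals; by Baire's theorem one of them contains a ball.\<close>

theorem Hellinger_Toeplitz:
  fixes S S' :: "'a::complex_hilbert \<Rightarrow> 'a"
  assumes adj: "\<And>x y. cinner (S x) y = cinner x (S' y)"
  shows "\<exists>K. \<forall>x. norm (S x) \<le> K * norm x"
proof -
  have add: "S (x + y) = S x + S y" for x y
    by (rule cinner_left_cancel) (simp add: adj cinner_add_left)
  have scale: "S (c *\<^sub>C x) = c *\<^sub>C S x" for c x
    by (rule cinner_left_cancel) (simp add: adj cinner_scaleC_left)
  have lin: "clinear_on UNIV S"
    by (simp add: clinear_on_def add scale)
  define A where "A n = {x. norm (S x) \<le> real n}" for n
  have A_eq: "A n = (\<Inter>y. {x. norm (cinner x (S' y)) \<le> real n * norm y})" for n
  proof -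
    have "norm (S x) \<le> real n" if "\<And>y. norm (cinner x (S' y)) \<le> real n * norm y" for x
      by (rule norm_le_cinner) (use that in \<open>simp_all add: adj\<close>)
    moreover have "norm (cinner x (S' y)) \<le> real n * norm y" if "norm (S x) \<le> real n" for x y
      using norm_cinner_le[of "S x" y] mult_right_mono[OF that norm_ge_zero[of y]]
      by (simp add: adj)
    ultimately show ?thesis
      by (auto simp: A_def)
  qed
  have "closed {x. norm (cinner x y) \<le> k}" for y :: 'a and k
  proof (rule closed_Collect_le)
    show "continuous_on UNIV (\<lambda>x. norm (cinner x y))"
      unfolding continuous_on_def by (intro ballI tendsto_norm tendsto_cinner_left tendsto_ident_at)
  qed (rule continuous_on_const)
  then have clA: "closed (A n)" for n
    unfolding A_eq by (intro closed_INT) blast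
  have "\<exists>n. interior (A n) \<noteq> {}"
  proof (rule ccontr)
    assume "\<not> ?thesis"
    then have "(euclidean :: 'a topology) interior_of \<Union>(range A) = {}"
      by (intro Baire_category_alt) (use clA in \<open>auto simp: completely_metrizable_space_euclidean\<close>)
    moreover have "\<Union>(range A) = UNIV"
      using real_arch_simple by (auto simp: A_def)
    ultimately show False
      by simp
  qed
  then obtain n x0 where "x0 \<in> interior (A n)"
    by blast
  then obtain e where e: "e > 0" "ball x0 e \<subseteq> A n"
    by (meson mem_interior)
  have "norm (S x) \<le> 4 * real n / e * norm x" for x
  proof (cases "x = 0")
    case True
    then show ?thesis
      using clinear_on_zero[OF lin] by simp
  next
    case False
    define k where "k = complex_of_real (e / (2 * norm x))"
    have k: "norm k = e / (2 * norm x)"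
      unfolding k_def norm_of_real using e by simp
    then have nk: "norm (k *\<^sub>C x) = e / 2"
      using False by (simp add: norm_scaleC)
    have "x0 + k *\<^sub>C x \<in> A n" "x0 \<in> A n"
      using e nk by (auto intro!: subsetD[OF e(2)] simp: dist_norm)
    then have "norm (S (x0 + k *\<^sub>C x)) \<le> real n" "norm (S x0) \<le> real n"
      by (auto simp: A_def)
    moreover have "k *\<^sub>C S x = S (x0 + k *\<^sub>C x) - S x0"
      by (simp add: add scale)
    ultimately have "norm (k *\<^sub>C S x) \<le> real n + real n"
      using norm_triangle_ineq4[of "S (x0 + k *\<^sub>C x)" "S x0"] by simp
    moreover have "norm (k *\<^sub>C S x) = e / (2 * norm x) * norm (S x)"
      by (simp add: norm_scaleC k)
    ultimately show ?thesis
      using False e by (simp add: field_simps)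
  qed
  then show ?thesis
    by blast
qed

section \<open>Resolvents of unitary operators\<close>

lemma norm_one_minus_ge:
  assumes "norm (U x) = norm (x::'a::complex_inner)"
  shows "\<bar>1 - norm \<zeta>\<bar> * norm x \<le> norm (x - \<zeta> *\<^sub>C U x)"
proof -
  have "norm (\<zeta> *\<^sub>C U x) = norm \<zeta> * norm x"
    using assms by (simp add: norm_scaleC)
  then have "\<bar>norm x - norm \<zeta> * norm x\<bar> \<le> norm (x - \<zeta> *\<^sub>C U x)"
    using norm_triangle_ineq3[of x "\<zeta> *\<^sub>C U x"] by simp
  moreover have "\<bar>norm x - norm \<zeta> * norm x\<bar> = \<bar>1 - norm \<zeta>\<bar> * norm x"
    using abs_mult[of "1 - norm \<zeta>" "norm x"] by (simp add: left_diff_distrib)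
  ultimately show ?thesis
    by simp
qed

lemma clinear_on_one_minus:
  assumes T: "clinear_on L T"
  shows "clinear_on L (\<lambda>x. x - \<zeta> *\<^sub>C T x)"
proof (rule clinear_onI)
  fix x y assume "x \<in> L" "y \<in> L"
  then have "\<zeta> *\<^sub>C T (x + y) = \<zeta> *\<^sub>C T x + \<zeta> *\<^sub>C T y"
    using clinear_on_add[OF T] scaleC_add_right by metis
  then show "x + y - \<zeta> *\<^sub>C T (x + y) = x - \<zeta> *\<^sub>C T x + (y - \<zeta> *\<^sub>C T y)"
    by simp
next
  fix c x assume "x \<in> L"
  then show "c *\<^sub>C x - \<zeta> *\<^sub>C T (c *\<^sub>C x) = c *\<^sub>C (x - \<zeta> *\<^sub>C T x)"
    using clinear_on_scale[OF T] by (simp add: complex_vector.scale_right_diff_distrib mult.commute)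
qed

lemma norm_one_minus_le:
  assumes "norm (T x) \<le> norm (x::'a::complex_inner)"
  shows "norm (x - \<zeta> *\<^sub>C T x) \<le> (1 + norm \<zeta>) * norm x"
proof -
  have "norm (x - \<zeta> *\<^sub>C T x) \<le> norm x + norm \<zeta> * norm (T x)"
    using norm_triangle_ineq4[of x "\<zeta> *\<^sub>C T x"] by (simp add: norm_scaleC)
  also have "\<dots> \<le> norm x + norm \<zeta> * norm x"
    using assms by (intro add_mono mult_left_mono) auto
  finally show ?thesis
    by (simp add: algebra_simps)
qed

lemma clinear_on_inv:
  assumes T: "clinear_on UNIV T" and b: "bij T"
  shows "clinear_on UNIV (inv T)"
proof (rule clinear_onI)
  have T_inv: "T (inv T z) = z" for z
    using b by (simp add: bij_is_surj surj_f_inv_f)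
  fix x y c
  have "T (inv T x + inv T y) = x + y" "T (c *\<^sub>C inv T x) = c *\<^sub>C x"
    using clinear_on_add[OF T] clinear_on_scale[OF T] by (simp_all add: T_inv)
  then show "inv T (x + y) = inv T x + inv T y" "inv T (c *\<^sub>C x) = c *\<^sub>C inv T x"
    using b by (metis bij_inv_eq_iff)+
qed

locale unitary =
  fixes U :: "'k::complex_hilbert \<Rightarrow> 'k"
  assumes unitary: "unitary_op U"
begin

lemma iso: "isometry_on UNIV U" and surj: "surj U"
  using unitary by (auto simp: unitary_op_def)

lemma lin: "clinear_on UNIV U"
  by (rule isometry_on_clinear[OF iso])

lemma norm_U: "norm (U x) = norm x"
  by (rule isometry_on_norm[OF iso UNIV_I])

lemma cinner_U: "cinner (U x) (U y) = cinner x y"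
  by (rule isometry_on_cinner[OF iso]) auto

lemma bij_one_minus:
  assumes "norm \<zeta> \<noteq> 1"
  shows "bij (\<lambda>x. x - \<zeta> *\<^sub>C U x)"
proof (rule bij_bounded_below)
  show "clinear_on UNIV (\<lambda>x. x - \<zeta> *\<^sub>C U x)"
    by (rule clinear_on_one_minus[OF lin])
  show "norm (x - \<zeta> *\<^sub>C U x) \<le> (1 + norm \<zeta>) * norm x" for x
    by (rule norm_one_minus_le) (simp add: norm_U)
  show "\<bar>1 - norm \<zeta>\<bar> * norm x \<le> norm (x - \<zeta> *\<^sub>C U x)" for x
    by (rule norm_one_minus_ge[OF norm_U])
  show "0 < \<bar>1 - norm \<zeta>\<bar>"
    using assms by simp
  fix y assume *: "\<And>x. cinner (x - \<zeta> *\<^sub>C U x) y = 0"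
  obtain v where v: "U v = y"
    using surj by (metis surjD)
  \<comment> \<open>hence \<open>y = cnj \<zeta> v\<close> with \<open>v\<close> of the same norm as \<open>y\<close>\<close>
  have e: "cinner x y = \<zeta> * cinner x v" for x
    using *[of x] cinner_U[of x v] by (simp add: cinner_diff_left cinner_scaleC_left v)
  have "cinner y x = cinner (cnj \<zeta> *\<^sub>C v) x" for x
    using arg_cong[OF e[of x], of cnj] cinner_commute[of y x] cinner_commute[of v x]
    by (simp add: cinner_scaleC_left)
  then have "y = cnj \<zeta> *\<^sub>C v"
    by (rule cinner_left_cancel)
  then have "norm v = norm \<zeta> * norm v"
    using v norm_U[of v] norm_scaleC[of "cnj \<zeta>" v] by simp
  then have "norm v = 0"
    using assms by simp
  then show "y = 0"
    using v norm_U[of v] by simp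
qed

definition res :: "complex \<Rightarrow> 'k \<Rightarrow> 'k"
  where "res \<zeta> = inv (\<lambda>x. x - \<zeta> *\<^sub>C U x)"

context
  fixes \<zeta> :: complex
  assumes \<zeta>: "norm \<zeta> \<noteq> 1"
begin

lemma res_left: "res \<zeta> (x - \<zeta> *\<^sub>C U x) = x"
  unfolding res_def using inv_f_f[OF bij_is_inj[OF bij_one_minus[OF \<zeta>]], of x] .

lemma res_right: "res \<zeta> x - \<zeta> *\<^sub>C U (res \<zeta> x) = x"
  unfolding res_def using surj_f_inv_f[OF bij_is_surj[OF bij_one_minus[OF \<zeta>]], of x] .

lemma res_clinear: "clinear_on UNIV (res \<zeta>)"
  unfolding res_def by (rule clinear_on_inv[OF clinear_on_one_minus[OF lin] bij_one_minus[OF \<zeta>]])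

lemma norm_res_le: "norm (res \<zeta> x) \<le> norm x / \<bar>1 - norm \<zeta>\<bar>"
proof -
  have "\<bar>1 - norm \<zeta>\<bar> * norm (res \<zeta> x) \<le> norm x"
    using norm_one_minus_ge[of U "res \<zeta> x" \<zeta>, OF norm_U] by (simp add: res_right)
  then show ?thesis
    using \<zeta> by (simp add: pos_le_divide_eq mult.commute)
qed

end

lemma resolvent_identity:
  assumes "norm \<eta> \<noteq> 1" "norm \<zeta> \<noteq> 1"
  shows "res \<eta> x - res \<zeta> x = (\<eta> - \<zeta>) *\<^sub>C res \<eta> (U (res \<zeta> x))"
proof -
  let ?u = "res \<zeta> x"
  have x: "x = ?u - \<zeta> *\<^sub>C U ?u"
    by (simp add: res_right[OF assms(2)])
  have "x = (?u - \<eta> *\<^sub>C U ?u) + (\<eta> - \<zeta>) *\<^sub>C U ?u"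
    by (subst x) (simp add: complex_vector.scale_left_diff_distrib)
  then have "res \<eta> x = res \<eta> ((?u - \<eta> *\<^sub>C U ?u) + (\<eta> - \<zeta>) *\<^sub>C U ?u)"
    by simp
  also have "\<dots> = ?u + (\<eta> - \<zeta>) *\<^sub>C res \<eta> (U ?u)"
    by (simp add: clinear_on_add[OF res_clinear[OF assms(1)]]
        clinear_on_scale[OF res_clinear[OF assms(1)]] res_left[OF assms(1)])
  finally show ?thesis
    by simp
qed

lemma res_tendsto:
  assumes "norm \<zeta> \<noteq> 1"
  shows "((\<lambda>\<eta>. res \<eta> x) \<longlongrightarrow> res \<zeta> x) (at \<zeta>)"
proof -
  let ?b = "\<lambda>\<eta>. norm (\<eta> - \<zeta>) * (norm (res \<zeta> x) / \<bar>1 - norm \<eta>\<bar>)"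
  have "open {\<eta>::complex. norm \<eta> \<noteq> 1}"
    by (intro open_Collect_neq continuous_intros)
  then have ev: "\<forall>\<^sub>F \<eta> in at \<zeta>. norm \<eta> \<noteq> 1"
    using assms by (auto dest!: eventually_nhds_in_open[of _ \<zeta>] simp: eventually_at_filter
        elim: eventually_mono)
  have "(?b \<longlongrightarrow> norm (\<zeta> - \<zeta>) * (norm (res \<zeta> x) / \<bar>1 - norm \<zeta>\<bar>)) (at \<zeta>)"
    using assms by (intro tendsto_intros) auto
  then have "(?b \<longlongrightarrow> 0) (at \<zeta>)"
    by simp
  moreover have "\<forall>\<^sub>F \<eta> in at \<zeta>. norm (res \<eta> x - res \<zeta> x) \<le> ?b \<eta>"
    using ev
  proof eventually_elim
    case (elim \<eta>)
    have "norm (res \<eta> x - res \<zeta> x) = norm (\<eta> - \<zeta>) * norm (res \<eta> (U (res \<zeta> x)))"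
      by (simp add: resolvent_identity[OF elim assms] norm_scaleC)
    also have "\<dots> \<le> ?b \<eta>"
      using norm_res_le[OF elim, of "U (res \<zeta> x)"] by (intro mult_left_mono) (auto simp: norm_U)
    finally show ?case .
  qed
  ultimately have "((\<lambda>\<eta>. res \<eta> x - res \<zeta> x) \<longlongrightarrow> 0) (at \<zeta>)"
    by (rule Lim_null_comparison[rotated])
  then show ?thesis
    by (simp add: LIM_zero_iff)
qed

lemma res_holomorphic: "(\<lambda>\<zeta>. cinner (res \<zeta> x) y) holomorphic_on {\<zeta>. norm \<zeta> \<noteq> 1}"
proof -
  have op: "open {\<eta>::complex. norm \<eta> \<noteq> 1}"
    by (intro open_Collect_neq continuous_intros)
  have "((\<lambda>\<zeta>. cinner (res \<zeta> x) y) has_field_derivative cinner (res \<zeta> (U (res \<zeta> x))) y) (at \<zeta>)"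
    if \<zeta>: "norm \<zeta> \<noteq> 1" for \<zeta>
    unfolding has_field_derivative_iff
  proof (rule Lim_transform_eventually)
    show "((\<lambda>\<eta>. cinner (res \<eta> (U (res \<zeta> x))) y) \<longlongrightarrow> cinner (res \<zeta> (U (res \<zeta> x))) y) (at \<zeta>)"
      by (rule tendsto_cinner_left[OF res_tendsto[OF \<zeta>]])
    have "\<forall>\<^sub>F \<eta> in at \<zeta>. norm \<eta> \<noteq> 1 \<and> \<eta> \<noteq> \<zeta>"
      using eventually_nhds_in_open[OF op, of \<zeta>] \<zeta>
      by (auto simp: eventually_at_filter elim: eventually_mono)
    then show "\<forall>\<^sub>F \<eta> in at \<zeta>. cinner (res \<eta> (U (res \<zeta> x))) y
        = (cinner (res \<eta> x) y - cinner (res \<zeta> x) y) / (\<eta> - \<zeta>)"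
    proof eventually_elim
      case (elim \<eta>)
      then have "cinner (res \<eta> x) y - cinner (res \<zeta> x) y
          = (\<eta> - \<zeta>) * cinner (res \<eta> (U (res \<zeta> x))) y"
        using resolvent_identity[of \<eta> \<zeta> x] \<zeta> by (simp add: cinner_scaleC_left flip: cinner_diff_left)
      then show ?case
        using elim by simp
    qed
  qed
  then show ?thesis
    using holomorphic_on_open[OF op] by blast
qed

text \<open>For \<open>x = (E - \<eta> U) u\<close> and \<open>y = (E - \<zeta> U) v\<close> with \<open>\<eta> * cnj \<zeta> = 1\<close> both sides expand to the same
  combination of inner products of \<open>u\<close>, \<open>U u\<close>, \<open>v\<close>, \<open>U v\<close>, because \<open>U\<close> preserves them.\<close>

lemma res_adjoint:
  assumes "norm \<zeta> \<noteq> 1" "\<zeta> \<noteq> 0"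
  shows "cinner (res (1 / cnj \<zeta>) x) y + cinner x (res \<zeta> y) = cinner x y"
proof -
  have \<eta>: "norm (1 / cnj \<zeta>) \<noteq> 1"
    using assms by (simp add: norm_divide)
  define u where "u = res (1 / cnj \<zeta>) x"
  define v where "v = res \<zeta> y"
  have x: "x = u - (1 / cnj \<zeta>) *\<^sub>C U u" and y: "y = v - \<zeta> *\<^sub>C U v"
    unfolding u_def v_def by (simp_all only: res_right[OF \<eta>] res_right[OF assms(1)])
  have "cinner u y + cinner x v = cinner x y"
    unfolding x y using assms(2) by (simp add: cinner_linear cinner_U field_simps)
  then show ?thesis
    by (simp add: u_def v_def)
qed

end

section \<open>Generalized resolvents\<close>

text \<open>The compression is visible only through its matrix coefficients, which are matrix coefficients of
  the resolvent of \<open>U\<close>. All properties needed later pass from one to the other in this form.\<close>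

lemma generalized_resolventE:
  fixes R :: "complex \<Rightarrow> 'h::complex_hilbert \<Rightarrow> 'h"
  assumes "generalized_resolvent TYPE('k::complex_hilbert) D V R"
  obtains J :: "'h \<Rightarrow> 'k::complex_hilbert" and U where "isometry_on UNIV J" "unitary U"
    "\<And>\<zeta> x y. norm \<zeta> \<noteq> 1 \<Longrightarrow> cinner (R \<zeta> x) y = cinner (unitary.res U \<zeta> (J x)) (J y)"
proof -
  obtain J :: "'h \<Rightarrow> 'k" and U where J: "isometry_on UNIV J" and U: "unitary_op U"
    and R: "\<And>\<zeta> h. norm \<zeta> \<noteq> 1 \<Longrightarrow>
      J (R \<zeta> h) = orth_proj (range J) (inv (\<lambda>x. x - \<zeta> *\<^sub>C U x) (J h))"
    using assms by (auto simp: generalized_resolvent_def)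
  interpret unitary U
    by (rule unitary.intro[OF U])
  note lin = isometry_on_clinear[OF J]
  have sub: "csubspace (range J)"
    by (rule csubspace_image[OF lin]) simp
  have cl: "closed (range J)"
    by (rule closed_image_bounded_below[OF lin, of 1 1]) (auto simp: isometry_on_norm[OF J])
  have "cinner (R \<zeta> x) y = cinner (res \<zeta> (J x)) (J y)" if "norm \<zeta> \<noteq> 1" for \<zeta> x y
  proof -
    have "cinner (R \<zeta> x) y = cinner (J (R \<zeta> x)) (J y)"
      using isometry_on_cinner[OF J] by simp
    also have "\<dots> = cinner (res \<zeta> (J x)) (J y)"
      unfolding R[OF that] res_def by (rule orth_proj_cinner[OF sub cl]) simp
    finally show ?thesis .
  qed
  then show ?thesis
    using that J unitary.intro[OF U] by blast
qed

context
  fixes D :: "'h::complex_hilbert set" and V :: "'h \<Rightarrow> 'h" and R :: "complex \<Rightarrow> 'h \<Rightarrow> 'h"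
  assumes R: "generalized_resolvent TYPE('k::complex_hilbert) D V R"
begin

lemma generalized_resolvent_clinear:
  assumes "norm \<zeta> \<noteq> 1"
  shows "clinear_on UNIV (R \<zeta>)"
proof -
  obtain J :: "'h \<Rightarrow> 'k" and U where J: "isometry_on UNIV J" and U: "unitary U"
    and RJ: "\<And>\<zeta> x y. norm \<zeta> \<noteq> 1 \<Longrightarrow> cinner (R \<zeta> x) y = cinner (unitary.res U \<zeta> (J x)) (J y)"
    using generalized_resolventE[OF R] by blast
  note lins = unitary.res_clinear[OF U assms] isometry_on_clinear[OF J]
  show ?thesis
  proof (rule clinear_onI)
    show "R \<zeta> (x + y) = R \<zeta> x + R \<zeta> y" for x y
      by (rule cinner_left_cancel)
         (simp add: RJ[OF assms] lins[THEN clinear_on_add] cinner_add_left)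
    show "R \<zeta> (c *\<^sub>C x) = c *\<^sub>C R \<zeta> x" for c x
      by (rule cinner_left_cancel)
         (simp add: RJ[OF assms] lins[THEN clinear_on_scale] cinner_scaleC_left)
  qed
qed

lemma generalized_resolvent_norm_le:
  assumes "norm \<zeta> \<noteq> 1"
  shows "norm (R \<zeta> x) \<le> norm x / \<bar>1 - norm \<zeta>\<bar>"
proof -
  obtain J :: "'h \<Rightarrow> 'k" and U where J: "isometry_on UNIV J" and U: "unitary U"
    and RJ: "\<And>\<zeta> x y. norm \<zeta> \<noteq> 1 \<Longrightarrow> cinner (R \<zeta> x) y = cinner (unitary.res U \<zeta> (J x)) (J y)"
    using generalized_resolventE[OF R] by blast
  have nJ: "norm (J x) = norm x" for x
    by (rule isometry_on_norm[OF J UNIV_I])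
  show ?thesis
  proof (rule norm_le_cinner)
    fix y
    have "norm (cinner (R \<zeta> x) y) \<le> norm (unitary.res U \<zeta> (J x)) * norm (J y)"
      unfolding RJ[OF assms] by (rule norm_cinner_le)
    also have "\<dots> \<le> norm x / \<bar>1 - norm \<zeta>\<bar> * norm y"
      using unitary.norm_res_le[OF U assms, of "J x"]
      unfolding nJ by (rule mult_right_mono) simp
    finally show "norm (cinner (R \<zeta> x) y) \<le> norm x / \<bar>1 - norm \<zeta>\<bar> * norm y" .
  qed simp
qed

lemma generalized_resolvent_holomorphic:
  "(\<lambda>\<zeta>. cinner (R \<zeta> x) y) holomorphic_on {\<zeta>. norm \<zeta> \<noteq> 1}"
proof -
  obtain J :: "'h \<Rightarrow> 'k" and U where J: "isometry_on UNIV J" and U: "unitary U"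
    and RJ: "\<And>\<zeta> x y. norm \<zeta> \<noteq> 1 \<Longrightarrow> cinner (R \<zeta> x) y = cinner (unitary.res U \<zeta> (J x)) (J y)"
    using generalized_resolventE[OF R] by blast
  show ?thesis
    by (rule holomorphic_transform[OF unitary.res_holomorphic[OF U, of "J x" "J y"]]) (simp add: RJ)
qed

text \<open>The symmetry $R_{1/\bar\zeta} = E - R_\zeta^*$ ties the two components of the complement of the
  circle together; everything on the exterior will be deduced from the disc through it.\<close>

lemma generalized_resolvent_adjoint:
  assumes "norm \<zeta> \<noteq> 1" "\<zeta> \<noteq> 0"
  shows "cinner (R (1 / cnj \<zeta>) x) y + cinner x (R \<zeta> y) = cinner x y"
proof -
  obtain J :: "'h \<Rightarrow> 'k" and U where J: "isometry_on UNIV J" and U: "unitary U"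
    and RJ: "\<And>\<zeta> x y. norm \<zeta> \<noteq> 1 \<Longrightarrow> cinner (R \<zeta> x) y = cinner (unitary.res U \<zeta> (J x)) (J y)"
    using generalized_resolventE[OF R] by blast
  have \<eta>: "norm (1 / cnj \<zeta>) \<noteq> 1"
    using assms by (simp add: norm_divide)
  have "cinner x (R \<zeta> y) = cinner (J x) (unitary.res U \<zeta> (J y))"
    using arg_cong[OF RJ[OF assms(1), of y x], of cnj]
    by (simp only: cinner_commute[of x] cinner_commute[of "J x"])
  then show ?thesis
    using unitary.res_adjoint[OF U assms, of "J x" "J y"] isometry_on_cinner[OF J]
    by (simp add: RJ[OF \<eta>])
qed

end

section \<open>Extensions of an isometry on a closed subspace\<close>

lemma inj_of_kernel:
  assumes "clinear_on UNIV T" and "\<And>x. T x = 0 \<Longrightarrow> x = 0"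
  shows "inj T"
proof (rule injI)
  fix x y assume "T x = T y"
  then have "T (x - y) = 0"
    using clinear_on_diff[OF assms(1)] by simp
  then show "x = y"
    using assms(2) by fastforce
qed

text \<open>\<open>M\<close> and \<open>A\<close> stand for $M_{z_0}$ and $V_{z_0}$; \<open>ext C\<close> is $V_{z_0} \oplus C$.\<close>

locale partial_isometry =
  fixes M :: "'h::complex_hilbert set" and A :: "'h \<Rightarrow> 'h"
  assumes subM: "csubspace M" and clM: "closed M" and isoA: "isometry_on M A"
begin

abbreviation "M' \<equiv> A ` M"
abbreviation "N \<equiv> orth_compl M"
abbreviation "N' \<equiv> orth_compl M'"
abbreviation "P \<equiv> orth_proj M"
abbreviation "Q \<equiv> orth_proj N"
abbreviation "P' \<equiv> orth_proj M'"
abbreviation "Q' \<equiv> orth_proj N'"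

lemma linA: "clinear_on M A"
  by (rule isometry_on_clinear[OF isoA])

lemma normA: "x \<in> M \<Longrightarrow> norm (A x) = norm x"
  by (rule isometry_on_norm[OF isoA])

lemma subM': "csubspace M'"
  by (rule csubspace_image[OF linA subM])

lemma clM': "closed M'"
  by (rule closed_image_bounded_below[OF linA subM clM, of 1 1]) (auto simp: normA)

lemmas subN = csubspace_orth_compl[of M]
lemmas subN' = csubspace_orth_compl[of "A ` M"]

lemmas P_mem = orth_proj_mem(1)[OF subM clM]
lemmas P'_mem = orth_proj_mem(1)[OF subM' clM']
lemmas linP = clinear_orth_proj[OF subM clM]
lemmas linP' = clinear_orth_proj[OF subM' clM']
lemmas linQ = clinear_orth_proj[OF subN closed_orth_compl]
lemmas linQ' = clinear_orth_proj[OF subN' closed_orth_compl]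

lemma Q_eq: "Q x = x - P x"
  by (rule orth_proj_compl[OF subM clM])

lemma Q'_eq: "Q' x = x - P' x"
  by (rule orth_proj_compl[OF subM' clM'])

lemma Q_mem: "Q x \<in> N"
  unfolding Q_eq by (rule orth_proj_mem(2)[OF subM clM])

lemma Q'_mem: "Q' x \<in> N'"
  unfolding Q'_eq by (rule orth_proj_mem(2)[OF subM' clM'])

lemma P_ident: "x \<in> M \<Longrightarrow> P x = x" and P_zero: "x \<in> N \<Longrightarrow> P x = 0"
  and Q_ident: "x \<in> N \<Longrightarrow> Q x = x" and Q_zero: "x \<in> M \<Longrightarrow> Q x = 0"
  by (auto simp: orth_proj_ident[OF subM] orth_proj_zero[OF subM] Q_eq)

lemma P'_ident: "x \<in> M' \<Longrightarrow> P' x = x" and P'_zero: "x \<in> N' \<Longrightarrow> P' x = 0"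
  by (auto simp: orth_proj_ident[OF subM'] orth_proj_zero[OF subM'])

definition ext :: "('h \<Rightarrow> 'h) \<Rightarrow> 'h \<Rightarrow> 'h"
  where "ext C h = A (P h) + C (Q h)"

lemma ext_clinear:
  assumes C: "clinear_on N C"
  shows "clinear_on UNIV (ext C)"
proof (rule clinear_onI)
  fix x y c
  have "A (P (x + y)) = A (P x) + A (P y)"
    using clinear_on_add[OF linP] clinear_on_add[OF linA] P_mem by simp
  moreover have "C (Q (x + y)) = C (Q x) + C (Q y)"
    using clinear_on_add[OF linQ] clinear_on_add[OF C] Q_mem by simp
  ultimately show "ext C (x + y) = ext C x + ext C y"
    by (simp add: ext_def)
  have "A (P (c *\<^sub>C x)) = c *\<^sub>C A (P x)"
    using clinear_on_scale[OF linP] clinear_on_scale[OF linA] P_mem by simp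
  moreover have "C (Q (c *\<^sub>C x)) = c *\<^sub>C C (Q x)"
    using clinear_on_scale[OF linQ] clinear_on_scale[OF C] Q_mem by simp
  ultimately show "ext C (c *\<^sub>C x) = c *\<^sub>C ext C x"
    by (simp add: ext_def complex_vector.scale_right_distrib)
qed

lemma ext_M: "clinear_on N C \<Longrightarrow> x \<in> M \<Longrightarrow> ext C x = A x"
  using clinear_on_zero[OF _ subN] by (simp add: ext_def P_ident Q_zero)

lemma ext_N: "x \<in> N \<Longrightarrow> ext C x = C x"
  using clinear_on_zero[OF linA subM] by (simp add: ext_def P_zero Q_ident)

lemma norm_ext:
  assumes "C ` N \<subseteq> N'"
  shows "(norm (ext C x))\<^sup>2 = (norm (P x))\<^sup>2 + (norm (C (Q x)))\<^sup>2"
proof -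
  have "C (Q x) \<in> N'"
    using assms Q_mem by blast
  then have "cinner (A (P x)) (C (Q x)) = 0"
    using P_mem by (auto simp: orth_compl_def cinner_eq_zero_sym[of "A (P x)"])
  then show ?thesis
    unfolding ext_def by (simp add: pythagoras normA P_mem)
qed

lemma norm_ext_le:
  assumes "contraction_on N C" "C ` N \<subseteq> N'"
  shows "norm (ext C x) \<le> norm x"
proof -
  have "norm (C (Q x)) \<le> norm (Q x)"
    using assms Q_mem by (auto simp: contraction_on_def)
  then have "(norm (ext C x))\<^sup>2 \<le> (norm (P x))\<^sup>2 + (norm (Q x))\<^sup>2"
    unfolding norm_ext[OF assms(2)] by (simp add: power_mono)
  then show ?thesis
    using norm_orth_proj_split[OF subM clM, of x] by (simp add: power2_le_imp_le)
qed

lemma ext_isometry: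
  assumes "isometry_on N C" "C ` N \<subseteq> N'"
  shows "isometry_on UNIV (ext C)"
  unfolding isometry_on_def
proof (intro conjI ballI)
  show "clinear_on UNIV (ext C)"
    by (rule ext_clinear[OF isometry_on_clinear[OF assms(1)]])
  fix x
  have "(norm (ext C x))\<^sup>2 = (norm x)\<^sup>2"
    unfolding norm_ext[OF assms(2)] isometry_on_norm[OF assms(1) Q_mem]
    by (rule norm_orth_proj_split[OF subM clM, symmetric])
  then show "norm (ext C x) = norm x"
    by (simp add: power2_eq_iff_nonneg)
qed

end

text \<open>The set \<open>defect\<close> is the orthogonal complement of $(E - wA)M$. For \<open>w = (\<lambda> - z\<^sub>0) / (1 - cnj z\<^sub>0 \<lambda>)\<close>
  it is $N_\lambda$, so the operator \<open>W\<close> of the boundary criterion is $W_{\lambda;z_0}$.\<close>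

locale boundary_point = partial_isometry +
  fixes w :: complex
  assumes norm_w: "norm w = 1"
begin

lemma cnj_w: "w * cnj w = 1" "cnj w * w = 1"
  using complex_norm_square[of w] norm_w by (simp_all add: mult.commute)

definition defect :: "'a set"
  where "defect = orth_compl ((\<lambda>g. g - w *\<^sub>C A g) ` M)"

lemma cinner_defect:
  assumes "g \<in> M"
  shows "cinner (A (P f) - cnj w *\<^sub>C P' f) (A g) = cinner f (g - w *\<^sub>C A g)"
proof -
  have "cinner (A (P f)) (A g) = cinner (P f) g"
    by (rule isometry_on_cinner[OF isoA subM P_mem assms])
  also have "\<dots> = cinner f g"
    by (rule orth_proj_cinner[OF subM clM assms])
  finally have "cinner (A (P f)) (A g) = cinner f g" .
  moreover have "cinner (P' f) (A g) = cinner f (A g)"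
    by (rule orth_proj_cinner[OF subM' clM']) (use assms in auto)
  ultimately show ?thesis
    by (simp add: cinner_diff_left cinner_diff_right cinner_scaleC_left cinner_scaleC_right)
qed

text \<open>Orthogonality to $(E - wA)M$ says $P_M f = \bar w A^* P_{M'} f$; since \<open>A\<close> maps \<open>M\<close> isometrically
  onto \<open>M'\<close>, applying \<open>A\<close> loses nothing.\<close>

lemma defect_iff: "f \<in> defect \<longleftrightarrow> A (P f) = cnj w *\<^sub>C P' f"
proof
  assume "f \<in> defect"
  then have "cinner (A (P f) - cnj w *\<^sub>C P' f) (A g) = 0" if "g \<in> M" for g
    unfolding cinner_defect[OF that] using that by (auto simp: defect_def orth_compl_def)
  then have "A (P f) - cnj w *\<^sub>C P' f \<in> N'"
    by (auto simp: orth_compl_def)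
  moreover have "A (P f) - cnj w *\<^sub>C P' f \<in> M'"
    by (intro complex_vector.subspace_diff[OF subM'] complex_vector.subspace_scale[OF subM'] P'_mem
        imageI P_mem)
  ultimately have "A (P f) - cnj w *\<^sub>C P' f = 0"
    by (rule orth_compl_Int[rotated])
  then show "A (P f) = cnj w *\<^sub>C P' f"
    by simp
next
  assume "A (P f) = cnj w *\<^sub>C P' f"
  then have "cinner f (g - w *\<^sub>C A g) = 0" if "g \<in> M" for g
    using cinner_defect[OF that, of f] by simp
  then show "f \<in> defect"
    by (auto simp: defect_def orth_compl_def)
qed

lemma sub_defect: "csubspace defect"
  unfolding defect_def by (rule csubspace_orth_compl)

text \<open>On the defect space the components along \<open>M\<close> and \<open>M'\<close> have equal norms, hence so do the
  complementary components. This is why \<open>W\<close> is well defined and isometric.\<close>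

lemma defect_norm:
  assumes "f \<in> defect"
  shows "norm (Q' f) = norm (Q f)"
proof -
  have "norm (P f) = norm (P' f)"
    using normA[OF P_mem, of f] assms norm_w by (simp add: defect_iff norm_scaleC)
  then have "(norm (Q' f))\<^sup>2 = (norm (Q f))\<^sup>2"
    using norm_orth_proj_split[OF subM clM, of f] norm_orth_proj_split[OF subM' clM', of f] by simp
  then show ?thesis
    by (simp add: power2_eq_iff_nonneg)
qed

lemma defect_unique:
  assumes "f \<in> defect" "f' \<in> defect" "Q f = Q f'"
  shows "Q' f = Q' f'"
proof -
  have "norm (Q' (f - f')) = norm (Q (f - f'))"
    by (rule defect_norm[OF complex_vector.subspace_diff[OF sub_defect assms(1,2)]])
  then show ?thesis
    using assms(3) by (simp add: clinear_on_diff[OF linQ'] clinear_on_diff[OF linQ])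
qed

text \<open>The component of the left-hand side in \<open>M'\<close> vanishes: on the defect space the operator \<open>E - w (A \<oplus> C)\<close> acts
  as \<open>- w (C - W)\<close> on the \<open>N\<close>-component.\<close>

lemma one_minus_ext_defect:
  assumes "f \<in> defect"
  shows "f - w *\<^sub>C ext C f = Q' f - w *\<^sub>C C (Q f)"
proof -
  have "w *\<^sub>C A (P f) = P' f"
    using assms by (simp add: defect_iff cnj_w)
  then show ?thesis
    by (simp add: ext_def complex_vector.scale_right_distrib Q'_eq)
qed

text \<open>Solvability of \<open>P' u - w A u = v\<close> in \<open>M\<close> for every \<open>v\<close> in \<open>M'\<close> is exactly what is needed to
  complete a given \<open>h\<close> in \<open>N\<close> by a vector of \<open>M\<close> to an element of the defect space.\<close>

lemma defect_onto:
  assumes proj: "P' ` (\<lambda>g. g - w *\<^sub>C A g) ` M = M'" and h: "h \<in> N"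
  shows "\<exists>f\<in>defect. Q f = h"
proof -
  have "- P' h \<in> M'"
    using P'_mem subM' by (simp add: complex_vector.subspace_neg)
  then have "- P' h \<in> P' ` (\<lambda>g. g - w *\<^sub>C A g) ` M"
    by (simp only: proj)
  then obtain u where u: "u \<in> M" "P' (u - w *\<^sub>C A u) = - P' h"
    by force
  have wA: "w *\<^sub>C A u \<in> M'"
    using u(1) subM' by (simp add: complex_vector.subspace_scale)
  have "P' u - w *\<^sub>C A u = - P' h"
    using u(2) P'_ident[OF wA] clinear_on_diff[OF linP'] by simp
  then have "w *\<^sub>C A u = P' (u + h)"
    using clinear_on_add[OF linP'] by (simp add: algebra_simps)
  then have "A u = cnj w *\<^sub>C P' (u + h)"
    by (metis cnj_w(2) complex_vector.scale_one scaleC_scaleC)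
  moreover have "P (u + h) = u"
    using clinear_on_add[OF linP] u(1) h by (simp add: P_ident P_zero)
  ultimately have "u + h \<in> defect"
    by (simp add: defect_iff)
  moreover have "Q (u + h) = h"
    using clinear_on_add[OF linQ] u(1) h by (simp add: Q_ident Q_zero)
  ultimately show ?thesis
    by blast
qed

text \<open>Equality of norms forces a solution of \<open>P' g = w A g\<close> to be an eigenvector of \<open>A\<close>.\<close>

lemma eigenvector_of_compression:
  assumes g: "g \<in> M" "g - w *\<^sub>C A g \<in> N'"
  shows "A g = cnj w *\<^sub>C g"
proof -
  have wA: "w *\<^sub>C A g \<in> M'"
    using g(1) subM' by (simp add: complex_vector.subspace_scale)
  have "P' g - w *\<^sub>C A g = P' (g - w *\<^sub>C A g)"
    using P'_ident[OF wA] clinear_on_diff[OF linP'] by simp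
  also have "\<dots> = 0"
    by (rule P'_zero[OF g(2)])
  finally have e: "P' g = w *\<^sub>C A g"
    by simp
  then have "norm (P' g) = norm g"
    using normA[OF g(1)] norm_w by (simp add: norm_scaleC)
  then have "Q' g = 0"
    using norm_orth_proj_split[OF subM' clM', of g] by simp
  then have "g = w *\<^sub>C A g"
    using e by (simp add: Q'_eq)
  then show ?thesis
    by (metis cnj_w(2) complex_vector.scale_one scaleC_scaleC)
qed

text \<open>The boundary criterion. Every vector is a sum of an element \<open>f\<close> of the defect space and a
  \<open>g\<close> in \<open>M\<close>, on which \<open>E - w (A \<oplus> C)\<close> takes the values \<open>- w (C - W) (Q f)\<close>, in \<open>N'\<close>, and
  \<open>(E - w A) g\<close>; the regularity and projection hypotheses say that these values of the second kind
  form a complement of \<open>N'\<close>.\<close>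

theorem bij_one_minus_ext_iff:
  assumes C: "isometry_on N C" "C ` N = N'"
    and W: "\<And>f. f \<in> defect \<Longrightarrow> W (Q f) = cnj w *\<^sub>C Q' f"
    and reg: "\<And>g. g \<in> M \<Longrightarrow> A g = cnj w *\<^sub>C g \<Longrightarrow> g = 0"
    and proj: "P' ` (\<lambda>g. g - w *\<^sub>C A g) ` M = M'"
  shows "bij (\<lambda>x. x - w *\<^sub>C ext C x) \<longleftrightarrow>
    inj_on (\<lambda>x. C x - W x) N \<and> (\<lambda>x. C x - W x) ` N = N'"
proof -
  define T where "T x = x - w *\<^sub>C ext C x" for x
  define G where "G x = C x - W x" for x
  note linC = isometry_on_clinear[OF C(1)]
  have linT: "clinear_on UNIV T"
    unfolding T_def[abs_def] by (rule clinear_on_one_minus[OF ext_clinear[OF linC]])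
  have T_defect: "T f = - (w *\<^sub>C G (Q f))" if "f \<in> defect" for f
    unfolding T_def G_def one_minus_ext_defect[OF that] W[OF that]
    by (simp add: complex_vector.scale_right_diff_distrib cnj_w)
  have T_M: "T g = g - w *\<^sub>C A g" if "g \<in> M" for g
    using ext_M[OF linC that] by (simp add: T_def)
  have G_N': "G h \<in> N'" if "h \<in> N" for h
  proof -
    obtain f where f: "f \<in> defect" "Q f = h"
      using defect_onto[OF proj \<open>h \<in> N\<close>] by blast
    have "C h \<in> N'"
      using C(2) that by blast
    moreover have "W h \<in> N'"
      using W[OF f(1)] f(2) Q'_mem[of f] subN' by (simp add: complex_vector.subspace_scale)
    ultimately show ?thesis
      using subN' by (simp add: G_def complex_vector.subspace_diff)
  qed
  have w0: "w *\<^sub>C x = w *\<^sub>C y \<Longrightarrow> x = y" for x y :: 'a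
    using norm_w by (auto simp: complex_vector.scale_cancel_left)
  have "bij T \<longleftrightarrow> inj_on G N \<and> G ` N = N'"
  proof (intro iffI conjI)
    assume bij: "bij T"
    show "inj_on G N"
    proof (rule inj_onI)
      fix h h' assume hh: "h \<in> N" "h' \<in> N" "G h = G h'"
      obtain f f' where f: "f \<in> defect" "Q f = h" "f' \<in> defect" "Q f' = h'"
        using defect_onto[OF proj] hh by metis
      then have "T f = T f'"
        using hh by (simp add: T_defect)
      then have "f = f'"
        using bij by (metis bij_is_inj injD)
      then show "h = h'"
        using f by simp
    qed
    show "G ` N = N'"
    proof (intro equalityI subsetI)
      fix k assume k: "k \<in> N'"
      obtain x where x: "T x = - (w *\<^sub>C k)"
        using bij by (metis bij_is_surj surjD)
      \<comment> \<open>remove from \<open>x\<close> an element of the defect space with the same \<open>N\<close>-component\<close>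
      obtain f where f: "f \<in> defect" "Q f = Q x"
        using defect_onto[OF proj Q_mem] by blast
      define g where "g = x - f"
      have "Q g = 0"
        using f(2) clinear_on_diff[OF linQ] by (simp add: g_def)
      then have g: "g \<in> M"
        using P_mem[of g] by (simp add: Q_eq)
      have "g - w *\<^sub>C A g = T x - T f"
        using T_M[OF g] clinear_on_diff[OF linT] by (simp add: g_def)
      also have "\<dots> = w *\<^sub>C G (Q x) - w *\<^sub>C k"
        by (simp add: x T_defect[OF f(1)] f(2))
      finally have e: "g - w *\<^sub>C A g = w *\<^sub>C G (Q x) - w *\<^sub>C k" .
      also have "\<dots> \<in> N'"
        using subN' k G_N'[OF Q_mem] by (simp add: complex_vector.subspace_diff complex_vector.subspace_scale)
      finally have "g = 0"
        using reg[OF g eigenvector_of_compression[OF g]] by simp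
      then have "w *\<^sub>C G (Q x) = w *\<^sub>C k"
        using e clinear_on_zero[OF linA subM] by simp
      then show "k \<in> G ` N"
        using w0 Q_mem by blast
    qed (use G_N' in auto)
  next
    assume G: "inj_on G N \<and> G ` N = N'"
    show "bij T"
    proof (rule bijI)
      show "inj T"
      proof (rule inj_of_kernel[OF linT])
        fix x assume "T x = 0"
        then have wx: "w *\<^sub>C ext C x = x"
          by (simp add: T_def)
        then have ex: "ext C x = cnj w *\<^sub>C x"
          by (metis cnj_w(2) complex_vector.scale_one scaleC_scaleC)
        have "C (Q x) \<in> N'"
          using C(2) Q_mem by blast
        then have "P' (ext C x) = A (P x)"
          using clinear_on_add[OF linP'] P'_zero P'_ident P_mem by (simp add: ext_def)
        then have d: "x \<in> defect"
          using clinear_on_scale[OF linP'] by (simp add: defect_iff ex)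
        have "0 \<in> defect" "0 \<in> N"
          using sub_defect subN by (simp_all add: complex_vector.subspace_0)
        then have "T 0 = - (w *\<^sub>C G 0)"
          using T_defect[of 0] Q_ident[of 0] by simp
        then have "w *\<^sub>C G (Q x) = w *\<^sub>C G 0"
          using T_defect[OF d] \<open>T x = 0\<close> clinear_on_zero[OF linT] norm_w by force
        then have "Q x = 0"
          using G w0 Q_mem \<open>0 \<in> N\<close> by (metis inj_onD)
        then have "x \<in> M"
          using P_mem[of x] by (simp add: Q_eq)
        then show "x = 0"
          using reg ex ext_M[OF linC] by simp
      qed
      show "surj T"
        unfolding surj_def
      proof
        fix y
        have "P' y \<in> P' ` (\<lambda>g. g - w *\<^sub>C A g) ` M"
          unfolding proj by (rule P'_mem)
        then obtain u where u: "u \<in> M" "P' y = P' (u - w *\<^sub>C A u)"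
          by force
        \<comment> \<open>after subtracting \<open>(E - w A) u\<close> the right-hand side lies in \<open>N'\<close> and is reached from the
          defect space\<close>
        define k where "k = cnj w *\<^sub>C (u - w *\<^sub>C A u - y)"
        have wk: "w *\<^sub>C k = u - w *\<^sub>C A u - y"
          by (simp add: k_def scaleC_scaleC cnj_w)
        have "P' (u - w *\<^sub>C A u - y) = 0"
          using u(2) clinear_on_diff[OF linP'] by simp
        then have "u - w *\<^sub>C A u - y \<in> N'"
          using Q'_mem[of "u - w *\<^sub>C A u - y"] by (simp add: Q'_eq)
        then have "k \<in> N'"
          using subN' by (simp add: k_def complex_vector.subspace_scale)
        then obtain h where h: "h \<in> N" "k = G h"
          using G by blast
        obtain f where f: "f \<in> defect" "Q f = h"
          using defect_onto[OF proj h(1)] by blast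
        have "T (u + f) = (u - w *\<^sub>C A u) - w *\<^sub>C k"
          using clinear_on_add[OF linT] T_M[OF u(1)] T_defect[OF f(1)] by (simp add: f h)
        also have "\<dots> = y"
          by (simp add: wk)
        finally show "\<exists>x. y = T x"
          by metis
      qed
    qed
  qed
  then show ?thesis
    by (simp add: T_def[abs_def] G_def[abs_def])
qed

end

section \<open>Convergence in the uniform operator topology\<close>

text \<open>For linear operators with domain \<open>L\<close> this is uniform convergence on the unit ball of \<open>L\<close>;
  the relative form passes more directly through compositions.\<close>

definition op_tendsto ::
    "'a::complex_inner set \<Rightarrow> (complex \<Rightarrow> 'a \<Rightarrow> 'b::complex_inner) \<Rightarrow> ('a \<Rightarrow> 'b) \<Rightarrow> complex filter \<Rightarrow> bool"
  where "op_tendsto L F F0 A \<longleftrightarrow>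
    (\<forall>e>0. \<forall>\<^sub>F w in A. \<forall>x\<in>L. norm (F w x - F0 x) \<le> e * norm x)"

lemma op_tendstoD:
  "op_tendsto L F F0 A \<Longrightarrow> 0 < e \<Longrightarrow> \<forall>\<^sub>F w in A. \<forall>x\<in>L. norm (F w x - F0 x) \<le> e * norm x"
  by (simp add: op_tendsto_def)

lemma op_tendsto_cong:
  assumes "op_tendsto L F F0 A" and "\<forall>\<^sub>F w in A. \<forall>x\<in>L. F w x = G w x" and "\<forall>x\<in>L. F0 x = G0 x"
  shows "op_tendsto L G G0 A"
  unfolding op_tendsto_def
proof (intro allI impI)
  fix e :: real assume "0 < e"
  from op_tendstoD[OF assms(1) this] assms(2)
  show "\<forall>\<^sub>F w in A. \<forall>x\<in>L. norm (G w x - G0 x) \<le> e * norm x"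
    by eventually_elim (use assms(3) in auto)
qed

lemma op_tendsto_subset: "op_tendsto L F F0 A \<Longrightarrow> K \<subseteq> L \<Longrightarrow> op_tendsto K F F0 A"
  unfolding op_tendsto_def by (blast intro: eventually_mono)

lemma op_tendsto_mono: "op_tendsto L F F0 A \<Longrightarrow> B \<le> A \<Longrightarrow> op_tendsto L F F0 B"
  unfolding op_tendsto_def using filter_leD by blast

lemma op_tendsto_apply:
  assumes "op_tendsto L F F0 A" and "x \<in> L"
  shows "((\<lambda>w. F w x) \<longlongrightarrow> F0 x) A"
proof (rule tendstoI)
  fix e :: real assume e: "0 < e"
  define d where "d = e / (norm x + 1)"
  have d: "d > 0" "d * norm x < e"
    using e by (auto simp: d_def field_simps add_pos_nonneg)
  show "\<forall>\<^sub>F w in A. dist (F w x) (F0 x) < e"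
    using op_tendstoD[OF assms(1) d(1)]
  proof eventually_elim
    case (elim w)
    then have "norm (F w x - F0 x) \<le> d * norm x"
      using assms(2) by blast
    then show ?case
      using d(2) by (simp add: dist_norm)
  qed
qed

lemma op_tendsto_add:
  assumes "op_tendsto L F F0 A" "op_tendsto L G G0 A"
  shows "op_tendsto L (\<lambda>w x. F w x + G w x) (\<lambda>x. F0 x + G0 x) A"
  unfolding op_tendsto_def
proof (intro allI impI)
  fix e :: real assume "0 < e"
  then have e: "0 < e / 2"
    by simp
  show "\<forall>\<^sub>F w in A. \<forall>x\<in>L. norm (F w x + G w x - (F0 x + G0 x)) \<le> e * norm x"
    using op_tendstoD[OF assms(1) e] op_tendstoD[OF assms(2) e]
  proof eventually_elim
    case (elim w)
    show ?case
    proof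
      fix x assume x: "x \<in> L"
      have "norm (F w x + G w x - (F0 x + G0 x)) \<le> norm (F w x - F0 x) + norm (G w x - G0 x)"
        by (rule norm_diff_triangle_ineq)
      also have "\<dots> \<le> e / 2 * norm x + e / 2 * norm x"
        using elim x by (intro add_mono) auto
      finally show "norm (F w x + G w x - (F0 x + G0 x)) \<le> e * norm x"
        by simp
    qed
  qed
qed

lemma op_tendsto_scaleC:
  assumes F: "op_tendsto L F F0 A" and c: "(c \<longlongrightarrow> c0) A"
    and K: "\<And>x. x \<in> L \<Longrightarrow> norm (F0 x) \<le> K * norm x"
  shows "op_tendsto L (\<lambda>w x. c w *\<^sub>C F w x) (\<lambda>x. c0 *\<^sub>C F0 x) A"
  unfolding op_tendsto_def
proof (intro allI impI)
  fix e :: real assume e: "0 < e"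
  define d where "d = e / 2 / (norm c0 + 1)"
  have p: "norm c0 + 1 > 0"
    by (simp add: add_nonneg_pos)
  then have d: "d > 0" "(norm c0 + 1) * d = e / 2"
    unfolding d_def using e by (simp_all del: divide_divide_eq_left)
  have "((\<lambda>w. norm (c w)) \<longlongrightarrow> norm c0) A"
    by (intro tendsto_intros c)
  then have ev1: "\<forall>\<^sub>F w in A. norm (c w) < norm c0 + 1"
    by (rule order_tendstoD) simp
  have "((\<lambda>w. norm (c w - c0) * K) \<longlongrightarrow> norm (c0 - c0) * K) A"
    by (intro tendsto_intros c)
  then have ev2: "\<forall>\<^sub>F w in A. norm (c w - c0) * K < e / 2"
    by (rule order_tendstoD) (use e in simp)
  show "\<forall>\<^sub>F w in A. \<forall>x\<in>L. norm (c w *\<^sub>C F w x - c0 *\<^sub>C F0 x) \<le> e * norm x"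
    using op_tendstoD[OF F d(1)] ev1 ev2
  proof eventually_elim
    case (elim w)
    show ?case
    proof
      fix x assume x: "x \<in> L"
      have "c w *\<^sub>C F w x - c0 *\<^sub>C F0 x = c w *\<^sub>C (F w x - F0 x) + (c w - c0) *\<^sub>C F0 x"
        by (simp add: complex_vector.scale_right_diff_distrib complex_vector.scale_left_diff_distrib)
      then have "norm (c w *\<^sub>C F w x - c0 *\<^sub>C F0 x)
          \<le> norm (c w) * norm (F w x - F0 x) + norm (c w - c0) * norm (F0 x)"
        by (metis norm_scaleC norm_triangle_ineq)
      also have "\<dots> \<le> (norm c0 + 1) * (d * norm x) + norm (c w - c0) * (K * norm x)"
        using elim x K by (intro add_mono mult_mono) auto
      also have "\<dots> = e / 2 * norm x + (norm (c w - c0) * K) * norm x"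
        by (simp flip: d(2))
      also have "\<dots> \<le> e / 2 * norm x + e / 2 * norm x"
        using elim by (intro add_left_mono mult_right_mono) auto
      finally show "norm (c w *\<^sub>C F w x - c0 *\<^sub>C F0 x) \<le> e * norm x"
        by simp
    qed
  qed
qed

lemma op_tendsto_const: "op_tendsto L (\<lambda>w. F) F A"
  by (simp add: op_tendsto_def)

lemma op_tendsto_scale_id:
  "(c \<longlongrightarrow> c0) A \<Longrightarrow> op_tendsto L (\<lambda>w x. c w *\<^sub>C x) (\<lambda>x. c0 *\<^sub>C x) A"
  by (rule op_tendsto_scaleC[OF op_tendsto_const, where K = 1]) auto

lemma op_tendsto_diff:
  fixes G :: "complex \<Rightarrow> 'a::complex_inner \<Rightarrow> 'b::complex_inner"
  assumes F: "op_tendsto L F F0 A" and G: "op_tendsto L G G0 A"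
  shows "op_tendsto L (\<lambda>w x. F w x - G w x) (\<lambda>x. F0 x - G0 x) A"
proof -
  have "op_tendsto L (\<lambda>w x. - G w x) (\<lambda>x. - G0 x) A"
    using G unfolding op_tendsto_def by (simp add: norm_minus_commute)
  from op_tendsto_add[OF F this] show ?thesis
    by simp
qed

text \<open>Stability of inversion: \<open>S - S\<^sub>0 = S (F\<^sub>0 - F) S\<^sub>0\<close> for the inverses \<open>S\<close> and \<open>S\<^sub>0\<close> of \<open>F\<close>
  and \<open>F\<^sub>0\<close>.\<close>

lemma op_tendsto_inverse:
  fixes F :: "complex \<Rightarrow> 'a::complex_inner \<Rightarrow> 'a"
  assumes F: "op_tendsto UNIV F F0 A"
    and S: "\<forall>\<^sub>F w in A. clinear_on UNIV (S w) \<and> (\<forall>x. S w (F w x) = x \<and> norm (S w x) \<le> K * norm x)"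
    and S0: "\<And>x. F0 (S0 x) = x" "\<And>x. norm (S0 x) \<le> K * norm x"
  shows "op_tendsto UNIV S S0 A"
  unfolding op_tendsto_def
proof (intro allI impI)
  fix e :: real assume e: "0 < e"
  define d where "d = e / ((\<bar>K\<bar> + 1) * (\<bar>K\<bar> + 1))"
  have "(\<bar>K\<bar> + 1) * (\<bar>K\<bar> + 1) > 0"
    by (intro mult_pos_pos) auto
  then have d: "0 < d" "(\<bar>K\<bar> + 1) * (d * (\<bar>K\<bar> + 1)) = e"
    using e by (auto simp: d_def)
  have K: "K * norm x \<le> (\<bar>K\<bar> + 1) * norm x" for x :: 'a
    by (intro mult_right_mono) auto
  show "\<forall>\<^sub>F w in A. \<forall>x\<in>UNIV. norm (S w x - S0 x) \<le> e * norm x"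
    using op_tendstoD[OF F d(1)] S
  proof eventually_elim
    case (elim w)
    then have lin: "clinear_on UNIV (S w)" and SF: "\<And>x. S w (F w x) = x"
      and nS: "\<And>x. norm (S w x) \<le> K * norm x"
      by auto
    show ?case
    proof
      fix x
      have "S w x - S0 x = S w (F0 (S0 x) - F w (S0 x))"
        by (simp add: clinear_on_diff[OF lin] SF S0(1))
      then have "norm (S w x - S0 x) \<le> K * norm (F0 (S0 x) - F w (S0 x))"
        using nS by simp
      also have "\<dots> \<le> (\<bar>K\<bar> + 1) * norm (F0 (S0 x) - F w (S0 x))"
        by (rule K)
      also have "\<dots> \<le> (\<bar>K\<bar> + 1) * (d * norm (S0 x))"
        using elim(1) by (intro mult_left_mono) (auto simp: norm_minus_commute)
      also have "\<dots> \<le> (\<bar>K\<bar> + 1) * (d * ((\<bar>K\<bar> + 1) * norm x))"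
        using order_trans[OF S0(2) K] d(1) by (intro mult_left_mono) auto
      also have "\<dots> = (\<bar>K\<bar> + 1) * (d * (\<bar>K\<bar> + 1)) * norm x"
        by (simp only: mult.assoc)
      finally show "norm (S w x - S0 x) \<le> e * norm x"
        by (simp only: d(2))
    qed
  qed
qed

lemma op_analytic_on_imp_op_tendsto:
  assumes F: "op_analytic_on L S F" and L: "csubspace L" and S: "open S" and z: "z \<in> S"
  shows "op_tendsto L F (F z) (at z)"
  unfolding op_tendsto_def
proof (intro allI impI)
  fix e :: real assume e: "0 < e"
  have lin: "clinear_on L (F w)" if "w \<in> S" for w
    using F that by (auto simp: op_analytic_on_def bounded_clinear_on_def)
  have "\<forall>\<^sub>F w in at z. w \<in> S"
    using eventually_nhds_in_open[OF S z] by (auto simp: eventually_at_filter elim: eventually_mono)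
  then have "\<forall>\<^sub>F w in at z. clinear_on L (F w)"
    by (rule eventually_mono) (rule lin)
  then show "\<forall>\<^sub>F w in at z. \<forall>x\<in>L. norm (F w x - F z x) \<le> e * norm x"
    by (rule uniform_limit_opD[OF op_analytic_on_imp_uniform_limit[OF F z] L _ lin[OF z] e])
qed

section \<open>Operators with real part one half\<close>

lemma bij_one_minus_contraction:
  fixes T :: "'a::complex_hilbert \<Rightarrow> 'a"
  assumes lin: "clinear_on UNIV T" and T: "\<And>x. norm (T x) \<le> norm x" and w: "norm w < 1"
  shows "bij (\<lambda>x. x - w *\<^sub>C T x)"
proof (rule bij_bounded_below)
  have le: "norm (w *\<^sub>C T x) \<le> norm w * norm x" for x
    using T[of x] by (simp add: norm_scaleC mult_left_mono)
  show "clinear_on UNIV (\<lambda>x. x - w *\<^sub>C T x)"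
    by (rule clinear_on_one_minus[OF lin])
  show "norm (x - w *\<^sub>C T x) \<le> (1 + norm w) * norm x" for x
    by (rule norm_one_minus_le[OF T])
  show "0 < 1 - norm w"
    using w by simp
  show "(1 - norm w) * norm x \<le> norm (x - w *\<^sub>C T x)" for x
    using norm_triangle_ineq2[of x "w *\<^sub>C T x"] le[of x] by (simp add: left_diff_distrib)
  fix y assume "\<And>x. cinner (x - w *\<^sub>C T x) y = 0"
  from this[of y] have "cinner y y = cinner (w *\<^sub>C T y) y"
    by (simp add: cinner_diff_left)
  then have "(norm y)\<^sup>2 = norm (cinner (w *\<^sub>C T y) y)"
    using cinner_self[of y] by (metis norm_of_real abs_power2 abs_norm_cancel power_abs)
  also have "\<dots> \<le> norm w * norm y * norm y"
    by (rule order_trans[OF norm_cinner_le mult_right_mono[OF le]]) simp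
  finally have "(1 - norm w) * (norm y)\<^sup>2 \<le> 0"
    by (simp add: power2_eq_square algebra_simps)
  then show "y = 0"
    using w by (simp add: mult_le_0_iff)
qed

text \<open>The equation \<open>G + G\<^sup>* = E\<close> says that \<open>G\<close> has real part \<open>1/2\<close>. Such a \<open>G\<close> is invertible, and
  \<open>E - G\<^sup>-\<^sup>1\<close> is its Cayley transform, a unitary operator.\<close>

locale half_real_part =
  fixes G :: "'a::complex_hilbert \<Rightarrow> 'a" and K :: real
  assumes linG: "clinear_on UNIV G" and bdG: "\<And>x. norm (G x) \<le> K * norm x"
    and half: "\<And>x y. cinner (G x) y + cinner x (G y) = cinner x y"
begin

lemma Re_half: "Re (cinner (G x) x) = (norm x)\<^sup>2 / 2"
proof -
  have "Re (cinner x (G x)) = Re (cinner (G x) x)"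
    using cinner_commute[of x "G x"] by simp
  then show ?thesis
    using arg_cong[OF half[of x x], of Re] by (simp add: cinner_self)
qed

lemma norm_ge: "1/2 * norm x \<le> norm (G x)"
proof (cases "x = 0")
  case False
  have "(norm x)\<^sup>2 / 2 \<le> norm (G x) * norm x"
    using complex_Re_le_cmod[of "cinner (G x) x"] norm_cinner_le[of "G x" x] by (simp add: Re_half)
  then show ?thesis
    using False by (simp add: power2_eq_square)
qed simp

lemma bijG: "bij G"
proof (rule bij_bounded_below[OF linG bdG])
  show "0 < (1/2::real)"
    by simp
  show "1/2 * norm x \<le> norm (G x)" for x
    by (rule norm_ge)
  show "y = 0" if "\<And>x. cinner (G x) y = 0" for y
    using Re_half[of y] that[of y] by simp
qed

lemma inv_right: "G (inv G x) = x" and inv_left: "inv G (G x) = x"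
  using bijG by (simp_all add: bij_is_surj surj_f_inv_f bij_is_inj)

lemma norm_inv_le: "norm (inv G x) \<le> 2 * norm x"
  using norm_ge[of "inv G x"] by (simp add: inv_right)

lemma lin_inv: "clinear_on UNIV (inv G)"
  by (rule clinear_on_inv[OF linG bijG])

lemma bij_inv: "bij (inv G)"
  by (rule bij_imp_bij_inv[OF bijG])

lemma cayley_isometry: "cinner (x - inv G x) (x - inv G x) = cinner x x"
proof -
  have "cinner x (inv G x) + cinner (inv G x) x = cinner (inv G x) (inv G x)"
    using half[of "inv G x" "inv G x"] by (simp add: inv_right)
  then show ?thesis
    by (simp add: cinner_diff_left cinner_diff_right algebra_simps)
qed

lemma cayley_surj: "surj (\<lambda>x. x - inv G x)"
proof -
  \<comment> \<open>up to sign the range is that of \<open>E - G = G\<^sup>*\<close>, which again has real part \<open>1/2\<close>\<close>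
  have "bij (\<lambda>x. x - G x)"
  proof (rule half_real_part.bijG[of _ "1 + K"], unfold_locales)
    have "clinear_on UNIV (\<lambda>x. x - 1 *\<^sub>C G x)"
      by (rule clinear_on_one_minus[OF linG])
    then show "clinear_on UNIV (\<lambda>x. x - G x)"
      by simp
    show "norm (x - G x) \<le> (1 + K) * norm x" for x
      using norm_triangle_ineq4[of x "G x"] bdG[of x] by (simp add: algebra_simps)
    show "cinner (x - G x) y + cinner x (y - G y) = cinner x y" for x y
      using half[of x y] by (simp add: cinner_diff_left cinner_diff_right algebra_simps)
  qed
  then have "\<exists>x. y = x - inv G x" for y
  proof -
    assume "bij (\<lambda>x. x - G x)"
    then obtain u where u: "- y = u - G u"
      by (metis bij_is_surj surjD)
    then have "y = G u - inv G (G u)"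
      unfolding inv_left by (metis minus_diff_eq minus_minus)
    then show ?thesis
      by blast
  qed
  then show ?thesis
    unfolding surj_def by blast
qed

end

text \<open>Conversely, resolvents of isometries at boundary points have real part \<open>1/2\<close>. Everywhere
  defined operators with this property are bounded by the Hellinger--Toeplitz theorem.\<close>

lemma half_real_part_inv_one_minus:
  fixes T :: "'a::complex_hilbert \<Rightarrow> 'a"
  assumes T: "isometry_on UNIV T" and w: "norm w = 1" and bij: "bij (\<lambda>x. x - w *\<^sub>C T x)"
  obtains K where "half_real_part (inv (\<lambda>x. x - w *\<^sub>C T x)) K"
proof -
  let ?B = "\<lambda>x. x - w *\<^sub>C T x"
  define G where "G = inv ?B"
  have BG: "G x - w *\<^sub>C T (G x) = x" for x
    using surj_f_inv_f[OF bij_is_surj[OF bij], of x] by (simp add: G_def)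
  have lin: "clinear_on UNIV G"
    unfolding G_def by (rule clinear_on_inv[OF clinear_on_one_minus[OF isometry_on_clinear[OF T]] bij])
  have ww: "w * (cnj w * c) = c" "cnj w * (w * c) = c" for c
  proof -
    have "w * cnj w = 1" "cnj w * w = 1"
      using complex_norm_square[of w] w by (simp_all add: mult.commute)
    then show "w * (cnj w * c) = c" "cnj w * (w * c) = c"
      by (simp_all flip: mult.assoc)
  qed
  have half: "cinner (G x) y + cinner x (G y) = cinner x y" for x y
  proof -
    define u v where "u = G x" and "v = G y"
    have xy: "x = u - w *\<^sub>C T u" "y = v - w *\<^sub>C T v"
      by (simp_all only: u_def v_def BG)
    have "cinner u y + cinner x v = cinner x y"
      unfolding xy using isometry_on_cinner[OF T, of u v]
      by (simp add: cinner_diff_left cinner_diff_right cinner_scaleC_left cinner_scaleC_right right_diff_distrib ww)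
    then show ?thesis
      by (simp add: u_def v_def)
  qed
  have "cinner (G x) y = cinner x (y - G y)" for x y
    using half[of x y] by (simp add: cinner_diff_right algebra_simps)
  then obtain K where "\<forall>x. norm (G x) \<le> K * norm x"
    using Hellinger_Toeplitz[of G "\<lambda>y. y - G y"] by blast
  then have "half_real_part G K"
    using lin half by unfold_locales auto
  then show ?thesis
    using that unfolding G_def by blast
qed

section \<open>The Moebius parameter\<close>

text \<open>If \<open>R = (E - \<zeta> B)\<^sup>-\<^sup>1\<close> and \<open>B = (T + cnj z\<^sub>0 E) (E + z\<^sub>0 T)\<^sup>-\<^sup>1\<close>, then
  \<open>(E - mob \<zeta> T)\<^sup>-\<^sup>1 = alpha \<zeta> R + beta \<zeta> E\<close>.\<close>

definition mob :: "complex \<Rightarrow> complex \<Rightarrow> complex"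
  where "mob z0 \<zeta> = (\<zeta> - z0) / (1 - cnj z0 * \<zeta>)"

definition alpha :: "complex \<Rightarrow> complex \<Rightarrow> complex"
  where "alpha z0 \<zeta> = (\<zeta> - z0) * (1 - cnj z0 * \<zeta>) / (\<zeta> * (1 - z0 * cnj z0))"

definition beta :: "complex \<Rightarrow> complex \<Rightarrow> complex"
  where "beta z0 \<zeta> = z0 * (1 - cnj z0 * \<zeta>) / (\<zeta> * (1 - z0 * cnj z0))"

context
  fixes z0 :: complex
  assumes z0: "norm z0 < 1"
begin

lemma denom_nz:
  assumes "norm \<zeta> \<le> 1"
  shows "1 - cnj z0 * \<zeta> \<noteq> 0"
proof
  assume "1 - cnj z0 * \<zeta> = 0"
  then have "norm (cnj z0 * \<zeta>) = 1"
    by simp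
  moreover have "norm (cnj z0 * \<zeta>) \<le> norm z0 * 1"
    unfolding norm_mult using assms by (intro mult_mono) auto
  ultimately show False
    using z0 by simp
qed

lemma one_minus_z0_nz: "1 - z0 * cnj z0 \<noteq> 0"
  using denom_nz[of z0] z0 by (simp add: mult.commute)

lemma moebius_identity:
  "(norm (1 - cnj z0 * \<zeta>))\<^sup>2 - (norm (\<zeta> - z0))\<^sup>2 = (1 - (norm z0)\<^sup>2) * (1 - (norm \<zeta>)\<^sup>2)"
  unfolding cmod_power2 by (simp add: algebra_simps power2_eq_square)

lemma norm_mob_less:
  assumes "norm \<zeta> < 1"
  shows "norm (mob z0 \<zeta>) < 1"
proof -
  have "0 < (1 - (norm z0)\<^sup>2) * (1 - (norm \<zeta>)\<^sup>2)"
    using z0 assms by (simp add: power_less_one_iff)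
  then have "(norm (\<zeta> - z0))\<^sup>2 < (norm (1 - cnj z0 * \<zeta>))\<^sup>2"
    using moebius_identity[of \<zeta>] by simp
  then have "norm (\<zeta> - z0) < norm (1 - cnj z0 * \<zeta>)"
    by (simp add: power_less_imp_less_base)
  then show ?thesis
    using denom_nz[of \<zeta>] assms by (simp add: mob_def norm_divide)
qed

lemma norm_mob_eq:
  assumes "norm \<zeta> = 1"
  shows "norm (mob z0 \<zeta>) = 1"
proof -
  have "norm (\<zeta> - z0) = norm (1 - cnj z0 * \<zeta>)"
    using moebius_identity[of \<zeta>] assms by (simp add: power2_eq_iff_nonneg)
  then show ?thesis
    using denom_nz[of \<zeta>] assms by (simp add: mob_def norm_divide)
qed

lemma cnj_mob:
  assumes "norm \<zeta> = 1"
  shows "cnj (mob z0 \<zeta>) = (1 - cnj z0 * \<zeta>) / (\<zeta> - z0)"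
proof -
  have "mob z0 \<zeta> * cnj (mob z0 \<zeta>) = 1"
    using complex_norm_square[of "mob z0 \<zeta>"] norm_mob_eq[OF assms] by simp
  then have "cnj (mob z0 \<zeta>) = 1 / mob z0 \<zeta>"
    by (metis mult.commute nonzero_eq_divide_eq zero_neq_one mult_zero_left)
  then show ?thesis
    by (simp add: mob_def)
qed

lemma mob_plus:
  assumes "norm \<zeta> \<le> 1"
  shows "mob z0 \<zeta> + z0 = \<zeta> * (1 - z0 * cnj z0) / (1 - cnj z0 * \<zeta>)"
    and "1 + mob z0 \<zeta> * cnj z0 = (1 - z0 * cnj z0) / (1 - cnj z0 * \<zeta>)"
  using denom_nz[OF assms] by (simp_all add: mob_def field_simps)

lemma mob_inverse:
  assumes "norm \<zeta> \<le> 1"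
  shows "(z0 + mob z0 \<zeta>) / (1 + mob z0 \<zeta> * cnj z0) = \<zeta>"
  using mob_plus[OF assms] denom_nz[OF assms] one_minus_z0_nz by (simp add: add.commute)

text \<open>On the circle \<open>alpha\<close> is real and \<open>alpha + 2 Re beta = 1\<close>. Hence passing from \<open>R\<close> to
  \<open>alpha R + beta E\<close> preserves the relation \<open>R + R\<^sup>* = E\<close>.\<close>

context
  fixes \<zeta> :: complex
  assumes \<zeta>: "norm \<zeta> = 1"
begin

lemma alpha_nz: "alpha z0 \<zeta> \<noteq> 0"
proof -
  have "\<zeta> \<noteq> 0" "\<zeta> \<noteq> z0"
    using \<zeta> z0 by auto
  then show ?thesis
    using denom_nz[of \<zeta>] one_minus_z0_nz \<zeta> by (simp add: alpha_def)
qed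

lemma one_over_circle: "(1 - cnj z0 * \<zeta>) / \<zeta> = cnj \<zeta> - cnj z0"
proof -
  have "\<zeta> * cnj \<zeta> = 1"
    using complex_norm_square[of \<zeta>] \<zeta> by simp
  moreover have "\<zeta> \<noteq> 0"
    using \<zeta> by auto
  ultimately show ?thesis
    by (simp add: field_simps)
qed

lemma alpha_circle: "alpha z0 \<zeta> = (\<zeta> - z0) * (cnj \<zeta> - cnj z0) / (1 - z0 * cnj z0)"
  and beta_circle: "beta z0 \<zeta> = z0 * (cnj \<zeta> - cnj z0) / (1 - z0 * cnj z0)"
  unfolding alpha_def beta_def one_over_circle[symmetric] by simp_all

lemma cnj_alpha: "cnj (alpha z0 \<zeta>) = alpha z0 \<zeta>"
  by (simp add: alpha_circle mult.commute)

lemma alpha_beta_sum: "alpha z0 \<zeta> + beta z0 \<zeta> + cnj (beta z0 \<zeta>) = 1"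
proof -
  have "\<zeta> * cnj \<zeta> = 1"
    using complex_norm_square[of \<zeta>] \<zeta> by simp
  moreover have "1 - cnj z0 * z0 \<noteq> 0"
    using one_minus_z0_nz by (simp add: mult.commute)
  ultimately show ?thesis
    using one_minus_z0_nz
    by (simp add: alpha_circle beta_circle mult.commute[of "cnj z0"] flip: add_divide_distrib)
       (simp add: algebra_simps)
qed

end

end

lemma tendsto_mob:
  assumes "norm z0 < 1" "norm \<zeta> \<le> 1"
  shows "(mob z0 \<longlongrightarrow> mob z0 \<zeta>) (at \<zeta> within S)"
  unfolding mob_def using denom_nz[OF assms] by (intro tendsto_intros) auto

lemma tendsto_alpha:
  assumes "norm z0 < 1" "\<zeta> \<noteq> 0"
  shows "(alpha z0 \<longlongrightarrow> alpha z0 \<zeta>) (at \<zeta> within S)"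
  unfolding alpha_def using one_minus_z0_nz[OF assms(1)] assms(2) by (intro tendsto_intros) auto

lemma tendsto_beta:
  assumes "norm z0 < 1" "\<zeta> \<noteq> 0"
  shows "(beta z0 \<longlongrightarrow> beta z0 \<zeta>) (at \<zeta> within S)"
  unfolding beta_def using one_minus_z0_nz[OF assms(1)] assms(2) by (intro tendsto_intros) auto

section \<open>The shifted isometry and Inin's formula\<close>

locale isometric_op =
  fixes D :: "'h::complex_hilbert set" and V :: "'h \<Rightarrow> 'h" and z0 :: complex
  assumes V: "closed_isometric_op D V" and z0: "norm z0 < 1"
begin

lemma subD: "csubspace D" and clD: "closed D" and isoV: "isometry_on D V"
  using V by (auto simp: closed_isometric_op_def)

lemma linV: "clinear_on D V"
  by (rule isometry_on_clinear[OF isoV])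

abbreviation "A \<equiv> V_shift D V z0"
abbreviation "S \<equiv> \<lambda>f. f - z0 *\<^sub>C V f"

lemma linS: "clinear_on D S"
  by (rule clinear_on_one_minus[OF linV])

lemma S_ge: "f \<in> D \<Longrightarrow> (1 - norm z0) * norm f \<le> norm (S f)"
  using norm_one_minus_ge[of V f z0] isometry_on_norm[OF isoV] z0 by simp

lemma injS: "inj_on S D"
proof (rule inj_onI)
  fix x y assume xy: "x \<in> D" "y \<in> D" "S x = S y"
  have "S (x - y) = 0"
    using clinear_on_diff[OF linS subD xy(1,2)] xy(3) by simp
  then have "(1 - norm z0) * norm (x - y) \<le> 0"
    using S_ge[OF complex_vector.subspace_diff[OF subD xy(1,2)]] by simp
  then show "x = y"
    using z0 by (simp add: mult_le_0_iff)
qed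

lemma A_S: "f \<in> D \<Longrightarrow> A (S f) = V f - cnj z0 *\<^sub>C f"
  unfolding V_shift_def Let_def by (simp add: inv_into_f_f[OF injS])

lemma M_eq: "M_space D V z0 = S ` D"
  by (simp add: M_space_def)

sublocale partial_isometry "M_space D V z0" A
proof
  show "csubspace (M_space D V z0)"
    unfolding M_eq by (rule csubspace_image[OF linS subD])
  show "closed (M_space D V z0)"
    unfolding M_eq
  proof (rule closed_image_bounded_below[OF linS subD clD _ _ S_ge])
    show "norm (S f) \<le> (1 + norm z0) * norm f" if "f \<in> D" for f
      by (rule norm_one_minus_le) (simp add: isometry_on_norm[OF isoV that])
  qed (use z0 in simp)
  show "isometry_on (M_space D V z0) A"
  proof (rule isometry_on_of_cinner)
    show "clinear_on (M_space D V z0) A"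
    proof (rule clinear_onI)
      fix x y assume "x \<in> M_space D V z0" "y \<in> M_space D V z0"
      then obtain f g where f: "f \<in> D" "x = S f" and g: "g \<in> D" "y = S g"
        by (auto simp: M_eq)
      have fg: "f + g \<in> D"
        using f g subD by (simp add: complex_vector.subspace_add)
      have "x + y = S (f + g)"
        using clinear_on_add[OF linS f(1) g(1)] f(2) g(2) by simp
      then have "A (x + y) = V (f + g) - cnj z0 *\<^sub>C (f + g)"
        using A_S[OF fg] by simp
      also have "\<dots> = A x + A y"
        unfolding f(2) g(2) A_S[OF f(1)] A_S[OF g(1)]
        by (simp add: clinear_on_add[OF linV f(1) g(1)] complex_vector.scale_right_distrib)
      finally show "A (x + y) = A x + A y" .
    next
      fix c x assume "x \<in> M_space D V z0"
      then obtain f where f: "f \<in> D" "x = S f"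
        by (auto simp: M_eq)
      have cf: "c *\<^sub>C f \<in> D"
        using f subD by (simp add: complex_vector.subspace_scale)
      have "c *\<^sub>C x = S (c *\<^sub>C f)"
        using clinear_on_scale[OF linS f(1)] f(2) by simp
      then have "A (c *\<^sub>C x) = V (c *\<^sub>C f) - cnj z0 *\<^sub>C c *\<^sub>C f"
        using A_S[OF cf] by simp
      also have "\<dots> = c *\<^sub>C A x"
        unfolding f(2) A_S[OF f(1)] by (simp add: clinear_on_scale[OF linV f(1)]
            complex_vector.scale_right_diff_distrib mult.commute)
      finally show "A (c *\<^sub>C x) = c *\<^sub>C A x" .
    qed
    fix x assume "x \<in> M_space D V z0"
    then obtain f where f: "f \<in> D" "x = S f"
      by (auto simp: M_eq)
    have "cinner (V f) (V f) = cinner f f"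
      by (rule isometry_on_cinner[OF isoV subD f(1) f(1)])
    then show "cinner (A x) (A x) = cinner x x"
      unfolding f(2) A_S[OF f(1)]
      by (simp add: cinner_diff_left cinner_diff_right cinner_scaleC_left cinner_scaleC_right
          right_diff_distrib)
  qed
qed

lemma scale_image_subspace:
  assumes "csubspace L" "c \<noteq> 0"
  shows "(\<lambda>x. c *\<^sub>C x) ` L = (L :: 'h set)"
proof (intro equalityI subsetI)
  fix x assume x: "x \<in> L"
  have "x = c *\<^sub>C (inverse c *\<^sub>C x)"
    using assms(2) by (simp add: scaleC_scaleC)
  then show "x \<in> (\<lambda>x. c *\<^sub>C x) ` L"
    using complex_vector.subspace_scale[OF assms(1) x] by blast
qed (use complex_vector.subspace_scale[OF assms(1)] in auto)

text \<open>$A$ sends $(E - z_0 V)f$ to $(V - \bar z_0 E)f = -\bar z_0 (E - \bar z_0^{-1} V)f$.\<close>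

lemma A_image: "A ` M_space D V z0 = M_refl D V z0"
proof -
  have im: "A ` M_space D V z0 = (\<lambda>f. V f - cnj z0 *\<^sub>C f) ` D"
    unfolding M_eq image_image using A_S by (rule image_cong[OF refl])
  show ?thesis
  proof (cases "z0 = 0")
    case True
    then show ?thesis
      using im by (simp add: M_refl_def)
  next
    case False
    have sub: "csubspace (M_space D V (1 / cnj z0))"
      unfolding M_space_def
      by (rule csubspace_image[OF clinear_on_one_minus[OF linV] subD])
    have "V f - cnj z0 *\<^sub>C f = (- cnj z0) *\<^sub>C (f - (1 / cnj z0) *\<^sub>C V f)" for f
      using False by (simp add: complex_vector.scale_right_diff_distrib scaleC_scaleC)
    then have "(\<lambda>f. V f - cnj z0 *\<^sub>C f) ` D = (\<lambda>x. (- cnj z0) *\<^sub>C x) ` M_space D V (1 / cnj z0)"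
      by (simp only: M_space_def image_image)
    also have "\<dots> = M_space D V (1 / cnj z0)"
      by (rule scale_image_subspace[OF sub]) (use False in simp)
    finally show ?thesis
      using False by (simp add: im M_refl_def)
  qed
qed

lemma N_space_eq: "N_space D V z0 = orth_compl (M_space D V z0)"
  by (simp add: N_space_def)

lemma N_refl_eq: "N_refl D V z0 = orth_compl (A ` M_space D V z0)"
  by (simp add: N_refl_def A_image)

lemma V_plus_eq: "V_plus D V z0 C = ext C"
  by (rule HOL.ext) (simp add: V_plus_def ext_def N_space_def)

text \<open>In terms of \<open>A\<close> the pencil \<open>E - \<mu> V\<close> becomes \<open>E - mob \<mu> A\<close> up to a scalar factor; therefore
  $M_\mu = (E - \mathit{mob}(\mu) A) M_{z_0}$, and eigenvectors of \<open>A\<close> correspond to eigenvectors of \<open>V\<close>.\<close>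

lemma one_minus_mob_A:
  assumes "norm \<mu> \<le> 1" "f \<in> D"
  shows "S f - mob z0 \<mu> *\<^sub>C A (S f)
    = ((1 - z0 * cnj z0) / (1 - cnj z0 * \<mu>)) *\<^sub>C (f - \<mu> *\<^sub>C V f)"
proof -
  have "S f - mob z0 \<mu> *\<^sub>C A (S f)
      = (1 + mob z0 \<mu> * cnj z0) *\<^sub>C f - (mob z0 \<mu> + z0) *\<^sub>C V f"
    unfolding A_S[OF assms(2)]
    by (simp add: complex_vector.scale_right_diff_distrib complex_vector.scale_left_distrib
        scaleC_scaleC algebra_simps)
  also have "\<dots> = ((1 - z0 * cnj z0) / (1 - cnj z0 * \<mu>)) *\<^sub>C (f - \<mu> *\<^sub>C V f)"
    unfolding mob_plus[OF z0 assms(1)]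
    by (simp add: complex_vector.scale_right_diff_distrib scaleC_scaleC mult.commute)
  finally show ?thesis .
qed

lemma factor_nz: "norm \<mu> \<le> 1 \<Longrightarrow> (1 - z0 * cnj z0) / (1 - cnj z0 * \<mu>) \<noteq> 0"
  using denom_nz[OF z0] one_minus_z0_nz[OF z0] by simp

lemma M_space_boundary:
  assumes "norm \<mu> \<le> 1"
  shows "(\<lambda>g. g - mob z0 \<mu> *\<^sub>C A g) ` M_space D V z0 = M_space D V \<mu>"
proof -
  have sub: "csubspace (M_space D V \<mu>)"
    unfolding M_space_def by (rule csubspace_image[OF clinear_on_one_minus[OF linV] subD])
  have "(\<lambda>g. g - mob z0 \<mu> *\<^sub>C A g) ` M_space D V z0
      = (\<lambda>x. ((1 - z0 * cnj z0) / (1 - cnj z0 * \<mu>)) *\<^sub>C x) ` M_space D V \<mu>"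
    unfolding M_space_def[of D V \<mu>] M_eq image_image
    using one_minus_mob_A[OF assms] by (rule image_cong[OF refl])
  also have "\<dots> = M_space D V \<mu>"
    by (rule scale_image_subspace[OF sub factor_nz[OF assms]])
  finally show ?thesis .
qed

lemma no_eigenvector:
  assumes \<mu>: "norm \<mu> = 1" and reg: "regular_type_point D V (inverse \<mu>)"
    and g: "g \<in> M_space D V z0" "A g = cnj (mob z0 \<mu>) *\<^sub>C g"
  shows "g = 0"
proof -
  obtain f where f: "f \<in> D" "g = S f"
    using g(1) by (auto simp: M_eq)
  have "mob z0 \<mu> * cnj (mob z0 \<mu>) = 1"
    using complex_norm_square[of "mob z0 \<mu>"] norm_mob_eq[OF z0 \<mu>] by simp
  then have "S f - mob z0 \<mu> *\<^sub>C A (S f) = 0"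
    using g(2) by (simp add: f(2) scaleC_scaleC)
  then have "((1 - z0 * cnj z0) / (1 - cnj z0 * \<mu>)) *\<^sub>C (f - \<mu> *\<^sub>C V f) = 0"
    using one_minus_mob_A[OF _ f(1)] \<mu> by simp
  then have "f - \<mu> *\<^sub>C V f = 0"
    using factor_nz[of \<mu>] \<mu> unfolding complex_vector.scale_eq_0_iff by simp
  then have "inverse \<mu> *\<^sub>C f = inverse \<mu> *\<^sub>C \<mu> *\<^sub>C V f"
    by simp
  also have "\<dots> = V f"
  proof -
    have "inverse \<mu> * \<mu> = 1"
      using \<mu> by (intro left_inverse) auto
    then show ?thesis
      by (simp only: scaleC_scaleC complex_vector.scale_one)
  qed
  finally have "V f - inverse \<mu> *\<^sub>C f = V 0 - inverse \<mu> *\<^sub>C 0"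
    using clinear_on_zero[OF linV subD] by simp
  moreover have "0 \<in> D"
    using subD by (simp add: complex_vector.subspace_0)
  moreover have "inj_on (\<lambda>f. V f - inverse \<mu> *\<^sub>C f) D"
    using reg by (simp add: regular_type_point_def Let_def)
  ultimately have "f = 0"
    using f(1) by (blast dest: inj_onD)
  then show ?thesis
    using f(2) clinear_on_zero[OF linS subD] by simp
qed

text \<open>The change of variable \<open>x = f + z\<^sub>0 T f\<close> with \<open>T = V_plus D V z0 C\<close> turns \<open>E - \<zeta> V_ext\<close> into a
  multiple of \<open>E - mob \<zeta> T\<close>.\<close>

lemma inv_V_ext:
  assumes C: "contraction_on (orth_compl (M_space D V z0)) C"
      "C ` orth_compl (M_space D V z0) \<subseteq> orth_compl (A ` M_space D V z0)"
    and \<zeta>: "norm \<zeta> < 1"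
  shows "inv (\<lambda>x. x - \<zeta> *\<^sub>C V_ext D V z0 C x)
      ((1 - cnj z0 * \<zeta>) *\<^sub>C (f - mob z0 \<zeta> *\<^sub>C ext C f)) = f + z0 *\<^sub>C ext C f"
proof -
  define T where "T = ext C"
  define B where "B f = f + z0 *\<^sub>C T f" for f
  define L where "L x = x - \<zeta> *\<^sub>C V_ext D V z0 C x" for x
  have linT: "clinear_on UNIV T"
    unfolding T_def using C(1) by (intro ext_clinear) (simp add: contraction_on_def)
  have nT: "norm (T x) \<le> norm x" for x
    unfolding T_def by (rule norm_ext_le[OF C])
  have "bij (\<lambda>x. x - (- z0) *\<^sub>C T x)"
    by (rule bij_one_minus_contraction[OF linT nT]) (use z0 in simp)
  then have B: "bij B"
    by (simp add: B_def[abs_def])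
  have wbij: "bij (\<lambda>x. x - mob z0 \<zeta> *\<^sub>C T x)"
    by (rule bij_one_minus_contraction[OF linT nT norm_mob_less[OF z0 \<zeta>]])
  have d: "1 - cnj z0 * \<zeta> \<noteq> 0"
    using denom_nz[OF z0] \<zeta> by simp
  have LB: "L (B f) = (1 - cnj z0 * \<zeta>) *\<^sub>C (f - mob z0 \<zeta> *\<^sub>C T f)" for f
  proof -
    have "inv B (B f) = f"
      using B by (simp add: bij_is_inj)
    then have "V_ext D V z0 C (B f) = T f + cnj z0 *\<^sub>C f"
      unfolding V_ext_def V_plus_eq T_def[symmetric] B_def[abs_def, symmetric] Let_def by simp
    then have "L (B f) = f + z0 *\<^sub>C T f - (\<zeta> *\<^sub>C T f + (cnj z0 * \<zeta>) *\<^sub>C f)"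
      by (simp add: L_def B_def scaleC_add_right scaleC_scaleC mult.commute[of \<zeta>])
    also have "\<dots> = (1 - cnj z0 * \<zeta>) *\<^sub>C f - (\<zeta> - z0) *\<^sub>C T f"
      by (simp add: complex_vector.scale_left_diff_distrib)
    also have "\<zeta> - z0 = (1 - cnj z0 * \<zeta>) * mob z0 \<zeta>"
      using d by (simp add: mob_def)
    finally show ?thesis
      by (simp add: complex_vector.scale_right_diff_distrib scaleC_scaleC)
  qed
  have "inj L"
  proof (rule injI)
    fix x y assume xy: "L x = L y"
    obtain f g where fg: "x = B f" "y = B g"
      using B by (metis bij_is_surj surjD)
    then have "f - mob z0 \<zeta> *\<^sub>C T f = g - mob z0 \<zeta> *\<^sub>C T g"
      using xy d by (simp add: LB complex_vector.scale_cancel_left)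
    then have "f = g"
      by (rule injD[OF bij_is_inj[OF wbij]])
    then show "x = y"
      using fg by simp
  qed
  then have "inv L (L (B f)) = B f"
    by simp
  then show ?thesis
    unfolding LB unfolding L_def[abs_def] B_def T_def .
qed

end

section \<open>The boundary operator\<close>

context isometric_op
begin

lemma W_op_eq:
  assumes \<mu>: "norm \<mu> = 1" and f: "f \<in> N_space D V \<mu>"
  shows "W_op D V \<mu> z0 (Q f) = cnj (mob z0 \<mu>) *\<^sub>C Q' f"
proof -
  interpret boundary_point "M_space D V z0" A "mob z0 \<mu>"
    by unfold_locales (rule norm_mob_eq[OF z0 \<mu>])
  have N\<mu>: "N_space D V \<mu> = defect"
    using M_space_boundary[of \<mu>] \<mu> by (simp add: N_space_def defect_def)
  show ?thesis
    unfolding W_op_def N_space_eq N_refl_eq N\<mu> cnj_mob[OF z0 \<mu>]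
  proof (rule the_equality)
    show "\<exists>f'\<in>defect. Q f = Q f' \<and>
        ((1 - cnj z0 * \<mu>) / (\<mu> - z0)) *\<^sub>C Q' f = ((1 - cnj z0 * \<mu>) / (\<mu> - z0)) *\<^sub>C Q' f'"
      using f N\<mu> by blast
    fix k assume "\<exists>f'\<in>defect. Q f = Q f' \<and> k = ((1 - cnj z0 * \<mu>) / (\<mu> - z0)) *\<^sub>C Q' f'"
    then show "k = ((1 - cnj z0 * \<mu>) / (\<mu> - z0)) *\<^sub>C Q' f"
      using defect_unique[of f] f N\<mu> by metis
  qed
qed

lemma bij_iff_W_op:
  assumes \<mu>: "norm \<mu> = 1" and reg: "regular_type_point D V (inverse \<mu>)"
    and proj: "orth_proj (M_refl D V z0) ` M_space D V \<mu> = M_refl D V z0"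
    and C: "isometry_on N C" "C ` N = N'"
  shows "bij (\<lambda>x. x - mob z0 \<mu> *\<^sub>C ext C x) \<longleftrightarrow>
    inj_on (\<lambda>x. C x - W_op D V \<mu> z0 x) N \<and> (\<lambda>x. C x - W_op D V \<mu> z0 x) ` N = N'"
proof -
  interpret boundary_point "M_space D V z0" A "mob z0 \<mu>"
    by unfold_locales (rule norm_mob_eq[OF z0 \<mu>])
  note M\<mu> = M_space_boundary[of \<mu>, OF eq_refl[OF \<mu>]]
  show ?thesis
  proof (rule bij_one_minus_ext_iff[OF C])
    show "W_op D V \<mu> z0 (Q f) = cnj (mob z0 \<mu>) *\<^sub>C Q' f" if "f \<in> defect" for f
      using that by (intro W_op_eq[OF \<mu>]) (simp add: N_space_def defect_def M\<mu>)
    show "g = 0" if "g \<in> M_space D V z0" "A g = cnj (mob z0 \<mu>) *\<^sub>C g" for g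
      by (rule no_eigenvector[OF \<mu> reg that])
    show "P' ` (\<lambda>g. g - mob z0 \<mu> *\<^sub>C A g) ` M_space D V z0 = M'"
      using proj by (simp add: M\<mu> A_image)
  qed
qed

end

section \<open>Boundary values of the resolvent and of the parameter\<close>

text \<open>Of the unitary extension behind a generalized resolvent only the following properties of \<open>R\<close>
  enter; they no longer refer to the larger Hilbert space.\<close>

locale inin_pair = isometric_op +
  fixes \<Delta> :: "complex set" and R C :: "complex \<Rightarrow> 'a \<Rightarrow> 'a"
  assumes open_domain: "open (ball 0 1 \<union> {z. 1 < norm z} \<union> \<Delta>)"
    and circle: "\<And>\<mu>. \<mu> \<in> \<Delta> \<Longrightarrow> norm \<mu> = 1"
    and regular: "\<And>\<mu>. \<mu> \<in> \<Delta> \<Longrightarrow> regular_type_point D V (inverse \<mu>)"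
    and proj: "\<And>\<mu>. \<mu> \<in> \<Delta> \<Longrightarrow> orth_proj (M_refl D V z0) ` M_space D V \<mu> = M_refl D V z0"
    and R_linear: "\<And>\<zeta>. norm \<zeta> \<noteq> 1 \<Longrightarrow> clinear_on UNIV (R \<zeta>)"
    and R_norm: "\<And>\<zeta> x. norm \<zeta> \<noteq> 1 \<Longrightarrow> norm (R \<zeta> x) \<le> norm x / \<bar>1 - norm \<zeta>\<bar>"
    and R_holomorphic: "\<And>x y. (\<lambda>\<zeta>. cinner (R \<zeta> x) y) holomorphic_on {\<zeta>. norm \<zeta> \<noteq> 1}"
    and R_adjoint: "\<And>\<zeta> x y. norm \<zeta> \<noteq> 1 \<Longrightarrow> \<zeta> \<noteq> 0 \<Longrightarrow>
      cinner (R (1 / cnj \<zeta>) x) y + cinner x (R \<zeta> y) = cinner x y"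
    and schur: "C \<in> schur_class (N_space D V z0) (N_refl D V z0)"
    and Inin: "corresponds_Inin D V z0 C R"
begin

lemma C_analytic: "op_analytic_on N (ball 0 1) C"
  and C_contraction: "norm z < 1 \<Longrightarrow> contraction_on N (C z)"
  and C_range: "norm z < 1 \<Longrightarrow> C z ` N \<subseteq> N'"
  using schur by (auto simp: schur_class_def N_space_eq N_refl_eq)

lemma C_clinear: "norm z < 1 \<Longrightarrow> clinear_on N (C z)"
  using C_contraction by (simp add: contraction_on_def)

lemma bij_inner:
  assumes "norm z < 1"
  shows "bij (\<lambda>x. x - mob z0 z *\<^sub>C ext (C z) x)"
  using assms by (intro bij_one_minus_contraction ext_clinear C_clinear norm_ext_le C_contraction
      C_range norm_mob_less z0)

text \<open>Inin's formula in the Moebius parameter: \<open>alpha R + beta E\<close> is the two-sided inverse of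
  \<open>E - mob T\<close>.\<close>

lemma shifted_resolvent_left:
  assumes z: "norm z < 1" "z \<noteq> 0"
  defines "g \<equiv> \<lambda>f. f - mob z0 z *\<^sub>C ext (C z) f"
  shows "alpha z0 z *\<^sub>C R z (g f) + beta z0 z *\<^sub>C g f = f"
proof -
  define T where "T = ext (C z) f"
  define k where "k = 1 / (z * (1 - z0 * cnj z0))"
  have kz: "k * (z * (1 - z0 * cnj z0)) = 1"
    using z one_minus_z0_nz[OF z0] by (simp add: k_def)
  have d: "1 - cnj z0 * z \<noteq> 0"
    using denom_nz[OF z0] z by simp
  have "(1 - cnj z0 * z) *\<^sub>C R z (g f) = R z ((1 - cnj z0 * z) *\<^sub>C g f)"
    using clinear_on_scale[OF R_linear] z by simp
  also have "\<dots> = f + z0 *\<^sub>C T"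
    using Inin inv_V_ext[OF C_contraction C_range, of z z f] z
    by (simp add: corresponds_Inin_def g_def T_def)
  finally have R: "(1 - cnj z0 * z) *\<^sub>C R z (g f) = f + z0 *\<^sub>C T" .
  have "alpha z0 z *\<^sub>C R z (g f) = (k * (z - z0)) *\<^sub>C (1 - cnj z0 * z) *\<^sub>C R z (g f)"
    by (simp add: scaleC_scaleC alpha_def k_def)
  also have "\<dots> = (k * (z - z0)) *\<^sub>C f + (k * (z - z0) * z0) *\<^sub>C T"
    by (simp add: R complex_vector.scale_right_distrib scaleC_scaleC)
  finally have 1: "alpha z0 z *\<^sub>C R z (g f) = (k * (z - z0)) *\<^sub>C f + (k * (z - z0) * z0) *\<^sub>C T" .
  have "beta z0 z = k * z0 * (1 - cnj z0 * z)" "beta z0 z * mob z0 z = k * (z - z0) * z0"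
    using d by (simp_all add: beta_def mob_def k_def)
  then have 2: "beta z0 z *\<^sub>C g f = (k * z0 * (1 - cnj z0 * z)) *\<^sub>C f - (k * (z - z0) * z0) *\<^sub>C T"
    by (simp add: g_def T_def complex_vector.scale_right_diff_distrib scaleC_scaleC)
  have "alpha z0 z *\<^sub>C R z (g f) + beta z0 z *\<^sub>C g f
      = (k * (z - z0) + k * z0 * (1 - cnj z0 * z)) *\<^sub>C f"
    by (simp add: 1 2 complex_vector.scale_left_distrib)
  also have "k * (z - z0) + k * z0 * (1 - cnj z0 * z) = k * (z * (1 - z0 * cnj z0))"
    by (simp add: algebra_simps)
  finally show ?thesis
    by (simp add: kz)
qed

lemma shifted_resolvent_right:
  assumes z: "norm z < 1" "z \<noteq> 0"
  defines "h \<equiv> \<lambda>x. alpha z0 z *\<^sub>C R z x + beta z0 z *\<^sub>C x"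
  shows "h x - mob z0 z *\<^sub>C ext (C z) (h x) = x"
proof -
  obtain f where "x = f - mob z0 z *\<^sub>C ext (C z) f"
    using surjD[OF bij_is_surj[OF bij_inner[OF z(1)]], of x] by blast
  then show ?thesis
    using shifted_resolvent_left[OF z, of f] by (simp add: h_def)
qed

text \<open>Limits at the arc are first taken within \<open>Z\<close>, where the parameter \<open>C\<close> is available.\<close>

abbreviation "Z \<equiv> ball 0 1 \<union> \<Delta>"
abbreviation "Dom \<equiv> ball 0 1 \<union> {z. 1 < norm z} \<union> \<Delta>"

lemma eventually_Z:
  assumes "\<mu> \<in> \<Delta>"
  shows "\<forall>\<^sub>F z in at \<mu> within Z. z \<in> Z \<and> z \<noteq> 0 \<and> z \<noteq> z0"
proof -
  have "\<mu> \<noteq> 0" "\<mu> \<noteq> z0"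
    using circle[OF assms] z0 by auto
  then have "\<forall>\<^sub>F z in at \<mu> within Z. z \<noteq> 0" "\<forall>\<^sub>F z in at \<mu> within Z. z \<noteq> z0"
    using tendsto_imp_eventually_ne[OF tendsto_ident_at] by blast+
  then show ?thesis
    by (auto simp: eventually_at_filter elim: eventually_elim2)
qed

lemma mob_nz:
  assumes "z \<in> Z" "z \<noteq> z0"
  shows "mob z0 z \<noteq> 0"
proof -
  have "norm z \<le> 1"
    using assms(1) circle by force
  then show ?thesis
    using denom_nz[OF z0] assms(2) by (simp add: mob_def)
qed

text \<open>For a function continued from the disc to the arc, the symmetry of \<open>R\<close> with respect to the
  circle says in the limit that the boundary values have real part \<open>1/2\<close>.\<close>

lemma continued_resolvent_half:
  assumes F: "op_analytic_on UNIV Dom F"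
    and FR: "\<And>z x. norm z \<noteq> 1 \<Longrightarrow> F z x = R z x"
    and \<mu>: "\<mu> \<in> \<Delta>"
  shows "cinner (F \<mu> x) y + cinner x (F \<mu> y) = cinner x y"
proof -
  have n\<mu>: "norm \<mu> = 1" and \<mu>0: "\<mu> \<noteq> 0"
    using circle[OF \<mu>] by auto
  have F_lim: "((\<lambda>z. F z x) \<longlongrightarrow> F \<mu> x) (at \<mu>)" for x
    by (rule op_tendsto_apply[OF op_analytic_on_imp_op_tendsto[OF F _ open_domain]])
       (use \<mu> in \<open>auto simp: complex_vector.subspace_UNIV\<close>)
  let ?c = "\<lambda>r. complex_of_real r * \<mu>" and ?d = "\<lambda>r. \<mu> / complex_of_real r"
  have ev: "\<forall>\<^sub>F r in at_left 1. r \<in> {0<..<1::real}"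
    by (rule eventually_at_leftI[of 0]) auto
  have ne: "complex_of_real r \<noteq> 1" if "r \<in> {0<..<1}" for r
    using that by auto
  have "(?c \<longlongrightarrow> complex_of_real 1 * \<mu>) (at_left 1)"
    by (intro tendsto_intros)
  then have "filterlim ?c (at \<mu>) (at_left 1)"
    unfolding filterlim_at using ev by (auto elim!: eventually_mono simp: \<mu>0)
  then have c: "((\<lambda>r. F (?c r) y) \<longlongrightarrow> F \<mu> y) (at_left 1)"
    by (rule filterlim_compose[OF F_lim])
  have "(?d \<longlongrightarrow> \<mu> / complex_of_real 1) (at_left 1)"
    by (intro tendsto_intros) auto
  then have "filterlim ?d (at \<mu>) (at_left 1)"
    unfolding filterlim_at using ev by (auto elim!: eventually_mono simp: \<mu>0 field_simps)
  then have d: "((\<lambda>r. F (?d r) x) \<longlongrightarrow> F \<mu> x) (at_left 1)"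
    by (rule filterlim_compose[OF F_lim])
  have "((\<lambda>r. cinner (F (?d r) x) y + cinner x (F (?c r) y))
      \<longlongrightarrow> cinner (F \<mu> x) y + cinner x (F \<mu> y)) (at_left 1)"
    by (intro tendsto_add tendsto_cinner_left[OF d] tendsto_cinner_right[OF c])
  moreover have "\<forall>\<^sub>F r in at_left 1. cinner (F (?d r) x) y + cinner x (F (?c r) y) = cinner x y"
    using ev
  proof eventually_elim
    case (elim r)
    have nc: "norm (?c r) \<noteq> 1" "?c r \<noteq> 0"
      using elim n\<mu> \<mu>0 by (auto simp: norm_mult)
    have nd: "norm (?d r) \<noteq> 1"
      using elim n\<mu> by (auto simp: norm_divide)
    have "\<mu> * cnj \<mu> = 1"
      using complex_norm_square[of \<mu>] n\<mu> by simp
    then have "1 / cnj (?c r) = ?d r"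
      using elim \<mu>0 by (simp add: divide_simps mult.commute)
    then show ?case
      using R_adjoint[OF nc, of x y] by (simp only: FR[OF nc(1)] FR[OF nd])
  qed
  ultimately have "((\<lambda>r::real. cinner x y) \<longlongrightarrow> cinner (F \<mu> x) y + cinner x (F \<mu> y)) (at_left 1)"
    by (rule Lim_transform_eventually)
  then show ?thesis
    using tendsto_unique[OF trivial_limit_at_left_real _ tendsto_const] by blast
qed

text \<open>Necessity. Put \<open>B = E - mob T\<close>, the inverse of \<open>G = alpha F + beta E\<close>. The inverses are
  bounded by \<open>2\<close> on both sides of the limit, inside because \<open>T\<close> is a contraction and on the arc because
  \<open>G\<close> has real part \<open>1/2\<close>; so \<open>B\<close>, and with it \<open>T\<close>, is continuous up to the arc, where \<open>T\<close> is
  unitary. The block structure \<open>T = A \<oplus> C\<close> passes to the limit and turns unitarity of \<open>T\<close> into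
  unitarity of the extended \<open>C\<close>, while bijectivity of \<open>B\<close> becomes the condition on \<open>C - W\<close>.\<close>

theorem boundary_parameter_of_continuation:
  assumes F: "op_analytic_on UNIV Dom F"
    and FR: "\<And>z x. norm z \<noteq> 1 \<Longrightarrow> F z x = R z x"
  shows "\<exists>Ce. (\<forall>\<mu>\<in>ball 0 1. \<forall>x\<in>N. Ce \<mu> x = C \<mu> x) \<and> op_continuous_on N Z Ce \<and>
    (\<forall>\<mu>\<in>\<Delta>. isometry_on N (Ce \<mu>) \<and> Ce \<mu> ` N = N') \<and>
    (\<forall>\<mu>\<in>\<Delta>. inj_on (\<lambda>x. Ce \<mu> x - W_op D V \<mu> z0 x) N \<and>
      (\<lambda>x. Ce \<mu> x - W_op D V \<mu> z0 x) ` N = N')"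
proof -
  define G where "G z x = alpha z0 z *\<^sub>C F z x + beta z0 z *\<^sub>C x" for z x
  define B where "B z = (if norm z < 1 then (\<lambda>x. x - mob z0 z *\<^sub>C ext (C z) x) else inv (G z))" for z
  define T where "T z x = inverse (mob z0 z) *\<^sub>C (x - B z x)" for z x
  define Ce where "Ce z = (if norm z < 1 then C z else T z)" for z
  have bdF: "bounded_clinear_on UNIV (F z)" if "z \<in> Dom" for z
    using F that by (auto simp: op_analytic_on_def)
  have half: "\<exists>K. half_real_part (G \<mu>) K" if \<mu>: "\<mu> \<in> \<Delta>" for \<mu>
  proof -
    have linF: "clinear_on UNIV (F \<mu>)"
      using bdF[of \<mu>] \<mu> by (auto simp: bounded_clinear_on_def)
    obtain K where K: "0 \<le> K" "\<And>x. norm (F \<mu> x) \<le> K * norm x"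
      using bounded_clinear_on_le[OF bdF[of \<mu>]] \<mu> by auto
    have "half_real_part (G \<mu>) (norm (alpha z0 \<mu>) * K + norm (beta z0 \<mu>))"
    proof
      show "clinear_on UNIV (G \<mu>)"
        by (rule clinear_onI) (simp_all add: G_def clinear_on_add[OF linF] clinear_on_scale[OF linF]
            complex_vector.scale_right_distrib mult.commute)
      show "norm (G \<mu> x) \<le> (norm (alpha z0 \<mu>) * K + norm (beta z0 \<mu>)) * norm x" for x
      proof -
        have "norm (G \<mu> x) \<le> norm (alpha z0 \<mu>) * norm (F \<mu> x) + norm (beta z0 \<mu>) * norm x"
          unfolding G_def by (rule order_trans[OF norm_triangle_ineq]) (simp add: norm_scaleC)
        also have "\<dots> \<le> norm (alpha z0 \<mu>) * (K * norm x) + norm (beta z0 \<mu>) * norm x"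
          by (intro add_right_mono mult_left_mono K) auto
        finally show ?thesis
          by (simp add: algebra_simps)
      qed
      fix x y
      have h: "cinner (F \<mu> x) y + cinner x (F \<mu> y) = cinner x y"
        by (rule continued_resolvent_half[OF F FR \<mu>])
      have "cinner (G \<mu> x) y + cinner x (G \<mu> y)
          = alpha z0 \<mu> * (cinner (F \<mu> x) y + cinner x (F \<mu> y))
            + (beta z0 \<mu> + cnj (beta z0 \<mu>)) * cinner x y"
        unfolding G_def cinner_add_left cinner_add_right cinner_scaleC_left cinner_scaleC_right
          cnj_alpha[OF z0 circle[OF \<mu>]]
        by (simp add: algebra_simps)
      also have "\<dots> = (alpha z0 \<mu> + beta z0 \<mu> + cnj (beta z0 \<mu>)) * cinner x y"
        unfolding h by (simp add: algebra_simps)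
      finally show "cinner (G \<mu> x) y + cinner x (G \<mu> y) = cinner x y"
        by (simp add: alpha_beta_sum[OF z0 circle[OF \<mu>]])
    qed
    then show ?thesis ..
  qed
  have B_inner: "clinear_on UNIV (B z)" "B z (G z x) = x" "norm (B z x) \<le> 2 * norm x"
    if z: "norm z < 1" "z \<noteq> 0" for z x
  proof -
    have n: "norm (ext (C z) x) \<le> norm x"
      by (intro norm_ext_le C_contraction C_range z)
    show "clinear_on UNIV (B z)"
      using z by (simp add: B_def clinear_on_one_minus ext_clinear C_clinear)
    show "B z (G z x) = x"
      using shifted_resolvent_right[OF z, of x] z by (simp add: B_def G_def FR)
    have "norm (B z x) \<le> (1 + norm (mob z0 z)) * norm x"
      using norm_one_minus_le[of "ext (C z)" x "mob z0 z", OF n] z by (simp add: B_def)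
    also have "\<dots> \<le> 2 * norm x"
      using norm_mob_less[OF z0 z(1)] by (intro mult_right_mono) auto
    finally show "norm (B z x) \<le> 2 * norm x" .
  qed
  have B_arc: "clinear_on UNIV (B z)" "B z (G z x) = x" "G z (B z x) = x" "norm (B z x) \<le> 2 * norm x"
    "bij (B z)" if z: "z \<in> \<Delta>" for z x
  proof -
    obtain K where "half_real_part (G z) K"
      using half[OF z] by blast
    then interpret half_real_part "G z" K .
    have B: "B z = inv (G z)"
      using circle[OF z] by (simp add: B_def)
    show "clinear_on UNIV (B z)" "B z (G z x) = x" "G z (B z x) = x" "norm (B z x) \<le> 2 * norm x"
      "bij (B z)"
      unfolding B by (rule lin_inv inv_left inv_right norm_inv_le bij_inv)+
  qed
  have T_inner: "T z x = ext (C z) x" if "norm z < 1" "z \<noteq> z0" for z x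
    using that mob_nz[of z] by (simp add: T_def B_def scaleC_scaleC)
  have T_lim: "op_tendsto UNIV T (T \<mu>) (at \<mu> within Z)" if \<mu>: "\<mu> \<in> \<Delta>" for \<mu>
  proof -
    have \<mu>0: "\<mu> \<noteq> 0"
      using circle[OF \<mu>] by auto
    obtain K where K: "0 \<le> K" "\<And>x. norm (F \<mu> x) \<le> K * norm x"
      using bounded_clinear_on_le[OF bdF[of \<mu>]] \<mu> by auto
    have "op_tendsto UNIV F (F \<mu>) (at \<mu>)"
      by (rule op_analytic_on_imp_op_tendsto[OF F _ open_domain])
         (use \<mu> in \<open>auto simp: complex_vector.subspace_UNIV\<close>)
    then have "op_tendsto UNIV G (G \<mu>) (at \<mu>)"
      unfolding G_def[abs_def]
      by (rule op_tendsto_add[OF op_tendsto_scaleC[OF _ tendsto_alpha[OF z0 \<mu>0] K(2)]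
            op_tendsto_scale_id[OF tendsto_beta[OF z0 \<mu>0]]])
    then have G: "op_tendsto UNIV G (G \<mu>) (at \<mu> within Z)"
      by (rule op_tendsto_mono) (simp add: at_le)
    have B: "op_tendsto UNIV B (B \<mu>) (at \<mu> within Z)"
    proof (rule op_tendsto_inverse[OF G])
      show "\<forall>\<^sub>F z in at \<mu> within Z. clinear_on UNIV (B z) \<and>
          (\<forall>x. B z (G z x) = x \<and> norm (B z x) \<le> 2 * norm x)"
        using eventually_Z[OF \<mu>] by eventually_elim (auto intro: B_inner B_arc)
    qed (rule B_arc[OF \<mu>])+
    have mob: "mob z0 \<mu> \<noteq> 0"
      by (rule mob_nz) (use \<mu> circle[OF \<mu>] z0 in auto)
    have "op_tendsto UNIV (\<lambda>z x. x - B z x) (\<lambda>x. x - B \<mu> x) (at \<mu> within Z)"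
      by (rule op_tendsto_diff[OF op_tendsto_const B])
    then show ?thesis
      unfolding T_def[abs_def]
    proof (rule op_tendsto_scaleC)
      show "((\<lambda>z. inverse (mob z0 z)) \<longlongrightarrow> inverse (mob z0 \<mu>)) (at \<mu> within Z)"
        by (intro tendsto_inverse tendsto_mob z0 mob) (use circle[OF \<mu>] in simp)
      show "norm (x - B \<mu> x) \<le> 3 * norm x" for x
        using norm_triangle_ineq4[of x "B \<mu> x"] B_arc(4)[OF \<mu>, of x] by simp
    qed
  qed
  have Ce_T: "Ce z x = T z x" if "z \<in> Z" "z \<noteq> z0" "x \<in> N" for z x
    using that by (simp add: Ce_def T_inner ext_N)
  have arc: "isometry_on N (Ce \<mu>)" "Ce \<mu> ` N = N'" "ext (Ce \<mu>) = T \<mu>" if \<mu>: "\<mu> \<in> \<Delta>" for \<mu>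
  proof -
    obtain K where "half_real_part (G \<mu>) K"
      using half[OF \<mu>] by blast
    then interpret H: half_real_part "G \<mu>" K .
    have n\<mu>: "norm \<mu> = 1"
      by (rule circle[OF \<mu>])
    have Ce: "Ce \<mu> = T \<mu>"
      using n\<mu> by (simp add: Ce_def)
    have T\<mu>: "T \<mu> x = inverse (mob z0 \<mu>) *\<^sub>C (x - inv (G \<mu>) x)" for x
      using n\<mu> by (simp add: T_def B_def)
    have nm: "norm (inverse (mob z0 \<mu>)) = 1"
      using norm_mob_eq[OF z0 n\<mu>] by (simp add: norm_inverse)
    have linT: "clinear_on UNIV (T \<mu>)"
      by (rule clinear_onI)
         (simp_all add: T\<mu> clinear_on_add[OF H.lin_inv] clinear_on_scale[OF H.lin_inv]
           complex_vector.scale_right_distrib complex_vector.scale_right_diff_distrib mult.commute)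
    have isoT: "isometry_on UNIV (T \<mu>)"
    proof (rule isometry_on_of_cinner[OF linT])
      fix x
      have e: "cnj (inverse (mob z0 \<mu>)) * inverse (mob z0 \<mu>) = 1"
        using complex_norm_square[of "inverse (mob z0 \<mu>)"] nm by (simp add: mult.commute)
      show "cinner (T \<mu> x) (T \<mu> x) = cinner x x"
        unfolding T\<mu> cinner_scaleC_left cinner_scaleC_right H.cayley_isometry
        unfolding mult.assoc[symmetric] e by (rule mult_1)
    qed
    have surjT: "surj (T \<mu>)"
      unfolding surj_def
    proof
      fix y
      obtain x where x: "mob z0 \<mu> *\<^sub>C y = x - inv (G \<mu>) x"
        using surjD[OF H.cayley_surj] by blast
      have "inverse (mob z0 \<mu>) * mob z0 \<mu> = 1"
        using nm by (intro left_inverse) auto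
      then have "T \<mu> x = y"
        unfolding T\<mu> x[symmetric] by (simp only: complex_vector.scale_one scaleC_scaleC)
      then have "y = T \<mu> x"
        by simp
      then show "\<exists>x. y = T \<mu> x" ..
    qed
    \<comment> \<open>the values on \<open>M\<close> and \<open>N\<close> are inherited from the approximation inside the disc\<close>
    let ?f = "at \<mu> within ball 0 1"
    have nt: "?f \<noteq> bot"
      using n\<mu> by (simp add: trivial_limit_within islimpt_ball)
    have lim: "((\<lambda>z. T z x) \<longlongrightarrow> T \<mu> x) ?f" for x
      by (rule op_tendsto_apply[OF op_tendsto_mono[OF T_lim[OF \<mu>]]]) (auto intro: at_le)
    have "?f \<le> at \<mu> within Z"
      by (rule at_le) auto
    then have "\<forall>\<^sub>F z in ?f. z \<in> Z \<and> z \<noteq> 0 \<and> z \<noteq> z0"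
      using eventually_Z[OF \<mu>] by (rule filter_leD)
    moreover have "\<forall>\<^sub>F z in ?f. z \<in> ball 0 1"
      by (simp add: eventually_at_filter)
    ultimately have ev: "\<forall>\<^sub>F z in ?f. norm z < 1 \<and> z \<noteq> z0"
      by eventually_elim auto
    have TM: "T \<mu> x = A x" if "x \<in> M_space D V z0" for x
    proof -
      have "\<forall>\<^sub>F z in ?f. T z x = A x"
        using ev by eventually_elim (use that in \<open>simp add: T_inner ext_M C_clinear\<close>)
      with lim[of x] have "((\<lambda>z. A x) \<longlongrightarrow> T \<mu> x) ?f"
        by (rule Lim_transform_eventually)
      then show ?thesis
        using tendsto_unique[OF nt _ tendsto_const] by blast
    qed
    have TN: "T \<mu> x \<in> N'" if "x \<in> N" for x
    proof (rule Lim_in_closed_set[OF closed_orth_compl _ nt lim])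
      show "\<forall>\<^sub>F z in ?f. T z x \<in> N'"
        using ev by eventually_elim (use that C_range in \<open>auto simp: T_inner ext_N\<close>)
    qed
    show "ext (Ce \<mu>) = T \<mu>"
    proof
      fix x
      have "T \<mu> (P x + Q x) = T \<mu> (P x) + T \<mu> (Q x)"
        by (rule clinear_on_add[OF linT]) auto
      then show "ext (Ce \<mu>) x = T \<mu> x"
        by (simp add: ext_def Ce TM P_mem) (simp add: Q_eq)
    qed
    show "isometry_on N (Ce \<mu>)"
      using isoT unfolding Ce isometry_on_def clinear_on_def by simp
    show "Ce \<mu> ` N = N'"
    proof (intro equalityI subsetI)
      fix k assume k: "k \<in> N'"
      obtain x where x: "k = T \<mu> x"
        using surjD[OF surjT] by blast
      have "k - T \<mu> (Q x) = T \<mu> (x - Q x)"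
        by (simp add: x clinear_on_diff[OF linT])
      also have "\<dots> = A (P x)"
        by (simp add: Q_eq TM P_mem)
      finally have "k - T \<mu> (Q x) \<in> M'"
        using P_mem by simp
      moreover have "k - T \<mu> (Q x) \<in> N'"
        by (rule complex_vector.subspace_diff[OF subN' k TN[OF Q_mem]])
      ultimately have "k - T \<mu> (Q x) = 0"
        by (rule orth_compl_Int)
      then show "k \<in> Ce \<mu> ` N"
        using Q_mem by (auto simp: Ce)
    qed (use TN in \<open>auto simp: Ce\<close>)
  qed
  have cont: "op_continuous_on N Z Ce"
    unfolding op_continuous_on_def
  proof
    fix z assume z: "z \<in> Z"
    show "bounded_clinear_on N (Ce z) \<and> uniform_limit (N \<inter> cball 0 1) Ce (Ce z) (at z within Z)"
    proof (cases "z \<in> \<Delta>")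
      case True
      have "op_tendsto N T (T z) (at z within Z)"
        by (rule op_tendsto_subset[OF T_lim[OF True]]) simp
      then have "op_tendsto N Ce (Ce z) (at z within Z)"
      proof (rule op_tendsto_cong)
        show "\<forall>\<^sub>F w in at z within Z. \<forall>x\<in>N. T w x = Ce w x"
          using eventually_Z[OF True] by eventually_elim (use Ce_T in auto)
        show "\<forall>x\<in>N. T z x = Ce z x"
          using circle[OF True] by (simp add: Ce_def)
      qed
      moreover have "bounded_clinear_on N (Ce z)"
        using arc(1)[OF True] by (auto simp: bounded_clinear_on_def isometry_on_def intro: exI[of _ 1])
      ultimately show ?thesis
        by (auto intro!: uniform_limit_opI dest: op_tendstoD)
    next
      case False
      then have zb: "z \<in> ball 0 1"
        using z by blast
      then have "op_tendsto N C (C z) (at z within Z)"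
        by (intro op_tendsto_mono[OF op_analytic_on_imp_op_tendsto[OF C_analytic subN open_ball]])
           (auto intro: at_le)
      then have "op_tendsto N Ce (Ce z) (at z within Z)"
      proof (rule op_tendsto_cong)
        have "\<forall>\<^sub>F w in nhds z. w \<in> ball 0 1"
          by (rule eventually_nhds_in_open[OF open_ball zb])
        then show "\<forall>\<^sub>F w in at z within Z. \<forall>x\<in>N. C w x = Ce w x"
          unfolding eventually_at_filter by eventually_elim (simp add: Ce_def)
      qed (use zb in \<open>simp add: Ce_def\<close>)
      moreover have "bounded_clinear_on N (Ce z)"
        using C_analytic zb by (auto simp: op_analytic_on_def Ce_def)
      ultimately show ?thesis
        by (auto intro!: uniform_limit_opI dest: op_tendstoD)
    qed
  qed
  have inv: "inj_on (\<lambda>x. Ce \<mu> x - W_op D V \<mu> z0 x) N \<and> (\<lambda>x. Ce \<mu> x - W_op D V \<mu> z0 x) ` N = N'"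
    if \<mu>: "\<mu> \<in> \<Delta>" for \<mu>
  proof -
    have "x - mob z0 \<mu> *\<^sub>C ext (Ce \<mu>) x = B \<mu> x" for x
    proof -
      have "mob z0 \<mu> \<noteq> 0"
        by (rule mob_nz) (use \<mu> circle[OF \<mu>] z0 in auto)
      then show ?thesis
        unfolding arc(3)[OF \<mu>] T_def by (simp add: scaleC_scaleC)
    qed
    then have "bij (\<lambda>x. x - mob z0 \<mu> *\<^sub>C ext (Ce \<mu>) x)"
      using B_arc(5)[OF \<mu>] by simp
    then show ?thesis
      using bij_iff_W_op[OF circle[OF \<mu>] regular[OF \<mu>] proj[OF \<mu>] arc(1,2)[OF \<mu>]] by blast
  qed
  have "\<forall>\<mu>\<in>ball 0 1. \<forall>x\<in>N. Ce \<mu> x = C \<mu> x"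
    by (simp add: Ce_def)
  with cont arc(1,2) inv show ?thesis
    by blast
qed

text \<open>Sufficiency. By the boundary criterion \<open>B = E - mob T\<close> is bijective on the arc, and its inverse is
  bounded. A bound for the inverse persists nearby, so the inverses, and with them the resolvents,
  have a norm limit from inside the disc. By the symmetry of the resolvent its
  matrix coefficients also converge from the exterior, to the same values since \<open>F + F\<^sup>* = E\<close> on the
  arc; pasting across the circle makes them holomorphic.\<close>

theorem continuation_of_boundary_parameter:
  assumes CeC: "\<And>\<mu> x. norm \<mu> < 1 \<Longrightarrow> x \<in> N \<Longrightarrow> Ce \<mu> x = C \<mu> x"
    and cont: "op_continuous_on N Z Ce"
    and iso: "\<And>\<mu>. \<mu> \<in> \<Delta> \<Longrightarrow> isometry_on N (Ce \<mu>)"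
    and onto: "\<And>\<mu>. \<mu> \<in> \<Delta> \<Longrightarrow> Ce \<mu> ` N = N'"
    and inv: "\<And>\<mu>. \<mu> \<in> \<Delta> \<Longrightarrow> inj_on (\<lambda>x. Ce \<mu> x - W_op D V \<mu> z0 x) N \<and>
      (\<lambda>x. Ce \<mu> x - W_op D V \<mu> z0 x) ` N = N'"
  shows "\<exists>F. op_analytic_on UNIV Dom F \<and> (\<forall>z. norm z \<noteq> 1 \<longrightarrow> (\<forall>h. F z h = R z h))"
proof -
  define T where "T z = ext (Ce z)" for z
  define B where "B z x = x - mob z0 z *\<^sub>C T z x" for z x
  define G where "G z = inv (B z)" for z
  define F where "F z x = (if norm z = 1 then inverse (alpha z0 z) *\<^sub>C (G z x - beta z0 z *\<^sub>C x) else R z x)"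
    for z x
  have lin_Ce: "clinear_on N (Ce z)" if "z \<in> Z" for z
    using cont that by (auto simp: op_continuous_on_def bounded_clinear_on_def)
  have linB: "clinear_on UNIV (B z)" if "z \<in> Z" for z
    unfolding B_def[abs_def] T_def by (intro clinear_on_one_minus ext_clinear lin_Ce that)
  have T_inner: "T z = ext (C z)" if "norm z < 1" for z
    using CeC[OF that Q_mem] by (auto simp: T_def ext_def)
  have bijB: "bij (B z)" if "z \<in> Z" for z
  proof (cases "z \<in> \<Delta>")
    case True
    show ?thesis
      unfolding B_def[abs_def] T_def
      using bij_iff_W_op[OF circle[OF True] regular[OF True] proj[OF True] iso[OF True] onto[OF True]]
        inv[OF True] by blast
  next
    case False
    then have z: "norm z < 1"
      using that by auto
    show ?thesis
      unfolding B_def[abs_def] T_inner[OF z] by (rule bij_inner[OF z])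
  qed
  have GB: "G z (B z x) = x" "B z (G z x) = x" "clinear_on UNIV (G z)" if "z \<in> Z" for z x
    using bijB[OF that] clinear_on_inv[OF linB[OF that] bijB[OF that]]
    by (simp_all add: G_def bij_is_inj bij_is_surj surj_f_inv_f)
  have F_eq: "F z x = inverse (alpha z0 z) *\<^sub>C (G z x - beta z0 z *\<^sub>C x)"
    if z: "z \<in> Z" "z \<noteq> 0" "z \<noteq> z0" for z x
  proof (cases "norm z = 1")
    case False
    then have n: "norm z < 1"
      using z(1) circle by auto
    let ?h = "alpha z0 z *\<^sub>C R z x + beta z0 z *\<^sub>C x"
    have "B z ?h = x"
      unfolding B_def T_inner[OF n] by (rule shifted_resolvent_right[OF n z(2)])
    then have "G z x = ?h"
      using GB(1)[OF z(1), of ?h] by simp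
    moreover have "inverse (alpha z0 z) * alpha z0 z = 1"
      using z(2,3) denom_nz[OF z0, of z] one_minus_z0_nz[OF z0] n
      by (intro left_inverse) (simp add: alpha_def)
    ultimately show ?thesis
      using False by (simp add: F_def scaleC_scaleC)
  qed (simp add: F_def)
  have half: "\<exists>K. half_real_part (G \<mu>) K" if \<mu>: "\<mu> \<in> \<Delta>" for \<mu>
  proof -
    have "isometry_on UNIV (T \<mu>)"
      unfolding T_def using iso[OF \<mu>] onto[OF \<mu>] by (intro ext_isometry) auto
    moreover have "bij (\<lambda>x. x - mob z0 \<mu> *\<^sub>C T \<mu> x)"
      using bijB[of \<mu>] \<mu> by (simp add: B_def[abs_def])
    ultimately show ?thesis
      using half_real_part_inv_one_minus[OF _ norm_mob_eq[OF z0 circle[OF \<mu>]]]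
      unfolding G_def B_def[abs_def] by metis
  qed
  have F_half: "cinner (F \<mu> x) y + cinner x (F \<mu> y) = cinner x y" if \<mu>: "\<mu> \<in> \<Delta>" for \<mu> x y
  proof -
    let ?a = "alpha z0 \<mu>" and ?b = "beta z0 \<mu>"
    obtain K where "half_real_part (G \<mu>) K"
      using half[OF \<mu>] by blast
    then have h: "cinner (G \<mu> x) y + cinner x (G \<mu> y) = cinner x y"
      by (rule half_real_part.half)
    have ca: "cnj (inverse ?a) = inverse ?a"
      using cnj_alpha[OF z0 circle[OF \<mu>]] by simp
    have a1: "?a = 1 - ?b - cnj ?b"
      using alpha_beta_sum[OF z0 circle[OF \<mu>]] by (simp add: algebra_simps)
    have "cinner (F \<mu> x) y + cinner x (F \<mu> y)
        = inverse ?a * (cinner (G \<mu> x) y + cinner x (G \<mu> y) - (?b + cnj ?b) * cinner x y)"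
    proof -
      have F: "F \<mu> x = inverse ?a *\<^sub>C (G \<mu> x - ?b *\<^sub>C x)" for x
        using circle[OF \<mu>] by (simp add: F_def)
      show ?thesis
        unfolding F cinner_scaleC_left cinner_scaleC_right cinner_diff_left cinner_diff_right ca
        by (simp only: algebra_simps)
    qed
    also have "\<dots> = inverse ?a * (?a * cinner x y)"
      unfolding h by (subst (2) a1) (simp add: algebra_simps)
    also have "\<dots> = cinner x y"
      using alpha_nz[OF z0 circle[OF \<mu>]] by simp
    finally show ?thesis .
  qed
  have F_symm: "cinner (F z x) y + cinner x (F (1 / cnj z) y) = cinner x y"
    if z: "z \<in> Dom" "z \<noteq> 0" for z x y
  proof (cases "norm z = 1")
    case True
    then have "z \<in> \<Delta>"
      using z by auto
    moreover have "1 / cnj z = z"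
      using complex_norm_square[of z] True z(2) by (simp add: field_simps)
    ultimately show ?thesis
      using F_half by simp
  next
    case False
    then have "norm (1 / cnj z) \<noteq> 1" "1 / cnj z \<noteq> 0"
      using z(2) by (simp_all add: norm_divide)
    then show ?thesis
      using R_adjoint[of "1 / cnj z" x y] False by (simp add: F_def)
  qed
  have F_lim: "op_tendsto UNIV F (F \<mu>) (at \<mu> within Z)"
    and F_bound: "\<exists>K\<ge>0. \<forall>x. norm (F \<mu> x) \<le> K * norm x" if \<mu>: "\<mu> \<in> \<Delta>" for \<mu>
  proof -
    have n\<mu>: "norm \<mu> = 1" and \<mu>0: "\<mu> \<noteq> 0" and \<mu>Z: "\<mu> \<in> Z" and \<mu>z0: "\<mu> \<noteq> z0"
      using circle[OF \<mu>] \<mu> z0 by auto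
    have evZ: "\<forall>\<^sub>F z in at \<mu> within Z. z \<in> Z"
      by (simp add: eventually_at_filter)
    have Ce_lim: "op_tendsto N Ce (Ce \<mu>) (at \<mu> within Z)"
      unfolding op_tendsto_def
    proof (intro allI impI)
      fix e :: real assume e: "0 < e"
      have "uniform_limit (N \<inter> cball 0 1) Ce (Ce \<mu>) (at \<mu> within Z)"
        using cont \<mu>Z by (simp add: op_continuous_on_def)
      then show "\<forall>\<^sub>F w in at \<mu> within Z. \<forall>x\<in>N. norm (Ce w x - Ce \<mu> x) \<le> e * norm x"
        by (rule uniform_limit_opD[OF _ subN eventually_mono[OF evZ lin_Ce] lin_Ce[OF \<mu>Z] e])
    qed
    have T_lim: "op_tendsto UNIV T (T \<mu>) (at \<mu> within Z)"
      unfolding op_tendsto_def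
    proof (intro allI impI)
      fix e :: real assume e: "0 < e"
      from op_tendstoD[OF Ce_lim e] show "\<forall>\<^sub>F w in at \<mu> within Z. \<forall>x\<in>UNIV. norm (T w x - T \<mu> x) \<le> e * norm x"
      proof eventually_elim
        case (elim w)
        show ?case
        proof
          fix x
          have "norm (T w x - T \<mu> x) = norm (Ce w (Q x) - Ce \<mu> (Q x))"
            by (simp add: T_def ext_def)
          also have "\<dots> \<le> e * norm (Q x)"
            using elim Q_mem by blast
          also have "\<dots> \<le> e * norm x"
            using e norm_orth_proj_le(2)[OF subM clM] by (intro mult_left_mono) auto
          finally show "norm (T w x - T \<mu> x) \<le> e * norm x" .
        qed
      qed
    qed
    have nT: "norm (T \<mu> x) \<le> 1 * norm x" for x
      using isometry_on_norm[OF ext_isometry[OF iso[OF \<mu>]], of x] onto[OF \<mu>] by (simp add: T_def)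
    have "op_tendsto UNIV (\<lambda>z x. mob z0 z *\<^sub>C T z x) (\<lambda>x. mob z0 \<mu> *\<^sub>C T \<mu> x) (at \<mu> within Z)"
      by (rule op_tendsto_scaleC[OF T_lim tendsto_mob[OF z0 eq_refl[OF n\<mu>]] nT])
    then have B_lim: "op_tendsto UNIV B (B \<mu>) (at \<mu> within Z)"
      unfolding B_def[abs_def] by (rule op_tendsto_diff[OF op_tendsto_const])
    obtain K0 where "half_real_part (G \<mu>) K0"
      using half[OF \<mu>] by blast
    then have K0: "norm (G \<mu> x) \<le> K0 * norm x" for x
      by (rule half_real_part.bdG)
    define K where "K = max K0 1"
    have K: "0 < K" "norm (G \<mu> x) \<le> K * norm x" for x
      using order_trans[OF K0[of x] mult_right_mono[of K0 K "norm x"]] by (auto simp: K_def)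
    have K2: "norm (G \<mu> x) \<le> 2 * K * norm x" for x
      using K(1) by (intro order_trans[OF K(2)] mult_right_mono) auto
    \<comment> \<open>\<open>B \<mu>\<close> is bounded below by \<open>1/K\<close>, hence nearby operators \<open>B z\<close> by half of it\<close>
    have "0 < 1 / (2 * K)"
      using K(1) by simp
    from op_tendstoD[OF B_lim this] evZ
    have "\<forall>\<^sub>F z in at \<mu> within Z. clinear_on UNIV (G z) \<and>
        (\<forall>x. G z (B z x) = x \<and> norm (G z x) \<le> 2 * K * norm x)"
    proof eventually_elim
      case (elim z)
      have "norm (G z x) \<le> 2 * K * norm x" for x
      proof -
        let ?y = "G z x"
        have "norm ?y \<le> K * norm (B \<mu> ?y)"
          using K(2)[of "B \<mu> ?y"] by (simp add: GB(1)[OF \<mu>Z])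
        also have "norm (B \<mu> ?y) \<le> norm (B z ?y) + norm (B z ?y - B \<mu> ?y)"
          using norm_triangle_ineq4[of "B z ?y" "B z ?y - B \<mu> ?y"] by simp
        also have "\<dots> \<le> norm x + 1 / (2 * K) * norm ?y"
          using elim(1) unfolding GB(2)[OF elim(2)] by (metis GB(2)[OF elim(2)] UNIV_I add_left_mono)
        finally have "norm ?y \<le> K * (norm x + 1 / (2 * K) * norm ?y)"
          using K(1) by simp
        then show ?thesis
          using K(1) by (simp add: distrib_left)
      qed
      then show ?case
        using GB[OF elim(2)] by blast
    qed
    then have G_lim: "op_tendsto UNIV G (G \<mu>) (at \<mu> within Z)"
      by (rule op_tendsto_inverse[OF B_lim]) (rule GB(2)[OF \<mu>Z] K2)+
    have bd: "norm (G \<mu> x - beta z0 \<mu> *\<^sub>C x) \<le> (K + norm (beta z0 \<mu>)) * norm x" for x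
      using norm_triangle_ineq4[of "G \<mu> x" "beta z0 \<mu> *\<^sub>C x"] K(2)[of x]
      by (simp add: norm_scaleC distrib_right)
    have "op_tendsto UNIV (\<lambda>z x. inverse (alpha z0 z) *\<^sub>C (G z x - beta z0 z *\<^sub>C x))
        (\<lambda>x. inverse (alpha z0 \<mu>) *\<^sub>C (G \<mu> x - beta z0 \<mu> *\<^sub>C x)) (at \<mu> within Z)"
      by (rule op_tendsto_scaleC[OF op_tendsto_diff[OF G_lim op_tendsto_scale_id[OF tendsto_beta[OF z0 \<mu>0]]]
            tendsto_inverse[OF tendsto_alpha[OF z0 \<mu>0] alpha_nz[OF z0 n\<mu>]] bd])
    then show "op_tendsto UNIV F (F \<mu>) (at \<mu> within Z)"
    proof (rule op_tendsto_cong)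
      show "\<forall>\<^sub>F z in at \<mu> within Z. \<forall>x\<in>UNIV.
          inverse (alpha z0 z) *\<^sub>C (G z x - beta z0 z *\<^sub>C x) = F z x"
        using eventually_Z[OF \<mu>] by eventually_elim (simp add: F_eq)
    qed (simp add: F_eq[OF \<mu>Z \<mu>0 \<mu>z0])
    have "norm (F \<mu> x) \<le> norm (inverse (alpha z0 \<mu>)) * (K + norm (beta z0 \<mu>)) * norm x" for x
      unfolding F_eq[OF \<mu>Z \<mu>0 \<mu>z0] norm_scaleC mult.assoc by (intro mult_left_mono bd) auto
    moreover have "0 \<le> norm (inverse (alpha z0 \<mu>)) * (K + norm (beta z0 \<mu>))"
      using K(1) by (intro mult_nonneg_nonneg add_nonneg_nonneg) auto
    ultimately show "\<exists>K\<ge>0. \<forall>x. norm (F \<mu> x) \<le> K * norm x"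
      by blast
  qed
  define E where "E = {z::complex. 1 < norm z}"
  have at_split: "at \<mu> = sup (at \<mu> within Z) (at \<mu> within E)" if "\<mu> \<in> \<Delta>" for \<mu>
  proof -
    have "Dom = Z \<union> E"
      by (auto simp: E_def)
    moreover have "at \<mu> within Dom = at \<mu>"
      by (rule at_within_open[OF _ open_domain]) (use that in auto)
    ultimately show ?thesis
      by (metis at_within_union)
  qed
  have reflect: "filterlim (\<lambda>z. 1 / cnj z) (at \<mu> within Z) (at \<mu> within E)" if \<mu>: "\<mu> \<in> \<Delta>" for \<mu>
  proof -
    have \<mu>0: "\<mu> \<noteq> 0" and n\<mu>: "norm \<mu> = 1"
      using circle[OF \<mu>] by auto
    have "((\<lambda>z. 1 / cnj z) \<longlongrightarrow> 1 / cnj \<mu>) (at \<mu> within E)"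
      using \<mu>0 by (intro tendsto_intros) auto
    moreover have "1 / cnj \<mu> = \<mu>"
      using complex_norm_square[of \<mu>] n\<mu> \<mu>0 by (simp add: field_simps)
    moreover have "\<forall>\<^sub>F z in at \<mu> within E. 1 / cnj z \<in> Z \<and> 1 / cnj z \<noteq> \<mu>"
    proof -
      have "norm (1 / cnj z) < 1" if "z \<in> E" for z
        using that by (simp add: E_def norm_divide divide_less_eq_1)
      then have "1 / cnj z \<in> Z \<and> 1 / cnj z \<noteq> \<mu>" if "z \<in> E" for z
        using that n\<mu> by force
      then show ?thesis
        by (auto simp: eventually_at_filter)
    qed
    ultimately show ?thesis
      by (simp add: filterlim_at)
  qed
  have E_mem: "\<forall>\<^sub>F z in at \<mu> within E. z \<in> Dom \<and> z \<noteq> 0" for \<mu>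
    unfolding eventually_at_filter by (rule always_eventually) (auto simp: E_def)
  have linF: "clinear_on UNIV (F z)" if z: "z \<in> Dom" for z
  proof (cases "norm z = 1")
    case True
    then have "z \<in> Z"
      using z by auto
    note linG = GB(3)[OF this]
    show ?thesis
      by (rule clinear_onI) (simp_all add: F_def True clinear_on_add[OF linG] clinear_on_scale[OF linG]
          complex_vector.scale_right_distrib complex_vector.scale_right_diff_distrib mult.commute
          mult.left_commute)
  next
    case False
    then show ?thesis
      using R_linear[OF False] by (simp add: F_def[abs_def])
  qed
  have "op_analytic_on UNIV Dom F"
  proof (rule op_analytic_on_of_weakly_holomorphic[OF open_domain linF])
    show "\<exists>r>0. \<exists>K. \<forall>w\<in>ball z r \<inter> Dom. \<forall>x. norm (F w x) \<le> K * norm x" if z: "z \<in> Dom" for z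
    proof (cases "norm z = 1")
      case False
      define r where "r = \<bar>1 - norm z\<bar> / 2"
      have r: "r > 0"
        using False by (simp add: r_def)
      have "norm (F w x) \<le> 1 / r * norm x" if "w \<in> ball z r" for w x
      proof -
        have "\<bar>norm z - norm w\<bar> < r"
          using that norm_triangle_ineq3[of z w] by (simp add: dist_norm)
        moreover have "2 * r \<le> \<bar>1 - norm w\<bar> + \<bar>norm z - norm w\<bar>"
          using abs_triangle_ineq[of "1 - norm w" "norm w - norm z"]
          by (simp add: r_def abs_minus_commute)
        ultimately have w: "r \<le> \<bar>1 - norm w\<bar>"
          by linarith
        then have nw: "norm w \<noteq> 1"
          using r by auto
        have "norm (F w x) \<le> norm x / \<bar>1 - norm w\<bar>"
          using R_norm[OF nw] nw by (simp add: F_def)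
        also have "\<dots> \<le> norm x / r"
          using w r by (intro divide_left_mono mult_pos_pos) auto
        finally show ?thesis
          by simp
      qed
      then show ?thesis
        using r by blast
    next
      case True
      then have \<mu>: "z \<in> \<Delta>"
        using z by auto
      obtain K where K: "K \<ge> 0" "\<And>x. norm (F z x) \<le> K * norm x"
        using F_bound[OF \<mu>] by blast
      have evZ: "\<forall>\<^sub>F w in at z within Z. \<forall>x. norm (F w x) \<le> (K + 1) * norm x"
        using op_tendstoD[OF F_lim[OF \<mu>] zero_less_one]
      proof eventually_elim
        case (elim w)
        show ?case
        proof
          fix x
          have "norm (F w x) \<le> norm (F z x) + norm (F w x - F z x)"
            by (rule norm_triangle_sub)
          also have "\<dots> \<le> K * norm x + 1 * norm x"
            using elim K by (intro add_mono) auto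
          finally show "norm (F w x) \<le> (K + 1) * norm x"
            by (simp add: distrib_right)
        qed
      qed
      have evE: "\<forall>\<^sub>F w in at z within E. \<forall>x. norm (F w x) \<le> (K + 2) * norm x"
        using eventually_compose_filterlim[OF evZ reflect[OF \<mu>]] E_mem
      proof eventually_elim
        case (elim w)
        show ?case
        proof
          fix x
          show "norm (F w x) \<le> (K + 2) * norm x"
          proof (rule norm_le_cinner)
            fix y
            have "cinner (F w x) y = cinner x (y - F (1 / cnj w) y)"
              using F_symm[of w x y] elim(2) by (simp add: cinner_diff_right algebra_simps)
            also have "norm \<dots> \<le> norm x * norm (y - F (1 / cnj w) y)"
              by (rule norm_cinner_le)
            also have "\<dots> \<le> norm x * (norm y + (K + 1) * norm y)"
              using elim(1) by (intro mult_left_mono order_trans[OF norm_triangle_ineq4] add_mono) auto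
            finally show "norm (cinner (F w x) y) \<le> (K + 2) * norm x * norm y"
              by (simp add: algebra_simps)
          qed (use K in simp)
        qed
      qed
      have "\<forall>\<^sub>F w in at z. \<forall>x. norm (F w x) \<le> (K + 2) * norm x"
        unfolding at_split[OF \<mu>] eventually_sup
      proof
        show "\<forall>\<^sub>F w in at z within Z. \<forall>x. norm (F w x) \<le> (K + 2) * norm x"
          using evZ
        proof eventually_elim
          case (elim w)
          have "(K + 1) * norm x \<le> (K + 2) * norm x" for x :: 'a
            by (intro mult_right_mono) auto
          then show ?case
            using elim order_trans by blast
        qed
      qed (rule evE)
      then obtain r where r: "r > 0" "\<And>w x. w \<noteq> z \<Longrightarrow> dist w z < r \<Longrightarrow> norm (F w x) \<le> (K + 2) * norm x"
        by (auto simp: eventually_at)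
      have "norm (F z x) \<le> (K + 2) * norm x" for x
        by (rule order_trans[OF K(2)]) (intro mult_right_mono, auto)
      then have "\<forall>w\<in>ball z r \<inter> Dom. \<forall>x. norm (F w x) \<le> (K + 2) * norm x"
        using r(2) by (metis IntD1 dist_commute mem_ball)
      then show ?thesis
        using r(1) by blast
    qed
    fix x y
    let ?f = "\<lambda>z. cinner (F z x) y"
    have op: "open {\<zeta>::complex. norm \<zeta> \<noteq> 1}"
      by (intro open_Collect_neq continuous_intros)
    have hol: "?f holomorphic_on {\<zeta>. norm \<zeta> \<noteq> 1}"
      by (rule holomorphic_transform[OF R_holomorphic]) (simp add: F_def)
    show "?f holomorphic_on Dom"
    proof (rule holomorphic_on_paste_across_circle[OF open_domain])
      show "?f holomorphic_on Dom \<inter> ball 0 1" "?f holomorphic_on Dom \<inter> {z. 1 < norm z}"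
        by (rule holomorphic_on_subset[OF hol], force)+
      have "isCont ?f z" if z: "z \<in> Dom" for z
      proof (cases "norm z = 1")
        case False
        then show ?thesis
          using holomorphic_on_imp_continuous_on[OF hol] op by (simp add: continuous_on_eq_continuous_at)
      next
        case True
        then have \<mu>: "z \<in> \<Delta>"
          using z by auto
        have "(?f \<longlongrightarrow> ?f z) (at z within Z)"
          by (rule tendsto_cinner_left[OF op_tendsto_apply[OF F_lim[OF \<mu>]]]) simp
        moreover have "(?f \<longlongrightarrow> ?f z) (at z within E)"
        proof (rule Lim_transform_eventually)
          have "((\<lambda>w. cinner x (F w y)) \<longlongrightarrow> cinner x (F z y)) (at z within Z)"
            by (rule tendsto_cinner_right[OF op_tendsto_apply[OF F_lim[OF \<mu>]]]) simp
          then have "((\<lambda>w. cinner x (F (1 / cnj w) y)) \<longlongrightarrow> cinner x (F z y)) (at z within E)"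
            by (rule filterlim_compose[OF _ reflect[OF \<mu>]])
          then have "((\<lambda>w. cinner x y - cinner x (F (1 / cnj w) y)) \<longlongrightarrow> cinner x y - cinner x (F z y))
              (at z within E)"
            by (intro tendsto_diff tendsto_const)
          moreover have "cinner x y - cinner x (F z y) = ?f z"
            using F_half[OF \<mu>, of x y] by (simp add: diff_eq_eq)
          ultimately show "((\<lambda>w. cinner x y - cinner x (F (1 / cnj w) y)) \<longlongrightarrow> ?f z) (at z within E)"
            by simp
          show "\<forall>\<^sub>F w in at z within E. cinner x y - cinner x (F (1 / cnj w) y) = ?f w"
            using E_mem
          proof eventually_elim
            case (elim w)
            then show ?case
              using F_symm[of w x y] by (simp add: algebra_simps)
          qed
        qed
        ultimately show ?thesis
          unfolding continuous_at unfolding at_split[OF \<mu>] by (rule filterlim_sup)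
      qed
      then show "continuous_on Dom ?f"
        using continuous_at_imp_continuous_on by blast
    qed
  qed
  moreover have "F z h = R z h" if "norm z \<noteq> 1" for z h
    using that by (simp add: F_def)
  ultimately show ?thesis
    by blast
qed

end

section \<open>Analytic continuation across the arc\<close>

text \<open>The complement of the domain is the image of a compact interval.\<close>

lemma open_disc_exterior_arc:
  assumes "open_arc \<Delta>"
  shows "open (ball 0 1 \<union> {z. 1 < norm z} \<union> \<Delta>)"
proof -
  obtain a b where ab: "a < b" "b \<le> a + 2 * pi" "\<Delta> = cis ` {a<..<b}"
    using assms by (auto simp: open_arc_def)
  have "- (ball 0 1 \<union> {z. 1 < norm z} \<union> \<Delta>) = cis ` {b..a + 2 * pi}"
  proof (intro equalityI subsetI)
    fix z assume z: "z \<in> - (ball 0 1 \<union> {z. 1 < norm z} \<union> \<Delta>)"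
    then have nz: "norm z = 1"
      by auto
    \<comment> \<open>normalize the argument of \<open>z\<close> to the period \<open>{a<..a + 2 * pi}\<close>\<close>
    define n where "n = \<lfloor>(a - Arg z) / (2 * pi)\<rfloor> + 1"
    define t where "t = Arg z + 2 * pi * of_int n"
    have "z = cis (Arg z)"
      using nz cis_Arg[of z] by (force simp: sgn_div_norm)
    then have zt: "z = cis t"
      by (simp add: t_def flip: cis_mult)
    have "(a - Arg z) / (2 * pi) < of_int n" "of_int n \<le> (a - Arg z) / (2 * pi) + 1"
      unfolding n_def by linarith+
    then have "a < t" "t \<le> a + 2 * pi"
      by (simp_all add: t_def field_simps)
    moreover have "\<not> t < b"
      using z zt ab(3) \<open>a < t\<close> by auto
    ultimately show "z \<in> cis ` {b..a + 2 * pi}"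
      using zt by auto
  next
    fix z assume "z \<in> cis ` {b..a + 2 * pi}"
    then obtain t where t: "z = cis t" "b \<le> t" "t \<le> a + 2 * pi"
      by auto
    have "z \<notin> \<Delta>"
    proof
      assume "z \<in> \<Delta>"
      then obtain s where s: "a < s" "s < b" "cis t = cis s"
        using ab(3) t(1) by auto
      then have "cis (t - s) = 1"
        by (simp flip: cis_divide)
      then have "cos (t - s) = 1"
        by (metis cis.sel(1) one_complex.sel(1))
      then obtain k :: int where k: "t - s = of_int k * 2 * pi"
        using cos_one_2pi_int by blast
      have "0 < t - s" "t - s < 2 * pi"
        using s t by auto
      then have "0 < real_of_int k" "real_of_int k < 1"
        by (simp_all add: k zero_less_mult_iff)
      then have "0 < k" "k < 1"
        by simp_all
      then show False
        by simp
    qed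
    then show "z \<in> - (ball 0 1 \<union> {z. 1 < norm z} \<union> \<Delta>)"
      using t(1) by simp
  qed
  moreover have "compact (cis ` {b..a + 2 * pi})"
    by (intro compact_continuous_image continuous_intros compact_Icc)
  ultimately show ?thesis
    by (metis compact_imp_closed open_closed double_compl)
qed

theorem theorem5p4:
  fixes D :: "'h::complex_hilbert set" and V :: "'h \<Rightarrow> 'h"
    and \<Delta> \<Delta>1 :: "complex set" and z0 :: complex
    and R C :: "complex \<Rightarrow> 'h \<Rightarrow> 'h"
  assumes V: "closed_isometric_op D V"
    and arc: "open_arc \<Delta>"
    and regular: "\<And>\<zeta>. \<zeta> \<in> \<Delta> \<Longrightarrow> regular_type_point D V (inverse \<zeta>)"
    and z0: "z0 \<in> ball 0 1"
    and \<Delta>1: "\<Delta>1 = (\<lambda>\<mu>. (\<mu> - z0) / (1 - cnj z0 * \<mu>)) ` \<Delta>"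
    and proj: "\<And>\<zeta>. \<zeta> \<in> \<Delta>1 \<Longrightarrow>
      orth_proj (M_refl D V z0) ` M_space D V ((z0 + \<zeta>) / (1 + \<zeta> * cnj z0)) = M_refl D V z0"
    and R: "generalized_resolvent TYPE('k::complex_hilbert) D V R"
    and C: "C \<in> schur_class (N_space D V z0) (N_refl D V z0)"
    and Inin: "corresponds_Inin D V z0 C R"
  shows "(\<exists>F :: complex \<Rightarrow> 'h \<Rightarrow> 'h.
            op_analytic_on UNIV (ball 0 1 \<union> {z. norm z > 1} \<union> \<Delta>) F \<and>
            (\<forall>z \<in> ball 0 1 \<union> {z. norm z > 1}. \<forall>h. F z h = R z h))
     \<longleftrightarrow>
         (\<exists>Ce :: complex \<Rightarrow> 'h \<Rightarrow> 'h.
            (\<forall>\<mu> \<in> ball 0 1. \<forall>x \<in> N_space D V z0. Ce \<mu> x = C \<mu> x) \<and>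
            op_continuous_on (N_space D V z0) (ball 0 1 \<union> \<Delta>) Ce \<and>
            (\<forall>\<mu> \<in> \<Delta>. isometry_on (N_space D V z0) (Ce \<mu>) \<and>
               Ce \<mu> ` N_space D V z0 = N_refl D V z0) \<and>
            (\<forall>\<mu> \<in> \<Delta>. inj_on (\<lambda>x. Ce \<mu> x - W_op D V \<mu> z0 x) (N_space D V z0) \<and>
               (\<lambda>x. Ce \<mu> x - W_op D V \<mu> z0 x) ` N_space D V z0 = N_refl D V z0))"
proof -
  have nz0: "norm z0 < 1"
    using z0 by simp
  interpret isometric_op D V z0
    by unfold_locales (rule V nz0)+
  have circle: "norm \<mu> = 1" if "\<mu> \<in> \<Delta>" for \<mu>
    using arc that by (auto simp: open_arc_def)
  have proj': "orth_proj (M_refl D V z0) ` M_space D V \<mu> = M_refl D V z0" if \<mu>: "\<mu> \<in> \<Delta>" for \<mu>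
  proof -
    have "mob z0 \<mu> \<in> \<Delta>1"
      using \<mu> by (auto simp: \<Delta>1 mob_def)
    from proj[OF this] show ?thesis
      using mob_inverse[OF nz0, of \<mu>] circle[OF \<mu>] by simp
  qed
  interpret inin_pair D V z0 \<Delta> R C
  proof
    show "open (ball 0 1 \<union> {z. 1 < norm z} \<union> \<Delta>)"
      by (rule open_disc_exterior_arc[OF arc])
    show "norm \<mu> = 1" "regular_type_point D V (inverse \<mu>)"
      "orth_proj (M_refl D V z0) ` M_space D V \<mu> = M_refl D V z0" if "\<mu> \<in> \<Delta>" for \<mu>
      by (rule circle[OF that] regular[OF that] proj'[OF that])+
    show "clinear_on UNIV (R \<zeta>)" "norm (R \<zeta> x) \<le> norm x / \<bar>1 - norm \<zeta>\<bar>" if "norm \<zeta> \<noteq> 1" for \<zeta> x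
      by (rule generalized_resolvent_clinear[OF R that] generalized_resolvent_norm_le[OF R that])+
    show "(\<lambda>\<zeta>. cinner (R \<zeta> x) y) holomorphic_on {\<zeta>. norm \<zeta> \<noteq> 1}" for x y
      by (rule generalized_resolvent_holomorphic[OF R])
    show "cinner (R (1 / cnj \<zeta>) x) y + cinner x (R \<zeta> y) = cinner x y"
      if "norm \<zeta> \<noteq> 1" "\<zeta> \<noteq> 0" for \<zeta> x y
      by (rule generalized_resolvent_adjoint[OF R that])
  qed (rule C Inin)+
  have off_circle: "z \<in> ball 0 1 \<union> {z. norm z > 1} \<longleftrightarrow> norm z \<noteq> 1" for z :: complex
    by auto
  show ?thesis
    unfolding off_circle N_space_eq N_refl_eq
  proof (intro iffI; elim exE conjE)
    fix F assume "op_analytic_on UNIV Dom F" "\<forall>z\<in>ball 0 1 \<union> {z. 1 < norm z}. \<forall>h. F z h = R z h"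
    then show "\<exists>Ce. (\<forall>\<mu>\<in>ball 0 1. \<forall>x\<in>N. Ce \<mu> x = C \<mu> x) \<and> op_continuous_on N Z Ce \<and>
        (\<forall>\<mu>\<in>\<Delta>. isometry_on N (Ce \<mu>) \<and> Ce \<mu> ` N = N') \<and>
        (\<forall>\<mu>\<in>\<Delta>. inj_on (\<lambda>x. Ce \<mu> x - W_op D V \<mu> z0 x) N \<and>
          (\<lambda>x. Ce \<mu> x - W_op D V \<mu> z0 x) ` N = N')"
      using off_circle by (intro boundary_parameter_of_continuation) blast+
  next
    fix Ce
    assume Ce: "\<forall>\<mu>\<in>ball 0 1. \<forall>x\<in>N. Ce \<mu> x = C \<mu> x" "op_continuous_on N Z Ce"
      "\<forall>\<mu>\<in>\<Delta>. isometry_on N (Ce \<mu>) \<and> Ce \<mu> ` N = N'"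
      "\<forall>\<mu>\<in>\<Delta>. inj_on (\<lambda>x. Ce \<mu> x - W_op D V \<mu> z0 x) N \<and>
        (\<lambda>x. Ce \<mu> x - W_op D V \<mu> z0 x) ` N = N'"
    have "\<exists>F. op_analytic_on UNIV Dom F \<and> (\<forall>z. norm z \<noteq> 1 \<longrightarrow> (\<forall>h. F z h = R z h))"
      by (rule continuation_of_boundary_parameter[OF _ Ce(2)]) (use Ce(1,3,4) in auto)
    then show "\<exists>F. op_analytic_on UNIV Dom F \<and>
        (\<forall>z\<in>ball 0 1 \<union> {z. 1 < norm z}. \<forall>h. F z h = R z h)"
      using off_circle by blast
  qed
qed

end
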